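(* Let $r,s,t$ be independent indeterminates over $\mathbb{Q}$, let $K=\mathbb{Q}(r,s,t)$, and set $$A=9\left(r^6-r^3s^3+s^6-r^3t^3-s^3t^3+t^6\right),$$ $$\begin{aligned}B=-&(r+s+t)(r^2+2rs+s^2-rt-st+t^2)(r^2-rs+s^2+2rt-st+t^2)\\&\cdot(r^2-rs+s^2-rt+2st+t^2)(r^2-rs+s^2-rt-st+t^2),\end{aligned}$$ $$u=2t^3-r^3-s^3,\qquad v=2s^3-r^3-t^3,\qquad w=2r^3-s^3-t^3.$$ Then the points $(X,Y)=(r,w),(s,v),(t,u)$ lie on the curve $$Y^{3}=AX^{3}+B$$ over $K$. Moreover, the elliptic curve $$E_{r,s,t}:\quad y^{2}-ABy=x^{3}$$ over $K$ has three independent $K$-rational points, and the curve $Y^3=AX^3+B$, which is related to $E_{r,s,t}$ by a $3$-isogeny, has Mordell–Weil rank at least $3$ over $K$.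
   Context: The curve $Y^3=AX^3+B$ (a Selmer curve) is identified with its smooth projective closure, a plane cubic of genus one, made into an elliptic curve over $K$ by choosing a $K$-rational point on it (for instance $(r,w)$) as the identity; its rank does not depend on this choice. The identity of $E_{r,s,t}$ is its point at infinity. The curves are related by the degree-$3$ map $(X,Y)\mapsto (x,y)=(AXY,\,AY^{3})$ from $Y^3=AX^3+B$ to $E_{r,s,t}$. Points are called independent if they are $\mathbb{Z}$-linearly independent in the Mordell–Weil group. *)

theory Defs
  imports
    "HOL-Algebra.Algebraic_Closure_Type"
    "HOL-Computational_Algebra.Fraction_Field"
    "HOL-Library.Extended_Nat"
    "HOL-Library.Product_Plus"
begin

section \<open>The field of rational functions in three indeterminates\<close>

type_synonym rat_fun3 = "rat poly poly poly fract"

definition indet_r :: rat_fun3 where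
  "indet_r = Fraction_Field.Fract [:[:[:0, 1:]:]:] 1"

definition indet_s :: rat_fun3 where
  "indet_s = Fraction_Field.Fract [:[:0, 1:]:] 1"

definition indet_t :: rat_fun3 where
  "indet_t = Fraction_Field.Fract [:0, 1:] 1"


section \<open>The projective plane and ternary forms\<close>

type_synonym 'a vec3 = "'a \<times> 'a \<times> 'a"

text \<open>A point of the projective plane is the set of its homogeneous coordinate vectors.\<close>

type_synonym 'a ppoint = "'a vec3 set"

fun smul3 :: "'a::field \<Rightarrow> 'a vec3 \<Rightarrow> 'a vec3" where
  "smul3 k (x, y, z) = (k * x, k * y, k * z)"

fun map3 :: "('a \<Rightarrow> 'b) \<Rightarrow> 'a vec3 \<Rightarrow> 'b vec3" where
  "map3 f (x, y, z) = (f x, f y, f z)"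

definition proj :: "'a::field vec3 \<Rightarrow> 'a ppoint" where
  "proj v = {smul3 k v | k. k \<noteq> 0}"

text \<open>
  A ternary form of degree \<open>d\<close> is given by its coefficients: \<open>c i j\<close> belongs to the
  monomial \<open>X^i Y^j Z^(d-i-j)\<close>.  Only the coefficients with \<open>i + j \<le> d\<close> matter.
\<close>

type_synonym 'a form = "nat \<Rightarrow> nat \<Rightarrow> 'a"

definition form_eval :: "nat \<Rightarrow> 'a::comm_ring_1 form \<Rightarrow> 'a vec3 \<Rightarrow> 'a" where
  "form_eval d c = (\<lambda>(x, y, z). \<Sum>i\<le>d. \<Sum>j\<le>d - i. c i j * x ^ i * y ^ j * z ^ (d - i - j))"

text \<open>Formal partial derivatives; they turn a form of degree \<open>d\<close> into one of degree \<open>d - 1\<close>.\<close>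

definition form_dX :: "'a::comm_ring_1 form \<Rightarrow> 'a form" where
  "form_dX c = (\<lambda>i j. of_nat (i + 1) * c (i + 1) j)"

definition form_dY :: "'a::comm_ring_1 form \<Rightarrow> 'a form" where
  "form_dY c = (\<lambda>i j. of_nat (j + 1) * c i (j + 1))"

definition form_dZ :: "nat \<Rightarrow> 'a::comm_ring_1 form \<Rightarrow> 'a form" where
  "form_dZ d c = (\<lambda>i j. of_nat (d - i - j) * c i j)"


section \<open>Plane cubics\<close>

definition cubic_points :: "'a::field form \<Rightarrow> 'a ppoint set" where
  "cubic_points c = {proj v | v. v \<noteq> 0 \<and> form_eval 3 c v = 0}"

definition ac_form :: "'a::field form \<Rightarrow> 'a alg_closure form" where
  "ac_form c = (\<lambda>i j. to_ac (c i j))"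

definition ac_point :: "'a::field ppoint \<Rightarrow> 'a alg_closure ppoint" where
  "ac_point P = {smul3 k (map3 to_ac v) | k v. k \<noteq> 0 \<and> v \<in> P}"

definition smooth_cubic :: "'a::field form \<Rightarrow> bool" where
  "smooth_cubic c \<longleftrightarrow>
     \<not> (\<exists>v. v \<noteq> 0 \<and> form_eval 3 (ac_form c) v = 0 \<and>
            form_eval 2 (form_dX (ac_form c)) v = 0 \<and>
            form_eval 2 (form_dY (ac_form c)) v = 0 \<and>
            form_eval 2 (form_dZ 3 (ac_form c)) v = 0)"

definition elliptic_curve :: "'a::field form \<Rightarrow> 'a ppoint \<Rightarrow> bool" where
  "elliptic_curve c Z \<longleftrightarrow> smooth_cubic c \<and> Z \<in> cubic_points c"

text \<open>
  \<open>line_section c P Q R\<close>: some line meets the cubic exactly in \<open>P\<close>, \<open>Q\<close>, \<open>R\<close>, counted with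
  multiplicity.  The line is spanned by \<open>a\<close> and \<open>b\<close>, and on it the cubic form factors into the
  three linear forms that vanish at \<open>P\<close>, \<open>Q\<close> and \<open>R\<close>.  (Comparing values is the same as
  comparing polynomials in \<open>x\<close> and \<open>y\<close>, because all fields used below are infinite.)
\<close>

definition line_section ::
  "'a::field form \<Rightarrow> 'a ppoint \<Rightarrow> 'a ppoint \<Rightarrow> 'a ppoint \<Rightarrow> bool" where
  "line_section c P Q R \<longleftrightarrow>
     (\<exists>a b k p1 p2 q1 q2 r1 r2.
        (\<forall>x y. smul3 x a + smul3 y b = 0 \<longrightarrow> x = 0 \<and> y = 0) \<and>
        k \<noteq> 0 \<and> (p1, p2) \<noteq> (0, 0) \<and> (q1, q2) \<noteq> (0, 0) \<and> (r1, r2) \<noteq> (0, 0) \<and>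
        P = proj (smul3 p1 a + smul3 p2 b) \<and>
        Q = proj (smul3 q1 a + smul3 q2 b) \<and>
        R = proj (smul3 r1 a + smul3 r2 b) \<and>
        (\<forall>x y. form_eval 3 c (smul3 x a + smul3 y b) =
           k * (x * p2 - y * p1) * (x * q2 - y * q1) * (x * r2 - y * r1)))"

definition third_point :: "'a::field form \<Rightarrow> 'a ppoint \<Rightarrow> 'a ppoint \<Rightarrow> 'a ppoint" where
  "third_point c P Q = (THE R. line_section c P Q R)"

text \<open>The Mordell--Weil group (chord-tangent law) of a smooth cubic with identity \<open>Z\<close>.
  The base point \<open>Z\<close> need not be an inflection point.\<close>

definition mw_group :: "'a::field form \<Rightarrow> 'a ppoint \<Rightarrow> 'a ppoint monoid" where
  "mw_group c Z =
     \<lparr> carrier = cubic_points c,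
       monoid.mult = (\<lambda>P Q. third_point c Z (third_point c P Q)),
       monoid.one = Z \<rparr>"


section \<open>Independence and rank in (multiplicatively written) abelian groups\<close>

definition Z_independent :: "('g, 'b) monoid_scheme \<Rightarrow> 'g list \<Rightarrow> bool" where
  "Z_independent G Ps \<longleftrightarrow> set Ps \<subseteq> carrier G \<and>
     (\<forall>ns :: int list. length ns = length Ps \<longrightarrow>
        foldr (\<lambda>(n, P) S. (P [^]\<^bsub>G\<^esub> n) \<otimes>\<^bsub>G\<^esub> S) (zip ns Ps) \<one>\<^bsub>G\<^esub> = \<one>\<^bsub>G\<^esub> \<longrightarrow>
        (\<forall>n\<in>set ns. n = 0))"

definition group_rank :: "('g, 'b) monoid_scheme \<Rightarrow> enat" where
  "group_rank G = Sup {enat (length Ps) | Ps. Z_independent G Ps}"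


section \<open>Morphisms and isogenies\<close>

text \<open>
  A morphism over the base field is a map on geometric points that, near every point, is given by
  three forms of the same degree with coefficients in the base field.
\<close>

definition is_morphism ::
  "'a::field form \<Rightarrow> 'a form \<Rightarrow> ('a alg_closure ppoint \<Rightarrow> 'a alg_closure ppoint) \<Rightarrow> bool" where
  "is_morphism c c' f \<longleftrightarrow>
     f ` cubic_points (ac_form c) \<subseteq> cubic_points (ac_form c') \<and>
     (\<forall>v. v \<noteq> 0 \<and> form_eval 3 (ac_form c) v = 0 \<longrightarrow>
        (\<exists>d g0 g1 g2.
           let g = (\<lambda>w. (form_eval d (ac_form g0) w, form_eval d (ac_form g1) w,
                         form_eval d (ac_form g2) w))
           in g v \<noteq> 0 \<and>
              (\<forall>w. w \<noteq> 0 \<and> form_eval 3 (ac_form c) w = 0 \<and> g w \<noteq> 0 \<longrightarrow>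
                 f (proj w) = proj (g w))))"

text \<open>
  The degree of a non-constant morphism of smooth curves in characteristic 0 (where the function
  field extension is separable) is the number of geometric points in all but finitely many fibres.
\<close>

definition has_degree ::
  "'a::field_char_0 form \<Rightarrow> 'a form \<Rightarrow> ('a alg_closure ppoint \<Rightarrow> 'a alg_closure ppoint) \<Rightarrow> nat \<Rightarrow> bool"
where
  "has_degree c c' f n \<longleftrightarrow> n > 0 \<and>
     finite {Q \<in> cubic_points (ac_form c'). card {P \<in> cubic_points (ac_form c). f P = Q} \<noteq> n}"

definition is_isogeny ::
  "'a::field_char_0 form \<Rightarrow> 'a ppoint \<Rightarrow> 'a form \<Rightarrow> 'a ppoint \<Rightarrow>
   ('a alg_closure ppoint \<Rightarrow> 'a alg_closure ppoint) \<Rightarrow> nat \<Rightarrow> bool" where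
  "is_isogeny c Z c' Z' f n \<longleftrightarrow>
     elliptic_curve c Z \<and> elliptic_curve c' Z' \<and>
     is_morphism c c' f \<and> f (ac_point Z) = ac_point Z' \<and> has_degree c c' f n"


section \<open>The two curves and the map between them\<close>

text \<open>\<open>Y\<^sup>3 - A X\<^sup>3 - B Z\<^sup>3\<close>\<close>

definition selmer_form :: "'a::field \<Rightarrow> 'a \<Rightarrow> 'a form" where
  "selmer_form A B = (\<lambda>i j. if (i, j) = (0, 3) then 1 else if (i, j) = (3, 0) then - A
                            else if (i, j) = (0, 0) then - B else 0)"

text \<open>\<open>Y\<^sup>2 Z - A B Y Z\<^sup>2 - X\<^sup>3\<close>\<close>

definition E_form :: "'a::field \<Rightarrow> 'a \<Rightarrow> 'a form" where
  "E_form A B = (\<lambda>i j. if (i, j) = (0, 2) then 1 else if (i, j) = (0, 1) then - (A * B)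
                       else if (i, j) = (3, 0) then - 1 else 0)"

definition E_infinity :: "'a::field ppoint" where
  "E_infinity = proj (0, 1, 0)"

text \<open>The homogenization of \<open>(X, Y) \<mapsto> (A X Y, A Y\<^sup>3)\<close>.\<close>

definition selmer_map :: "'a::field \<Rightarrow> 'a ppoint \<Rightarrow> 'a ppoint" where
  "selmer_map A P =
     {smul3 k (A * x * y * z, A * y ^ 3, z ^ 3) | k x y z. k \<noteq> 0 \<and> (x, y, z) \<in> P}"

lemma form_eval_selmer:
  "form_eval 3 (selmer_form A B) (x, y, z) = y ^ 3 - A * x ^ 3 - B * z ^ 3"
  by (simp add: form_eval_def selmer_form_def eval_nat_numeral)

lemma form_eval_E:
  "form_eval 3 (E_form A B) (x, y, z) = y ^ 2 * z - A * B * y * z ^ 2 - x ^ 3"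
  by (simp add: form_eval_def E_form_def eval_nat_numeral)

lemma proj_in_cubic_points_iff:
  assumes "v \<noteq> 0"
  shows "proj v \<in> cubic_points c \<longleftrightarrow> form_eval 3 c v = 0"
proof
  assume "proj v \<in> cubic_points c"
  then obtain w where w: "form_eval 3 c w = 0" "proj v = proj w"
    by (auto simp: cubic_points_def)
  obtain x y z where xyz: "w = (x, y, z)" by (cases w)
  have "v \<in> proj v" unfolding proj_def by (cases v) (auto intro!: exI[of _ 1])
  with w obtain k where k: "v = smul3 k w" by (auto simp: proj_def)
  have "form_eval 3 c v = k ^ 3 * form_eval 3 c w"
    by (simp add: k xyz form_eval_def eval_nat_numeral algebra_simps)
  with w show "form_eval 3 c v = 0" by simp
next
  assume "form_eval 3 c v = 0"
  with assms show "proj v \<in> cubic_points c" unfolding cubic_points_def by blast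
qed

lemma selmer_affine_iff:
  fixes A B x y :: "'k::field"
  shows "proj (x, y, 1) \<in> cubic_points (selmer_form A B) \<longleftrightarrow> y ^ 3 = A * x ^ 3 + B"
proof -
  have "(x, y, 1::'k) \<noteq> 0" by (simp add: zero_prod_def)
  then show ?thesis
    by (simp add: proj_in_cubic_points_iff form_eval_selmer diff_eq_eq add.commute)
qed

lemma E_affine_iff:
  fixes A B x y :: "'k::field"
  shows "proj (x, y, 1) \<in> cubic_points (E_form A B) \<longleftrightarrow> y ^ 2 - A * B * y = x ^ 3"
proof -
  have "(x, y, 1::'k) \<noteq> 0" by (simp add: zero_prod_def)
  then show ?thesis
    by (simp add: proj_in_cubic_points_iff form_eval_E)
qed

end

theory Submission
  imports Defs
begin

text \<open>
  Specialize at the prime \<open>r + s + t\<close>, which divides \<open>B\<close> exactly once and does not divide \<open>A\<close>.  The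
  residue field is \<open>\<rat>(r, s)\<close>.  Both curves acquire additive reduction: \<open>E\<close> becomes the cuspidal cubic
  \<open>y\<^sup>2 z = x\<^sup>3\<close>, whose smooth points form the additive group with coordinate \<open>x / y\<close>, and the Selmer
  curve becomes three concurrent lines, of which only one is rational over \<open>\<rat>(r, s)\<close>.  On
  that line \<open>z / y\<close> is an additive coordinate, and every rational point reduces to a point of this line
  other than the common point.  In both cases the reduced coordinate sums to zero on the three
  points of a line section (\<open>E0_line_section\<close>, \<open>selmer_line_section_sum\<close>), so up to a constant it is a homomorphism
  from the Mordell--Weil group, or on \<open>E\<close> from the subgroup of points with nonsingular reduction,
  to a torsion-free group (\<open>Z_independentI\<close>).  The three given points have coordinates proportional
  to \<open>1 / r\<close>, \<open>1 / s\<close> and \<open>- 1 / (r + s)\<close>, which are linearly independent over the rationals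
  (\<open>reciprocals_independent\<close>).  This gives the independence on \<open>E\<close>.  On the Selmer curve with an arbitrary base
  point \<open>Z\<close> the differences \<open>P - Z\<close> can be dependent; the classes \<open>3 P - H\<close>, with \<open>H\<close> the class of a
  line section, do not involve \<open>Z\<close> and yield rank 3 (\<open>selmer_rank\<close>).

  The group law enters through the third intersection point, a totally symmetric operation
  \<open>(P, Q) \<mapsto> P * Q\<close> with \<open>P * (P * Q) = Q\<close> (locale \<open>line_cubic\<close>).

  The map \<open>(X, Y) \<mapsto> (A X Y, A Y\<^sup>3)\<close> is given by monomials and has three preimages over almost every
  point.  To see that its translates are morphisms, the sum of two points of \<open>E\<close> is needed
  by formulas that together have no common zeros.  The chord formula fails only where the two points
  coincide.  A second formula arises from the identity \<open>P + N = (P + S) + (N - S)\<close> for the rational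
  point \<open>S = (0, 0, 1)\<close> of order 3, because translation by \<open>S\<close> is linear (\<open>third_rot\<close>); it is valid where \<open>P = N\<close>.
\<close>

section \<open>Chords and tangents of plane cubics\<close>

text \<open>
  \<open>polar c p q\<close> is the derivative of the cubic form at \<open>p\<close> in the direction \<open>q\<close>.  Its role is the
  expansion of the form along a line (\<open>form_eval_taylor\<close>), from which every intersection number
  used below is read off.
\<close>

definition polar :: "'a::comm_ring_1 form \<Rightarrow> 'a vec3 \<Rightarrow> 'a vec3 \<Rightarrow> 'a" where
  "polar c p q = fst q * form_eval 2 (form_dX c) p + fst (snd q) * form_eval 2 (form_dY c) p
                 + snd (snd q) * form_eval 2 (form_dZ 3 c) p"

definition indep :: "'a::field vec3 \<Rightarrow> 'a vec3 \<Rightarrow> bool" where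
  "indep a b \<longleftrightarrow> (\<forall>x y. smul3 x a + smul3 y b = 0 \<longrightarrow> x = 0 \<and> y = 0)"

lemma zero_vec3: "(0::'a::zero vec3) = (0, 0, 0)"
  by (simp add: zero_prod_def)

lemma form_eval_taylor:
  fixes c :: "'a::field form"
  shows "form_eval 3 c (smul3 x p + smul3 y q) =
    x^3 * form_eval 3 c p + x^2 * y * polar c p q + x * y^2 * polar c q p + y^3 * form_eval 3 c q"
proof -
  obtain p1 p2 p3 where p: "p = (p1, p2, p3)" by (cases p)
  obtain q1 q2 q3 where q: "q = (q1, q2, q3)" by (cases q)
  show ?thesis
    unfolding p q polar_def form_eval_def form_dX_def form_dY_def form_dZ_def
    by (simp add: eval_nat_numeral algebra_simps)
qed

lemma polar_self: "polar c p p = 3 * form_eval 3 c (p :: 'a::field vec3)"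
proof -
  obtain p1 p2 p3 where p: "p = (p1, p2, p3)" by (cases p)
  show ?thesis
    unfolding p polar_def form_eval_def form_dX_def form_dY_def form_dZ_def
    by (simp add: eval_nat_numeral algebra_simps)
qed

lemma smul3_assoc: "smul3 a (smul3 b p) = smul3 (a * b) p"
  by (cases p) (simp add: mult.assoc)

lemma smul3_add: "smul3 a (p + q) = smul3 a p + smul3 a q"
  by (cases p; cases q) (simp add: algebra_simps)

lemma smul3_one [simp]: "smul3 1 p = p"
  by (cases p) simp

lemma smul3_comb:
  "smul3 x (smul3 a p + smul3 b q) + smul3 y (smul3 a' p + smul3 b' q) =
   smul3 (x * a + y * a') p + smul3 (x * b + y * b') q"
  by (cases p; cases q) (simp add: algebra_simps)

lemma smul3_eq_0_iff: "smul3 k p = 0 \<longleftrightarrow> k = 0 \<or> p = 0"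
  by (cases p) (auto simp: zero_vec3)

lemma self_in_proj: "v \<in> proj v"
  unfolding proj_def using smul3_one[of v] zero_neq_one by (metis (mono_tags, lifting) mem_Collect_eq)

lemma proj_eq_iff: "proj v = proj w \<longleftrightarrow> (\<exists>k. k \<noteq> 0 \<and> v = smul3 k w)"
proof
  assume "proj v = proj w"
  moreover have "v \<in> proj v" by (rule self_in_proj)
  ultimately show "\<exists>k. k \<noteq> 0 \<and> v = smul3 k w" by (auto simp: proj_def)
next
  assume "\<exists>k. k \<noteq> 0 \<and> v = smul3 k w"
  then obtain k where k: "k \<noteq> 0" "v = smul3 k w" by auto
  show "proj v = proj w"
  proof (intro Set.set_eqI iffI)
    fix u assume "u \<in> proj v"
    then obtain l where l: "l \<noteq> 0" "u = smul3 l v" by (auto simp: proj_def)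
    then show "u \<in> proj w" using k
      by (auto simp: proj_def smul3_assoc intro!: exI[of _ "l * k"])
  next
    fix u assume "u \<in> proj w"
    then obtain l where l: "l \<noteq> 0" "u = smul3 l w" by (auto simp: proj_def)
    then show "u \<in> proj v" using k
      by (auto simp: proj_def smul3_assoc intro!: exI[of _ "l / k"])
  qed
qed

lemma proj_smul: "k \<noteq> 0 \<Longrightarrow> proj (smul3 k v) = proj v"
  by (auto simp: proj_eq_iff)

lemma indep_iff: "p \<noteq> 0 \<Longrightarrow> q \<noteq> 0 \<Longrightarrow> indep p q \<longleftrightarrow> proj p \<noteq> proj q"
proof -
  assume nz: "p \<noteq> 0" "q \<noteq> 0"
  have "\<not> indep p q" if pq: "proj p = proj q"
  proof -
    obtain k where "k \<noteq> 0" "p = smul3 k q" using pq by (auto simp: proj_eq_iff)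
    then have "smul3 1 p + smul3 (-k) q = 0" by (cases q) (simp add: zero_vec3)
    then show ?thesis unfolding indep_def by (metis one_neq_zero)
  qed
  moreover have "proj p = proj q" if nind: "\<not> indep p q"
  proof -
    obtain x y where xy: "smul3 x p + smul3 y q = 0" "x \<noteq> 0 \<or> y \<noteq> 0"
      using nind unfolding indep_def by blast
    have e: "smul3 x p = smul3 (-y) q"
      using xy(1) by (cases p; cases q) (simp add: zero_vec3 add_eq_0_iff)
    have "x \<noteq> 0" "y \<noteq> 0" using e xy(2) nz by (auto simp: smul3_eq_0_iff) 
      (metis (no_types) add.inverse_neutral neg_equal_0_iff_equal smul3_eq_0_iff)+
    have "p = smul3 (inverse x * (- y)) q"
      using arg_cong[OF e, of "smul3 (inverse x)"] \<open>x \<noteq> 0\<close> by (simp add: smul3_assoc)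
    then show ?thesis using \<open>x \<noteq> 0\<close> \<open>y \<noteq> 0\<close>
      by (auto simp: proj_eq_iff intro!: exI[of _ "inverse x * (-y)"])
  qed
  ultimately show ?thesis by blast
qed

lemma indep_nonzero: "indep p q \<Longrightarrow> (x, y) \<noteq> (0, 0) \<Longrightarrow> smul3 x p + smul3 y q \<noteq> 0"
  by (auto simp: indep_def)

lemma cubic_pointsE:
  assumes "P \<in> cubic_points c"
  obtains p where "P = proj p" "p \<noteq> 0" "form_eval 3 c p = 0"
  using assms by (auto simp: cubic_points_def)

lemma cubic_pointsI: "p \<noteq> 0 \<Longrightarrow> form_eval 3 c p = 0 \<Longrightarrow> proj p \<in> cubic_points c"
  unfolding cubic_points_def by blast

lemma line_section_swap12:
  assumes "line_section c P Q R" shows "line_section c Q P R"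
proof -
  obtain a b k p1 p2 q1 q2 r1 r2 where *:
    "\<forall>x y. smul3 x a + smul3 y b = 0 \<longrightarrow> x = 0 \<and> y = 0" "k \<noteq> 0" "(p1, p2) \<noteq> (0, 0)"
    "(q1, q2) \<noteq> (0, 0)" "(r1, r2) \<noteq> (0, 0)" "P = proj (smul3 p1 a + smul3 p2 b)"
    "Q = proj (smul3 q1 a + smul3 q2 b)" "R = proj (smul3 r1 a + smul3 r2 b)"
    "\<forall>x y. form_eval 3 c (smul3 x a + smul3 y b) =
       k * (x * p2 - y * p1) * (x * q2 - y * q1) * (x * r2 - y * r1)"
    using assms unfolding line_section_def by blast
  have "\<forall>x y. form_eval 3 c (smul3 x a + smul3 y b) =
       k * (x * q2 - y * q1) * (x * p2 - y * p1) * (x * r2 - y * r1)"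
    unfolding *(9)[rule_format] by (simp add: mult_ac)
  then show ?thesis unfolding line_section_def using *(1-8) by blast
qed

lemma line_section_swap23:
  assumes "line_section c P Q R" shows "line_section c P R Q"
proof -
  obtain a b k p1 p2 q1 q2 r1 r2 where *:
    "\<forall>x y. smul3 x a + smul3 y b = 0 \<longrightarrow> x = 0 \<and> y = 0" "k \<noteq> 0" "(p1, p2) \<noteq> (0, 0)"
    "(q1, q2) \<noteq> (0, 0)" "(r1, r2) \<noteq> (0, 0)" "P = proj (smul3 p1 a + smul3 p2 b)"
    "Q = proj (smul3 q1 a + smul3 q2 b)" "R = proj (smul3 r1 a + smul3 r2 b)"
    "\<forall>x y. form_eval 3 c (smul3 x a + smul3 y b) =
       k * (x * p2 - y * p1) * (x * q2 - y * q1) * (x * r2 - y * r1)"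
    using assms unfolding line_section_def by blast
  have "\<forall>x y. form_eval 3 c (smul3 x a + smul3 y b) =
       k * (x * p2 - y * p1) * (x * r2 - y * r1) * (x * q2 - y * q1)"
    unfolding *(9)[rule_format] by (simp add: mult_ac)
  then show ?thesis unfolding line_section_def using *(1-8) by blast
qed

lemma line_section_point:
  assumes "line_section c P Q R" shows "P \<in> cubic_points c"
proof -
  obtain a b k p1 p2 q1 q2 r1 r2 where *:
        "indep a b" "(p1, p2) \<noteq> (0, 0)"
        "P = proj (smul3 p1 a + smul3 p2 b)"
        "(\<forall>x y. form_eval 3 c (smul3 x a + smul3 y b) =
           k * (x * p2 - y * p1) * (x * q2 - y * q1) * (x * r2 - y * r1))"
    using assms unfolding line_section_def indep_def by blast
  show ?thesis unfolding *(3)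
  proof (rule cubic_pointsI)
    show "smul3 p1 a + smul3 p2 b \<noteq> 0" using *(1,2) by (rule indep_nonzero)
    show "form_eval 3 c (smul3 p1 a + smul3 p2 b) = 0" unfolding *(4)[rule_format] by simp
  qed
qed

text \<open>
  The line and the reference vectors \<open>a\<close>, \<open>b\<close> in the definition of \<open>line_section\<close> are arbitrary.  Here
  the first reference vector becomes a given representative of one of the three points, so that the
  factor belonging to this point is the second coordinate on the line.
\<close>

lemma line_section_frame:
  assumes ls: "line_section c (proj p) Q R" and p: "p \<noteq> 0"
  obtains d k q1 q2 r1 r2 where "indep p d" "k \<noteq> 0" "(q1, q2) \<noteq> (0, 0)" "(r1, r2) \<noteq> (0, 0)"
    "Q = proj (smul3 q1 p + smul3 q2 d)" "R = proj (smul3 r1 p + smul3 r2 d)"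
    "\<And>x y. form_eval 3 c (smul3 x p + smul3 y d) = k * y * (x * q2 - y * q1) * (x * r2 - y * r1)"
proof -
  obtain a b k u1 u2 q1 q2 r1 r2 where *:
        "indep a b" "k \<noteq> 0" "(u1, u2) \<noteq> (0, 0)" "(q1, q2) \<noteq> (0, 0)" "(r1, r2) \<noteq> (0, 0)"
        "proj p = proj (smul3 u1 a + smul3 u2 b)"
        "Q = proj (smul3 q1 a + smul3 q2 b)"
        "R = proj (smul3 r1 a + smul3 r2 b)"
        "\<And>x y. form_eval 3 c (smul3 x a + smul3 y b) =
           k * (x * u2 - y * u1) * (x * q2 - y * q1) * (x * r2 - y * r1)"
    using ls unfolding line_section_def indep_def by blast
  obtain l where l: "l \<noteq> 0" "p = smul3 l (smul3 u1 a + smul3 u2 b)"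
    using *(6) by (auto simp: proj_eq_iff)
  define p1 p2 where "p1 = l * u1" and "p2 = l * u2"
  have p_eq: "p = smul3 p1 a + smul3 p2 b"
    by (simp add: l(2) p1_def p2_def smul3_add smul3_assoc)
  \<comment> \<open>complete \<open>(p1, p2)\<close> to a basis of determinant 1\<close>
  have "p1 \<noteq> 0 \<or> p2 \<noteq> 0" using l(1) *(3) by (auto simp: p1_def p2_def)
  then have "p1 * (1 / p1) - p2 * 0 = 1 \<or> p1 * 0 - p2 * (- 1 / p2) = 1" by auto
  then obtain d1 d2 where det: "p1 * d2 - p2 * d1 = 1" by blast
  define d where "d = smul3 d1 a + smul3 d2 b"
  have vec: "smul3 x a + smul3 y b = smul3 (x * d2 - y * d1) p + smul3 (y * p1 - x * p2) d" for x y
  proof -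
    have "(x * d2 - y * d1) * p1 + (y * p1 - x * p2) * d1 = x * (p1 * d2 - p2 * d1)"
         "(x * d2 - y * d1) * p2 + (y * p1 - x * p2) * d2 = y * (p1 * d2 - p2 * d1)"
      by (simp_all add: algebra_simps)
    then show ?thesis unfolding p_eq d_def smul3_comb det by simp
  qed
  have vec': "smul3 x p + smul3 y d = smul3 (x * p1 + y * d1) a + smul3 (x * p2 + y * d2) b" for x y
    unfolding p_eq d_def smul3_comb ..
  have "indep p d"
    unfolding indep_def
  proof (intro allI impI)
    fix x y assume "smul3 x p + smul3 y d = 0"
    then have "x * p1 + y * d1 = 0" "x * p2 + y * d2 = 0"
      using *(1) unfolding vec' indep_def by blast+
    moreover have "x * (p1 * d2 - p2 * d1) = d2 * (x * p1 + y * d1) - d1 * (x * p2 + y * d2)"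
      "y * (p1 * d2 - p2 * d1) = p1 * (x * p2 + y * d2) - p2 * (x * p1 + y * d1)"
      by (simp_all add: algebra_simps)
    ultimately show "x = 0 \<and> y = 0" unfolding det by auto
  qed
  have nz: "(x * d2 - y * d1, y * p1 - x * p2) \<noteq> (0, 0)" if "(x, y) \<noteq> (0, 0)" for x y
  proof
    assume "(x * d2 - y * d1, y * p1 - x * p2) = (0, 0)"
    then have "x * d2 - y * d1 = 0" "y * p1 - x * p2 = 0" by auto
    moreover have "x * (p1 * d2 - p2 * d1) = p1 * (x * d2 - y * d1) + d1 * (y * p1 - x * p2)"
      "y * (p1 * d2 - p2 * d1) = p2 * (x * d2 - y * d1) + d2 * (y * p1 - x * p2)"
      by (simp_all add: algebra_simps)
    ultimately show False using that unfolding det by auto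
  qed
  show ?thesis
  proof (rule that[of d "- k / l"])
    show "indep p d" by fact
    show "- k / l \<noteq> 0" using *(2) l(1) by simp
    show "Q = proj (smul3 (q1 * d2 - q2 * d1) p + smul3 (q2 * p1 - q1 * p2) d)"
      unfolding *(7) vec ..
    show "R = proj (smul3 (r1 * d2 - r2 * d1) p + smul3 (r2 * p1 - r1 * p2) d)"
      unfolding *(8) vec ..
    show "form_eval 3 c (smul3 x p + smul3 y d) = - k / l * y *
         (x * (q2 * p1 - q1 * p2) - y * (q1 * d2 - q2 * d1)) *
         (x * (r2 * p1 - r1 * p2) - y * (r1 * d2 - r2 * d1))" for x y
    proof -
      have "l * ((x * p1 + y * d1) * u2 - (x * p2 + y * d2) * u1) = - y * (p1 * d2 - p2 * d1)"
        by (simp add: p1_def p2_def algebra_simps)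
      then have "l * ((x * p1 + y * d1) * u2 - (x * p2 + y * d2) * u1) = - y" unfolding det by simp
      then have 1: "(x * p1 + y * d1) * u2 - (x * p2 + y * d2) * u1 = - y / l"
        using l(1) by (metis nonzero_mult_div_cancel_left)
      show ?thesis unfolding vec' *(9) 1 by (simp add: algebra_simps)
    qed
  qed (use nz *(4,5) in auto)
qed

lemma line_section_chord_frame:
  assumes ls: "line_section c (proj p) (proj q) R" and pq: "indep p q"
  obtains k m n where "k \<noteq> 0" "(m, n) \<noteq> (0, 0)" "R = proj (smul3 m p + smul3 n q)"
    "\<And>x y. form_eval 3 c (smul3 x p + smul3 y q) = k * x * y * (x * n - y * m)"
proof -
  have "p \<noteq> 0" using indep_nonzero[OF pq, of 1 0] by (cases p; cases q) (auto simp: zero_vec3)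
  then obtain d k u1 u2 r1 r2 where *: "indep p d" "k \<noteq> 0" "(u1, u2) \<noteq> (0, 0)" "(r1, r2) \<noteq> (0, 0)"
    "proj q = proj (smul3 u1 p + smul3 u2 d)" "R = proj (smul3 r1 p + smul3 r2 d)"
    "\<And>x y. form_eval 3 c (smul3 x p + smul3 y d) = k * y * (x * u2 - y * u1) * (x * r2 - y * r1)"
    using line_section_frame[OF ls] by blast
  obtain l where l: "l \<noteq> 0" "q = smul3 l (smul3 u1 p + smul3 u2 d)"
    using *(5) by (auto simp: proj_eq_iff)
  define q1 q2 where "q1 = l * u1" and "q2 = l * u2"
  have q_eq: "q = smul3 q1 p + smul3 q2 d"
    by (simp add: l(2) q1_def q2_def smul3_add smul3_assoc)
  have q2: "q2 \<noteq> 0"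
  proof
    assume "q2 = 0"
    then have "smul3 q1 p + smul3 (- 1) q = 0"
      unfolding q_eq by (cases p; cases d) (simp add: zero_vec3)
    then show False using pq unfolding indep_def by (metis neg_equal_0_iff_equal zero_neq_one)
  qed
  have vec: "smul3 x p + smul3 y q = smul3 (x + y * q1) p + smul3 (y * q2) d" for x y
    unfolding q_eq by (cases p; cases d) (simp add: algebra_simps)
  show ?thesis
  proof (rule that[of "k * q2 * q2 * u2" "r1 - r2 * q1 / q2" "r2 / q2"])
    show "k * q2 * q2 * u2 \<noteq> 0" using *(2) q2 by (auto simp: q2_def)
    show "(r1 - r2 * q1 / q2, r2 / q2) \<noteq> (0, 0)" using *(4) q2 by auto
    show "R = proj (smul3 (r1 - r2 * q1 / q2) p + smul3 (r2 / q2) q)"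
      unfolding *(6) vec using q2 by simp
    show "form_eval 3 c (smul3 x p + smul3 y q) =
          k * q2 * q2 * u2 * x * y * (x * (r2 / q2) - y * (r1 - r2 * q1 / q2))" for x y
    proof -
      have "(x + y * q1) * u2 - y * q2 * u1 = x * u2" by (simp add: q1_def q2_def algebra_simps)
      moreover have "(x + y * q1) * r2 - y * q2 * r1 = q2 * (x * (r2 / q2) - y * (r1 - r2 * q1 / q2))"
        using q2 by (simp add: field_simps)
      ultimately show ?thesis unfolding vec *(7) by simp
    qed
  qed
qed

text \<open>
  On the line through \<open>p\<close> and \<open>q\<close> the form is \<open>x y (L x + M y)\<close> with \<open>L = polar c p q\<close> and
  \<open>M = polar c q p\<close>, whose third zero is \<open>(x, y) = (M, - L)\<close>.
\<close>

lemma line_section_chord_iff: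
  fixes c :: "'a::field_char_0 form"
  assumes F: "form_eval 3 c p = 0" "form_eval 3 c q = 0" and pq: "indep p q"
    and nl: "(polar c p q, polar c q p) \<noteq> (0, 0)"
  shows "line_section c (proj p) (proj q) R \<longleftrightarrow>
         R = proj (smul3 (polar c q p) p + smul3 (- polar c p q) q)"
proof
  assume "line_section c (proj p) (proj q) R"
  then obtain k m n where *: "k \<noteq> 0" "(m, n) \<noteq> (0, 0)" "R = proj (smul3 m p + smul3 n q)"
    "\<And>x y. form_eval 3 c (smul3 x p + smul3 y q) = k * x * y * (x * n - y * m)"
    using line_section_chord_frame[OF _ pq] by blast
  \<comment> \<open>evaluate at \<open>(1, 1)\<close> and \<open>(1, -1)\<close>\<close>
  have "polar c p q + polar c q p = k * (n - m)" "polar c q p - polar c p q = - k * (n + m)"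
    using *(4)[of 1 1] *(4)[of 1 "-1"] unfolding form_eval_taylor by (simp_all add: F)
  from arg_cong2[OF this, of "(-)"] arg_cong2[OF this, of "(+)"]
  have "2 * polar c p q = 2 * (k * n)" "2 * polar c q p = 2 * (- k * m)"
    by (simp_all add: algebra_simps)
  then have "polar c p q = k * n" "polar c q p = - k * m" by simp_all
  then have "smul3 (polar c q p) p + smul3 (- polar c p q) q = smul3 (- k) (smul3 m p + smul3 n q)"
    by (simp add: smul3_add smul3_assoc)
  then show "R = proj (smul3 (polar c q p) p + smul3 (- polar c p q) q)"
    using *(1,3) by (simp add: proj_smul)
next
  assume R: "R = proj (smul3 (polar c q p) p + smul3 (- polar c p q) q)"
  show "line_section c (proj p) (proj q) R"
    unfolding line_section_def
  proof (intro exI conjI)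
    show "\<forall>x y. smul3 x p + smul3 y q = 0 \<longrightarrow> x = 0 \<and> y = 0" using pq by (simp add: indep_def)
    show "(1::'a) \<noteq> 0" by simp
    show "(1::'a, 0::'a) \<noteq> (0, 0)" "(0::'a, 1::'a) \<noteq> (0, 0)" by simp_all
    show "(polar c q p, - polar c p q) \<noteq> (0, 0)" using nl by auto
    show "proj p = proj (smul3 1 p + smul3 0 q)" "proj q = proj (smul3 0 p + smul3 1 q)"
      by (cases p; cases q; simp)+
    show "R = proj (smul3 (polar c q p) p + smul3 (- polar c p q) q)" by fact
    show "\<forall>x y. form_eval 3 c (smul3 x p + smul3 y q) =
       1 * (x * 0 - y * 1) * (x * 1 - y * 0) * (x * (- polar c p q) - y * polar c q p)"
      unfolding form_eval_taylor by (simp add: F algebra_simps power2_eq_square)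
  qed
qed

text \<open>
  The tangent line at a smooth point is unique: the gradient is a nonzero covector, so its kernel
  is the plane spanned by \<open>p\<close> and any one independent tangent direction.
\<close>

lemma kernel_of_covector:
  fixes p d d' :: "'a::field vec3"
  assumes ind: "indep p d" and nz: "polar c v e \<noteq> 0"
    and 0: "polar c v p = 0" "polar c v d = 0" "polar c v d' = 0"
  obtains x y where "d' = smul3 x p + smul3 y d"
proof -
  obtain p1 p2 p3 where p: "p = (p1, p2, p3)" by (cases p)
  obtain d1 d2 d3 where d: "d = (d1, d2, d3)" by (cases d)
  obtain e1 e2 e3 where e: "d' = (e1, e2, e3)" by (cases d')
  define g1 where "g1 = form_eval 2 (form_dX c) v"
  define g2 where "g2 = form_eval 2 (form_dY c) v"
  define g3 where "g3 = form_eval 2 (form_dZ 3 c) v"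
  have g: "polar c v q = fst q * g1 + fst (snd q) * g2 + snd (snd q) * g3" for q
    by (simp add: polar_def g1_def g2_def g3_def)
  have gnz: "g1 \<noteq> 0 \<or> g2 \<noteq> 0 \<or> g3 \<noteq> 0" using nz by (auto simp: g)
  have g0: "p1 * g1 + p2 * g2 + p3 * g3 = 0" "d1 * g1 + d2 * g2 + d3 * g3 = 0"
    "e1 * g1 + e2 * g2 + e3 * g3 = 0"
    using 0 by (simp_all add: g p d e)
  define n1 where "n1 = p2 * d3 - p3 * d2"
  define n2 where "n2 = p3 * d1 - p1 * d3"
  define n3 where "n3 = p1 * d2 - p2 * d1"
  define dt where "dt = e1 * n1 + e2 * n2 + e3 * n3"
  \<comment> \<open>the gradient is parallel to the cross product of \<open>p\<close> and \<open>d\<close>\<close>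
  have "g1 * n2 - g2 * n1 = p3 * (d1 * g1 + d2 * g2 + d3 * g3) - d3 * (p1 * g1 + p2 * g2 + p3 * g3)"
    "g2 * n3 - g3 * n2 = p1 * (d1 * g1 + d2 * g2 + d3 * g3) - d1 * (p1 * g1 + p2 * g2 + p3 * g3)"
    "g3 * n1 - g1 * n3 = p2 * (d1 * g1 + d2 * g2 + d3 * g3) - d2 * (p1 * g1 + p2 * g2 + p3 * g3)"
    unfolding n1_def n2_def n3_def by (simp_all add: algebra_simps)
  then have par: "g1 * n2 - g2 * n1 = 0" "g2 * n3 - g3 * n2 = 0" "g3 * n1 - g1 * n3 = 0"
    unfolding g0 by simp_all
  have "g1 * dt = n1 * (e1 * g1 + e2 * g2 + e3 * g3) + e2 * (g1 * n2 - g2 * n1) - e3 * (g3 * n1 - g1 * n3)"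
    "g2 * dt = n2 * (e1 * g1 + e2 * g2 + e3 * g3) - e1 * (g1 * n2 - g2 * n1) + e3 * (g2 * n3 - g3 * n2)"
    "g3 * dt = n3 * (e1 * g1 + e2 * g2 + e3 * g3) + e1 * (g3 * n1 - g1 * n3) - e2 * (g2 * n3 - g3 * n2)"
    unfolding dt_def by (simp_all add: algebra_simps)
  then have "g1 * dt = 0" "g2 * dt = 0" "g3 * dt = 0" unfolding g0 par by simp_all
  with gnz have dt: "dt = 0" by auto
  have "n1 \<noteq> 0 \<or> n2 \<noteq> 0 \<or> n3 \<noteq> 0"
  proof (rule ccontr)
    assume "\<not> ?thesis"
    then have n: "n1 = 0" "n2 = 0" "n3 = 0" by auto
    have "smul3 d1 p + smul3 (-p1) d = 0" "smul3 d2 p + smul3 (-p2) d = 0" "smul3 d3 p + smul3 (-p3) d = 0"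
      using n unfolding n1_def n2_def n3_def p d zero_vec3
      by (simp_all add: algebra_simps)
    then have "p1 = 0" "p2 = 0" "p3 = 0" using ind unfolding indep_def
      by (metis neg_equal_0_iff_equal)+
    then have "smul3 1 p + smul3 0 d = 0" unfolding p d zero_vec3 by simp
    then show False using ind unfolding indep_def by (metis one_neq_zero)
  qed
  then consider "n1 \<noteq> 0" | "n2 \<noteq> 0" | "n3 \<noteq> 0" by blast
  then show ?thesis
  proof cases
    case 1
    have "e1 * n1 = (e2 * d3 - e3 * d2) * p1 + (p2 * e3 - p3 * e2) * d1 + dt"
      "e2 * n1 = (e2 * d3 - e3 * d2) * p2 + (p2 * e3 - p3 * e2) * d2"
      "e3 * n1 = (e2 * d3 - e3 * d2) * p3 + (p2 * e3 - p3 * e2) * d3"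
      by (simp_all add: n1_def n2_def n3_def dt_def algebra_simps)
    then show ?thesis
      using that[of "(e2 * d3 - e3 * d2) / n1" "(p2 * e3 - p3 * e2) / n1"] 1 dt
      by (simp add: p d e nonzero_eq_divide_eq add_divide_distrib [symmetric])
  next
    case 2
    have "e1 * n2 = (e3 * d1 - e1 * d3) * p1 + (p3 * e1 - p1 * e3) * d1"
      "e2 * n2 = (e3 * d1 - e1 * d3) * p2 + (p3 * e1 - p1 * e3) * d2 + dt"
      "e3 * n2 = (e3 * d1 - e1 * d3) * p3 + (p3 * e1 - p1 * e3) * d3"
      by (simp_all add: n1_def n2_def n3_def dt_def algebra_simps)
    then show ?thesis
      using that[of "(e3 * d1 - e1 * d3) / n2" "(p3 * e1 - p1 * e3) / n2"] 2 dt
      by (simp add: p d e nonzero_eq_divide_eq add_divide_distrib [symmetric])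
  next
    case 3
    have "e1 * n3 = (e1 * d2 - e2 * d1) * p1 + (p1 * e2 - p2 * e1) * d1"
      "e2 * n3 = (e1 * d2 - e2 * d1) * p2 + (p1 * e2 - p2 * e1) * d2"
      "e3 * n3 = (e1 * d2 - e2 * d1) * p3 + (p1 * e2 - p2 * e1) * d3 + dt"
      by (simp_all add: n1_def n2_def n3_def dt_def algebra_simps)
    then show ?thesis
      using that[of "(e1 * d2 - e2 * d1) / n3" "(p1 * e2 - p2 * e1) / n3"] 3 dt
      by (simp add: p d e nonzero_eq_divide_eq add_divide_distrib [symmetric])
  qed
qed

text \<open>
  If \<open>d\<close> is a tangent direction at \<open>p\<close>, the form along the tangent is \<open>y\<^sup>2 (M x + N y)\<close> with
  \<open>M = polar c d p\<close> and \<open>N = form_eval 3 c d\<close>.  Any other line that meets the cubic doubly at \<open>p\<close> has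
  a direction in the span of \<open>p\<close> and \<open>d\<close>, and the residual point does not depend on that choice.
\<close>

lemma line_section_tangent_iff:
  fixes c :: "'a::field_char_0 form"
  assumes F: "form_eval 3 c p = 0" and pd: "indep p d" and tan: "polar c p d = 0"
    and sm: "polar c p e \<noteq> 0"
    and nl: "(form_eval 3 c d, polar c d p) \<noteq> (0, 0)"
  shows "line_section c (proj p) (proj p) R \<longleftrightarrow>
         R = proj (smul3 (form_eval 3 c d) p + smul3 (- polar c d p) d)"
proof
  assume ls: "line_section c (proj p) (proj p) R"
  have p0: "p \<noteq> 0" using indep_nonzero[OF pd, of 1 0] by (cases p; cases d) (auto simp: zero_vec3)
  obtain d' k u1 u2 r1 r2 where *: "indep p d'" "k \<noteq> 0" "(u1, u2) \<noteq> (0, 0)" "(r1, r2) \<noteq> (0, 0)"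
    "proj p = proj (smul3 u1 p + smul3 u2 d')" "R = proj (smul3 r1 p + smul3 r2 d')"
    "\<And>x y. form_eval 3 c (smul3 x p + smul3 y d') = k * y * (x * u2 - y * u1) * (x * r2 - y * r1)"
    using line_section_frame[OF ls p0] by blast
  have u2: "u2 = 0"
  proof -
    obtain l where "l \<noteq> 0" "smul3 u1 p + smul3 u2 d' = smul3 l p"
      using *(5) proj_eq_iff by metis
    then have "smul3 (u1 - l) p + smul3 u2 d' = 0" by (cases p; cases d') (simp add: zero_vec3 algebra_simps)
    then show ?thesis using *(1) unfolding indep_def by blast
  qed
  with *(3) have u1: "u1 \<noteq> 0" by simp
  have ev: "x^2 * y * polar c p d' + x * y^2 * polar c d' p + y^3 * form_eval 3 c d' =
            - k * u1 * y^2 * (x * r2 - y * r1)" for x y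
    using *(7)[of x y] unfolding form_eval_taylor by (simp add: F u2 power2_eq_square)
  have N: "form_eval 3 c d' = k * u1 * r1" using ev[of 0 1] by simp
  have e: "polar c p d' + polar c d' p = - k * u1 * r2" "polar c p d' - polar c d' p = k * u1 * r2"
    using ev[of 1 1] ev[of "-1" 1] by (simp_all add: N algebra_simps)
  from arg_cong2[OF e, of "(-)"] arg_cong2[OF e, of "(+)"]
  have "2 * polar c p d' = 0" "2 * polar c d' p = 2 * (- k * u1 * r2)"
    by (simp_all add: algebra_simps)
  then have T: "polar c p d' = 0" "polar c d' p = - k * u1 * r2" by simp_all
  have "polar c p p = 0" by (simp add: polar_self F)
  then obtain a b where d': "d' = smul3 a p + smul3 b d"
    using kernel_of_covector[OF pd sm _ tan T(1)] by blast
  have b: "b \<noteq> 0"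
  proof
    assume "b = 0"
    then have "smul3 a p + smul3 (- 1) d' = 0" unfolding d' by (cases p; cases d) (simp add: zero_vec3)
    then show False using *(1) unfolding indep_def by (metis neg_equal_0_iff_equal zero_neq_one)
  qed
  have dform: "form_eval 3 c d' = a * b^2 * polar c d p + b^3 * form_eval 3 c d"
    unfolding d' form_eval_taylor by (simp add: F tan)
  have dpol: "polar c d' p = b^2 * polar c d p"
  proof -
    have e1: "form_eval 3 c (smul3 1 p + smul3 1 d') =
          form_eval 3 c (smul3 (1 + a) p + smul3 b d)"
      unfolding d' by (cases p; cases d) (simp add: algebra_simps)
    show ?thesis using e1 unfolding form_eval_taylor
      by (simp add: F tan T(1) dform algebra_simps)
  qed
  have "smul3 (form_eval 3 c d') p + smul3 (- polar c d' p) d' =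
        smul3 (b^3) (smul3 (form_eval 3 c d) p + smul3 (- polar c d p) d)"
    unfolding dform dpol unfolding d'
    by (cases p; cases d) (simp add: algebra_simps power2_eq_square power3_eq_cube)
  moreover have "smul3 (form_eval 3 c d') p + smul3 (- polar c d' p) d' =
        smul3 (k * u1) (smul3 r1 p + smul3 r2 d')"
    unfolding N T(2) by (simp add: smul3_add smul3_assoc)
  ultimately have "proj (smul3 r1 p + smul3 r2 d') =
      proj (smul3 (form_eval 3 c d) p + smul3 (- polar c d p) d)"
    using b *(2) u1 proj_smul[of "b^3"] proj_smul[of "k * u1"]
    by (metis mult_eq_0_iff power_not_zero)
  with *(6) show "R = proj (smul3 (form_eval 3 c d) p + smul3 (- polar c d p) d)" by simp
next
  assume R: "R = proj (smul3 (form_eval 3 c d) p + smul3 (- polar c d p) d)"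
  show "line_section c (proj p) (proj p) R"
    unfolding line_section_def
  proof (intro exI conjI)
    show "\<forall>x y. smul3 x p + smul3 y d = 0 \<longrightarrow> x = 0 \<and> y = 0" using pd by (simp add: indep_def)
    show "(-1::'a) \<noteq> 0" by simp
    show "(1::'a, 0::'a) \<noteq> (0, 0)" "(1::'a, 0::'a) \<noteq> (0, 0)" by simp_all
    show "(form_eval 3 c d, - polar c d p) \<noteq> (0, 0)" using nl by auto
    show "proj p = proj (smul3 1 p + smul3 0 d)" "proj p = proj (smul3 1 p + smul3 0 d)"
      by (cases p; cases d; simp)+
    show "R = proj (smul3 (form_eval 3 c d) p + smul3 (- polar c d p) d)" by fact
    show "\<forall>x y. form_eval 3 c (smul3 x p + smul3 y d) =
       (-1) * (x * 0 - y * 1) * (x * 0 - y * 1) * (x * (- polar c d p) - y * form_eval 3 c d)"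
      unfolding form_eval_taylor
      by (simp add: F tan algebra_simps power2_eq_square power3_eq_cube)
  qed
qed

text \<open>
  Two conditions make the third intersection point of a line well defined for points over the base
  field: no rational point is singular, and no rational line lies on the cubic.
  Then \<open>third_point\<close> is a totally symmetric quasigroup operation, from which the product and the inverses
  of \<open>mw_group\<close> can be computed for every base point (\<open>inv_mw_group\<close>).
\<close>

locale line_cubic =
  fixes c :: "'a::field_char_0 form"
  assumes smooth_pt: "p \<noteq> 0 \<Longrightarrow> form_eval 3 c p = 0 \<Longrightarrow> \<exists>e. polar c p e \<noteq> 0"
    and no_line: "indep p q \<Longrightarrow> \<exists>x y. form_eval 3 c (smul3 x p + smul3 y q) \<noteq> 0"
begin

abbreviation third (infixl "\<star>" 70) where "P \<star> Q \<equiv> third_point c P Q"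

lemma tangent_direction:
  assumes "p \<noteq> 0" "form_eval 3 c p = 0"
  obtains d where "indep p d" "polar c p d = 0"
proof -
  obtain p1 p2 p3 where p: "p = (p1, p2, p3)" by (cases p)
  define g1 where "g1 = form_eval 2 (form_dX c) p"
  define g2 where "g2 = form_eval 2 (form_dY c) p"
  define g3 where "g3 = form_eval 2 (form_dZ 3 c) p"
  have g: "polar c p q = fst q * g1 + fst (snd q) * g2 + snd (snd q) * g3" for q
    by (simp add: polar_def g1_def g2_def g3_def)
  have "polar c p p = 0" using assms by (simp add: polar_self)
  then have gp: "p1 * g1 + p2 * g2 + p3 * g3 = 0" using g[of p] by (simp add: p)
  have gnz: "g1 \<noteq> 0 \<or> g2 \<noteq> 0 \<or> g3 \<noteq> 0" using smooth_pt[OF assms] by (auto simp: g)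
  have "\<exists>d. d \<noteq> 0 \<and> polar c p d = 0 \<and> proj d \<noteq> proj p"
  proof (rule ccontr)
    assume "\<not> ?thesis"
    then have H: "proj d = proj p" if "d \<noteq> 0" "polar c p d = 0" for d using that by blast
    have K: "x * p2 = y * p1 \<and> y * p3 = z * p2 \<and> x * p3 = z * p1"
      if "x * g1 + y * g2 + z * g3 = 0" for x y z
    proof (cases "(x, y, z) = 0")
      case False
      then have "proj (x, y, z) = proj p" using H that by (simp add: g)
      then obtain k where "(x, y, z) = smul3 k p" by (auto simp: proj_eq_iff)
      then show ?thesis by (simp add: p)
    qed (simp add: zero_vec3)
    have pn: "p1 \<noteq> 0 \<or> p2 \<noteq> 0 \<or> p3 \<noteq> 0" using assms(1) by (auto simp: p zero_vec3)
    have "g2 * p2 = - g1 * p1" "g2 * p3 = 0" "g1 * p3 = 0"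
      using K[of g2 "- g1" 0] by (simp_all add: algebra_simps)
    moreover have "g3 * p3 = - g1 * p1" "g3 * p2 = 0" "g1 * p2 = 0"
      using K[of g3 0 "- g1"] by (simp_all add: algebra_simps)
    moreover have "g3 * p3 = - g2 * p2" "g3 * p1 = 0" "g2 * p1 = 0"
      using K[of 0 g3 "- g2"] by (simp_all add: algebra_simps)
    ultimately have z: "g1 * p2 = 0" "g1 * p3 = 0" "g2 * p1 = 0" "g2 * p3 = 0" "g3 * p1 = 0" "g3 * p2 = 0"
      and e: "g2 * p2 = - g1 * p1" "g3 * p3 = - g1 * p1" "g3 * p3 = - g2 * p2" by auto
    have "g1 * p1 + g1 * p1 = 0" using e by simp
    then have "2 * (g1 * p1) = 0" by (simp only: mult_2)
    then have "g1 * p1 = 0" by simp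
    with e have "g2 * p2 = 0" "g3 * p3 = 0" by simp_all
    with z \<open>g1 * p1 = 0\<close> gnz pn show False by auto
  qed
  then obtain d where "d \<noteq> 0" "polar c p d = 0" "proj d \<noteq> proj p" by blast
  then show ?thesis using that[of d] assms by (auto simp: indep_iff)
qed

lemma third_chord:
  assumes "form_eval 3 c p = 0" "form_eval 3 c q = 0" "indep p q"
  shows "(polar c p q, polar c q p) \<noteq> (0, 0)"
    and "line_section c (proj p) (proj q) R \<longleftrightarrow>
         R = proj (smul3 (polar c q p) p + smul3 (- polar c p q) q)"
    and "proj p \<star> proj q = proj (smul3 (polar c q p) p + smul3 (- polar c p q) q)"
proof -
  show nl: "(polar c p q, polar c q p) \<noteq> (0, 0)"
    using no_line[OF assms(3)] unfolding form_eval_taylor by (auto simp: assms)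
  show iff: "line_section c (proj p) (proj q) R \<longleftrightarrow>
         R = proj (smul3 (polar c q p) p + smul3 (- polar c p q) q)" for R
    by (rule line_section_chord_iff[OF assms nl])
  show "proj p \<star> proj q = proj (smul3 (polar c q p) p + smul3 (- polar c p q) q)"
    unfolding third_point_def iff by simp
qed

lemma third_tangent:
  assumes "p \<noteq> 0" "form_eval 3 c p = 0" "indep p d" "polar c p d = 0"
  shows "line_section c (proj p) (proj p) R \<longleftrightarrow>
         R = proj (smul3 (form_eval 3 c d) p + smul3 (- polar c d p) d)"
    and "proj p \<star> proj p = proj (smul3 (form_eval 3 c d) p + smul3 (- polar c d p) d)"
proof -
  obtain e where e: "polar c p e \<noteq> 0" using smooth_pt assms by blast
  have nl: "(form_eval 3 c d, polar c d p) \<noteq> (0, 0)"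
    using no_line[OF assms(3)] unfolding form_eval_taylor by (auto simp: assms)
  show iff: "line_section c (proj p) (proj p) R \<longleftrightarrow>
         R = proj (smul3 (form_eval 3 c d) p + smul3 (- polar c d p) d)" for R
    by (rule line_section_tangent_iff[OF assms(2-4) e nl])
  show "proj p \<star> proj p = proj (smul3 (form_eval 3 c d) p + smul3 (- polar c d p) d)"
    unfolding third_point_def iff by simp
qed

lemma line_section_iff_third:
  assumes "P \<in> cubic_points c" "Q \<in> cubic_points c"
  shows "line_section c P Q R \<longleftrightarrow> R = P \<star> Q"
proof -
  obtain p where p: "P = proj p" "p \<noteq> 0" "form_eval 3 c p = 0" using assms(1) by (rule cubic_pointsE)
  obtain q where q: "Q = proj q" "q \<noteq> 0" "form_eval 3 c q = 0" using assms(2) by (rule cubic_pointsE)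
  show ?thesis
  proof (cases "P = Q")
    case True
    obtain d where d: "indep p d" "polar c p d = 0" using tangent_direction p by blast
    show ?thesis using third_tangent[OF p(2,3) d] True p(1) by simp
  next
    case False
    then have "indep p q" using p q by (simp add: indep_iff)
    then show ?thesis using third_chord[OF p(3) q(3)] p q by simp
  qed
qed

lemma third_line_section:
  "P \<in> cubic_points c \<Longrightarrow> Q \<in> cubic_points c \<Longrightarrow> line_section c P Q (P \<star> Q)"
  by (simp add: line_section_iff_third)

lemma third_closed [simp]:
  "P \<in> cubic_points c \<Longrightarrow> Q \<in> cubic_points c \<Longrightarrow> P \<star> Q \<in> cubic_points c"
  by (metis third_line_section line_section_point line_section_swap12 line_section_swap23)

lemma third_commute: "P \<in> cubic_points c \<Longrightarrow> Q \<in> cubic_points c \<Longrightarrow> P \<star> Q = Q \<star> P"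
  by (metis third_line_section line_section_iff_third line_section_swap12)

lemma third_cancel [simp]: "P \<in> cubic_points c \<Longrightarrow> Q \<in> cubic_points c \<Longrightarrow> P \<star> (P \<star> Q) = Q"
  by (metis third_line_section line_section_iff_third line_section_swap23 third_closed)

lemma third_eq_iff:
  "P \<in> cubic_points c \<Longrightarrow> Q \<in> cubic_points c \<Longrightarrow> R \<in> cubic_points c \<Longrightarrow> P \<star> Q = R \<longleftrightarrow> Q = P \<star> R"
  by (metis third_cancel)

lemma inv_mw_group:
  assumes Z: "Z \<in> cubic_points c" and P: "P \<in> cubic_points c"
  shows "inv\<^bsub>mw_group c Z\<^esub> P = P \<star> (Z \<star> Z)"
  unfolding m_inv_def
proof (rule the_equality)
  show "P \<star> (Z \<star> Z) \<in> carrier (mw_group c Z) \<and>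
    P \<otimes>\<^bsub>mw_group c Z\<^esub> (P \<star> (Z \<star> Z)) = \<one>\<^bsub>mw_group c Z\<^esub> \<and>
    P \<star> (Z \<star> Z) \<otimes>\<^bsub>mw_group c Z\<^esub> P = \<one>\<^bsub>mw_group c Z\<^esub>"
    using assms by (simp add: mw_group_def third_commute[of "P \<star> (Z \<star> Z)" P])
  fix y assume "y \<in> carrier (mw_group c Z) \<and> P \<otimes>\<^bsub>mw_group c Z\<^esub> y = \<one>\<^bsub>mw_group c Z\<^esub> \<and>
      y \<otimes>\<^bsub>mw_group c Z\<^esub> P = \<one>\<^bsub>mw_group c Z\<^esub>"
  then show "y = P \<star> (Z \<star> Z)" using assms by (auto simp: mw_group_def third_eq_iff)
qed

end

section \<open>Independence from a function that sums to zero on lines\<close>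

context line_cubic begin

text \<open>
  A function \<open>\<nu>\<close> on a set of points closed under the chord-tangent operation, with values summing to
  zero on collinear triples, becomes additive for the group law with base point \<open>Z\<close> after subtracting
  \<open>\<nu> Z\<close>: the product of \<open>P\<close> and \<open>Q\<close> has value \<open>- \<nu> Z - (- \<nu> P - \<nu> Q)\<close>.  It is then additive on
  powers and inverses as well, and a relation among the points becomes a linear relation among
  elements of a field of characteristic 0.
\<close>

lemma Z_independentI:
  fixes \<nu> :: "'a ppoint \<Rightarrow> 'k::field_char_0"
  assumes H: "H \<subseteq> cubic_points c" and Z: "Z \<in> H"
    and closed: "\<And>P Q. P \<in> H \<Longrightarrow> Q \<in> H \<Longrightarrow> P \<star> Q \<in> H"
    and nu: "\<And>P Q. P \<in> H \<Longrightarrow> Q \<in> H \<Longrightarrow> \<nu> (P \<star> Q) = - \<nu> P - \<nu> Q"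
    and Ps: "set Ps \<subseteq> H"
    and lin: "\<And>ns :: int list. length ns = length Ps \<Longrightarrow>
       (\<Sum>(n, P)\<leftarrow>zip ns Ps. of_int n * (\<nu> P - \<nu> Z)) = 0 \<Longrightarrow> \<forall>n\<in>set ns. n = 0"
  shows "Z_independent (mw_group c Z) Ps"
proof -
  let ?G = "mw_group c Z"
  define \<mu> where "\<mu> P = \<nu> P - \<nu> Z" for P
  have mult: "P \<otimes>\<^bsub>?G\<^esub> Q \<in> H \<and> \<mu> (P \<otimes>\<^bsub>?G\<^esub> Q) = \<mu> P + \<mu> Q" if "P \<in> H" "Q \<in> H" for P Q
    using that Z by (simp add: mw_group_def closed nu \<mu>_def)
  have one: "\<one>\<^bsub>?G\<^esub> \<in> H \<and> \<mu> \<one>\<^bsub>?G\<^esub> = 0"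
    using Z by (simp add: mw_group_def \<mu>_def)
  have inv: "inv\<^bsub>?G\<^esub> P \<in> H \<and> \<mu> (inv\<^bsub>?G\<^esub> P) = - \<mu> P" if "P \<in> H" for P
  proof -
    have "inv\<^bsub>?G\<^esub> P = P \<star> (Z \<star> Z)" using that Z H by (intro inv_mw_group) auto
    then show ?thesis using that Z by (simp add: closed nu \<mu>_def)
  qed
  have npow: "P [^]\<^bsub>?G\<^esub> n \<in> H \<and> \<mu> (P [^]\<^bsub>?G\<^esub> n) = of_nat n * \<mu> P" if "P \<in> H" for P and n :: nat
    using that by (induction n) (simp_all add: one mult algebra_simps)
  have ipow: "P [^]\<^bsub>?G\<^esub> n \<in> H \<and> \<mu> (P [^]\<^bsub>?G\<^esub> n) = of_int n * \<mu> P" if "P \<in> H" for P and n :: int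
  proof (cases "n < 0")
    case True
    then have "P [^]\<^bsub>?G\<^esub> n = inv\<^bsub>?G\<^esub> (P [^]\<^bsub>?G\<^esub> nat (- n))"
      using int_pow_def2[of ?G P n] by (simp only: if_True)
    moreover have "of_nat (nat (- n)) = (- of_int n :: 'k)"
      using True by simp
    moreover note npow[OF that, of "nat (- n)"] inv[OF conjunct1[OF npow[OF that, of "nat (- n)"]]]
    ultimately show ?thesis by (metis minus_mult_left minus_minus)
  next
    case False
    then have "P [^]\<^bsub>?G\<^esub> n = P [^]\<^bsub>?G\<^esub> nat n"
      using int_pow_def2[of ?G P n] by (simp only: if_False)
    moreover have "of_nat (nat n) = (of_int n :: 'k)" using False by simp
    ultimately show ?thesis using npow[OF that, of "nat n"] by simp
  qed
  have fold: "foldr (\<lambda>(n, P) S. (P [^]\<^bsub>?G\<^esub> n) \<otimes>\<^bsub>?G\<^esub> S) nPs \<one>\<^bsub>?G\<^esub> \<in> H \<and>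
     \<mu> (foldr (\<lambda>(n, P) S. (P [^]\<^bsub>?G\<^esub> n) \<otimes>\<^bsub>?G\<^esub> S) nPs \<one>\<^bsub>?G\<^esub>) = (\<Sum>(n, P)\<leftarrow>nPs. of_int n * \<mu> P)"
    if "snd ` set nPs \<subseteq> H" for nPs :: "(int \<times> 'a ppoint) list"
    using that
  proof (induction nPs)
    case Nil
    then show ?case by (simp add: one)
  next
    case (Cons nP nPs)
    obtain n P where nP: "nP = (n, P)" by (cases nP)
    show ?case using Cons mult[of "P [^]\<^bsub>?G\<^esub> n"] ipow[of P n] by (simp add: nP)
  qed
  show ?thesis
    unfolding Z_independent_def
  proof (intro conjI allI impI)
    show "set Ps \<subseteq> carrier ?G" using Ps H by (auto simp: mw_group_def)
    fix ns :: "int list"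
    assume len: "length ns = length Ps"
      and eq: "foldr (\<lambda>(n, P) S. (P [^]\<^bsub>?G\<^esub> n) \<otimes>\<^bsub>?G\<^esub> S) (zip ns Ps) \<one>\<^bsub>?G\<^esub> = \<one>\<^bsub>?G\<^esub>"
    have "snd ` set (zip ns Ps) \<subseteq> H" using Ps by (auto dest: set_zip_rightD)
    from fold[OF this] one eq have "(\<Sum>(n, P)\<leftarrow>zip ns Ps. of_int n * \<mu> P) = 0" by simp
    then show "\<forall>n\<in>set ns. n = 0" using lin[OF len] by (simp add: \<mu>_def)
  qed
qed

end

section \<open>Places\<close>

text \<open>
  A valuation ring \<open>V\<close> with its residue map.  The residue field is taken to be ordered; then a cube
  there has a unique cube root, which separates the three branches of the reduced Selmer curve.
\<close>

locale place =
  fixes V :: "'a::field_char_0 set" and red :: "'a \<Rightarrow> 'k::linordered_field"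
  assumes one_V [simp]: "1 \<in> V" and red_one [simp]: "red 1 = 1"
    and add_V [simp]: "x \<in> V \<Longrightarrow> y \<in> V \<Longrightarrow> x + y \<in> V"
    and red_add [simp]: "x \<in> V \<Longrightarrow> y \<in> V \<Longrightarrow> red (x + y) = red x + red y"
    and minus_V [simp]: "x \<in> V \<Longrightarrow> - x \<in> V"
    and mult_V [simp]: "x \<in> V \<Longrightarrow> y \<in> V \<Longrightarrow> x * y \<in> V"
    and red_mult [simp]: "x \<in> V \<Longrightarrow> y \<in> V \<Longrightarrow> red (x * y) = red x * red y"
    and valuation: "x \<in> V \<or> inverse x \<in> V"
    and unit: "x \<in> V \<Longrightarrow> red x \<noteq> 0 \<Longrightarrow> inverse x \<in> V"
begin

lemma zero_V [simp]: "0 \<in> V"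
  using add_V[OF one_V minus_V[OF one_V]] by simp

lemma red_zero [simp]: "red 0 = 0"
  using red_add[of 0 0] by simp

lemma red_minus [simp]: "x \<in> V \<Longrightarrow> red (- x) = - red x"
  using red_add[of x "- x"] by (simp add: add_eq_0_iff)

lemma diff_V [simp]: "x \<in> V \<Longrightarrow> y \<in> V \<Longrightarrow> x - y \<in> V"
  using add_V[of x "- y"] by simp

lemma red_diff [simp]: "x \<in> V \<Longrightarrow> y \<in> V \<Longrightarrow> red (x - y) = red x - red y"
  using red_add[of x "- y"] by simp

lemma power_V [simp]: "x \<in> V \<Longrightarrow> x ^ n \<in> V"
  by (induction n) simp_all

lemma red_power [simp]: "x \<in> V \<Longrightarrow> red (x ^ n) = red x ^ n"
  by (induction n) simp_all

lemma of_nat_V [simp]: "of_nat n \<in> V" and red_of_nat [simp]: "red (of_nat n) = of_nat n"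
  by (induction n) simp_all

lemma numeral_V [simp]: "numeral n \<in> V" and red_numeral [simp]: "red (numeral n) = numeral n"
  using of_nat_V[of "numeral n"] red_of_nat[of "numeral n"] by simp_all

lemma red_nonzero: "red x \<noteq> 0 \<Longrightarrow> x \<noteq> 0"
  by auto

lemma red_inverse: "x \<in> V \<Longrightarrow> red x \<noteq> 0 \<Longrightarrow> red (inverse x) = inverse (red x)"
  using red_mult[OF _ unit, of x x] red_nonzero[of x] by (metis inverse_unique red_one right_inverse)

lemma divide_V: "x \<in> V \<Longrightarrow> y \<in> V \<Longrightarrow> red y \<noteq> 0 \<Longrightarrow> x / y \<in> V"
  by (simp add: divide_inverse unit)

lemma red_divide: "x \<in> V \<Longrightarrow> y \<in> V \<Longrightarrow> red y \<noteq> 0 \<Longrightarrow> red (x / y) = red x / red y"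
  by (simp add: divide_inverse unit red_inverse)

lemma primitive_pair:
  assumes "(x, y) \<noteq> (0, 0)"
  obtains k where "k \<noteq> 0" "k * x \<in> V" "k * y \<in> V" "k * x = 1 \<or> k * y = 1"
proof (cases "x \<noteq> 0 \<and> y / x \<in> V")
  case True
  then show ?thesis using that[of "inverse x"] by (simp add: divide_inverse mult.commute)
next
  case False
  then have "y \<noteq> 0 \<and> x / y \<in> V"
    using assms valuation[of "y / x"] by (auto simp: inverse_eq_divide)
  then show ?thesis using that[of "inverse y"] by (simp add: divide_inverse mult.commute)
qed

lemma primitive_triple:
  assumes "(x, y, z) \<noteq> (0, 0, 0)"
  obtains k where "k \<noteq> 0" "k * x \<in> V" "k * y \<in> V" "k * z \<in> V" "k * x = 1 \<or> k * y = 1 \<or> k * z = 1"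
proof (cases "(x, y) = (0, 0)")
  case True
  then show ?thesis using that[of "inverse z"] assms by simp
next
  case False
  then obtain k where k: "k \<noteq> 0" "k * x \<in> V" "k * y \<in> V" "k * x = 1 \<or> k * y = 1"
    using primitive_pair by blast
  obtain l where l: "l \<noteq> 0" "l * 1 \<in> V" "l * (k * z) \<in> V" "l * 1 = 1 \<or> l * (k * z) = 1"
    using primitive_pair[of 1 "k * z"] by auto
  show ?thesis
  proof (rule that[of "l * k"])
    show "l * k \<noteq> 0" using k l by simp
    show "l * k * x \<in> V" "l * k * y \<in> V" "l * k * z \<in> V" using k l by (simp_all add: mult.assoc)
    show "l * k * x = 1 \<or> l * k * y = 1 \<or> l * k * z = 1" using k l by (auto simp: mult.assoc)
  qed
qed

text \<open>
  The line section is rewritten around a point with second coordinate 1.  The direction of the line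
  is chosen with second coordinate 0 and primitive, so that all coordinates can be reduced.
\<close>

lemma line_section_affine:
  assumes ls: "line_section c (proj (x1, 1, z1)) Q R"
  obtains d0 d2 k q1 q2 r1 r2 where "d0 \<in> V" "d2 \<in> V" "d0 = 1 \<or> d2 = 1"
    "k \<noteq> 0" "(q1, q2) \<noteq> (0, 0)" "(r1, r2) \<noteq> (0, 0)"
    "Q = proj (q1 * x1 + q2 * d0, q1, q1 * z1 + q2 * d2)"
    "R = proj (r1 * x1 + r2 * d0, r1, r1 * z1 + r2 * d2)"
    "\<And>s. form_eval 3 c (x1 + s * d0, 1, z1 + s * d2) = k * s * (q2 - s * q1) * (r2 - s * r1)"
proof -
  have "(x1, 1::'a, z1) \<noteq> 0" by (simp add: zero_vec3)
  then obtain d k q1 q2 r1 r2 where *: "indep (x1, 1, z1) d" "k \<noteq> 0" "(q1, q2) \<noteq> (0, 0)"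
    "(r1, r2) \<noteq> (0, 0)"
    "Q = proj (smul3 q1 (x1, 1, z1) + smul3 q2 d)" "R = proj (smul3 r1 (x1, 1, z1) + smul3 r2 d)"
    "\<And>x y. form_eval 3 c (smul3 x (x1, 1, z1) + smul3 y d) =
        k * y * (x * q2 - y * q1) * (x * r2 - y * r1)"
    using line_section_frame[OF ls] by blast
  obtain a0 a1 a2 where d: "d = (a0, a1, a2)" by (cases d)
  define e0 where "e0 = a0 - a1 * x1"
  define e2 where "e2 = a2 - a1 * z1"
  have "(e0, e2) \<noteq> (0, 0)"
  proof
    assume "(e0, e2) = (0, 0)"
    then have "smul3 (- a1) (x1, 1, z1) + smul3 1 d = 0" by (simp add: d zero_vec3 e0_def e2_def)
    then show False using *(1) unfolding indep_def by (metis one_neq_zero)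
  qed
  then obtain l where l: "l \<noteq> 0" "l * e0 \<in> V" "l * e2 \<in> V" "l * e0 = 1 \<or> l * e2 = 1"
    using primitive_pair by blast
  have pt: "smul3 x (x1, 1, z1) + smul3 y d =
      ((x + y * a1) * x1 + (y / l) * (l * e0), x + y * a1, (x + y * a1) * z1 + (y / l) * (l * e2))" for x y
    using l(1) by (simp add: d e0_def e2_def algebra_simps)
  show ?thesis
  proof (rule that[of "l * e0" "l * e2" "k * l^3" "q1 + q2 * a1" "q2 / l" "r1 + r2 * a1" "r2 / l"])
    show "l * e0 \<in> V" "l * e2 \<in> V" "l * e0 = 1 \<or> l * e2 = 1" by (fact l)+
    show "k * l^3 \<noteq> 0" using l(1) *(2) by simp
    show "(q1 + q2 * a1, q2 / l) \<noteq> (0, 0)" "(r1 + r2 * a1, r2 / l) \<noteq> (0, 0)"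
      using *(3,4) l(1) by auto
    show "Q = proj ((q1 + q2 * a1) * x1 + q2 / l * (l * e0), q1 + q2 * a1,
                    (q1 + q2 * a1) * z1 + q2 / l * (l * e2))"
      unfolding *(5) pt ..
    show "R = proj ((r1 + r2 * a1) * x1 + r2 / l * (l * e0), r1 + r2 * a1,
                    (r1 + r2 * a1) * z1 + r2 / l * (l * e2))"
      unfolding *(6) pt ..
    show "form_eval 3 c (x1 + s * (l * e0), 1, z1 + s * (l * e2)) =
        k * l^3 * s * (q2 / l - s * (q1 + q2 * a1)) * (r2 / l - s * (r1 + r2 * a1))" for s
    proof -
      have "(x1 + s * (l * e0), 1, z1 + s * (l * e2)) =
            smul3 (1 - s * l * a1) (x1, 1, z1) + smul3 (s * l) d"
        unfolding pt using l(1) by simp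
      then have "form_eval 3 c (x1 + s * (l * e0), 1, z1 + s * (l * e2)) =
         k * (s * l) * ((1 - s * l * a1) * q2 - s * l * q1) * ((1 - s * l * a1) * r2 - s * l * r1)"
        using *(7) by simp
      also have "(1 - s * l * a1) * q2 - s * l * q1 = l * (q2 / l - s * (q1 + q2 * a1))"
        using l(1) by (simp add: algebra_simps)
      also have "(1 - s * l * a1) * r2 - s * l * r1 = l * (r2 / l - s * (r1 + r2 * a1))"
        using l(1) by (simp add: algebra_simps)
      finally show ?thesis by (simp only: power3_eq_cube mult_ac)
    qed
  qed
qed

end

lemma sum_of_powers_eq_0:
  fixes x y :: "'a::linordered_field"
  assumes "x^2 + x * y + y^2 = 0" shows "x = 0" "y = 0"
proof -
  have "(2 * x + y)^2 + 3 * y^2 = 4 * (x^2 + x * y + y^2)" by (simp add: algebra_simps power2_eq_square)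
  then have "(2 * x + y)^2 + 3 * y^2 = 0" by (simp add: assms)
  then have "(2 * x + y)^2 = 0 \<and> 3 * y^2 = 0"
    by (subst (asm) add_nonneg_eq_0_iff) auto
  then show "x = 0" "y = 0" by auto
qed

lemma cube_inject:
  fixes x y :: "'a::linordered_field"
  assumes "x^3 = y^3" shows "x = y"
proof (rule ccontr)
  assume "x \<noteq> y"
  moreover have "(x - y) * (x^2 + x * y + y^2) = 0"
    using assms by (simp add: algebra_simps power2_eq_square power3_eq_cube)
  ultimately have "x^2 + x * y + y^2 = 0" by simp
  then show False using sum_of_powers_eq_0[of x y] \<open>x \<noteq> y\<close> by simp
qed

lemma cubic_poly_coeffs:
  fixes a b d :: "'a::field_char_0"
  assumes "\<And>s. a * s + b * s^2 + d * s^3 = a' * s + b' * s^2 + d' * s^3"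
  shows "a = a'" "b = b'" "d = d'"
proof -
  have "poly [:0, a, b, d:] = poly [:0, a', b', d':]"
    using assms by (auto simp: fun_eq_iff algebra_simps power2_eq_square power3_eq_cube)
  then have "[:0, a, b, d:] = [:0, a', b', d':]" by (simp only: poly_eq_poly_eq_iff)
  then show "a = a'" "b = b'" "d = d'" by auto
qed

lemma proj_affine_eq:
  "proj (a * x + e, a, a * z + g) = proj (x', 1, z') \<longleftrightarrow>
   a \<noteq> 0 \<and> x' = x + e / a \<and> z' = z + g / (a::'a::field)"
  by (auto simp: proj_eq_iff field_simps)

lemma polar_selmer:
  "polar (selmer_form A B) (x, y, z) q =
     - 3 * A * x^2 * fst q + 3 * y^2 * fst (snd q) - 3 * B * z^2 * snd (snd q)"
  by (simp add: polar_def form_eval_def form_dX_def form_dY_def form_dZ_def selmer_form_def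
      eval_nat_numeral algebra_simps)

lemma selmer_gradient:
  fixes p :: "'a::field_char_0 vec3"
  assumes "A \<noteq> 0" "B \<noteq> 0" "p \<noteq> 0"
  shows "\<exists>e. polar (selmer_form A B) p e \<noteq> 0"
proof -
  obtain x y z where p: "p = (x, y, z)" by (cases p)
  with assms(3) consider "x \<noteq> 0" | "y \<noteq> 0" | "z \<noteq> 0" by (auto simp: zero_vec3)
  then show "\<exists>e. polar (selmer_form A B) p e \<noteq> 0"
  proof cases
    case 1
    show ?thesis by (rule exI[of _ "(1, 0, 0)"]) (use 1 assms in \<open>simp add: p polar_selmer\<close>)
  next
    case 2
    show ?thesis by (rule exI[of _ "(0, 1, 0)"]) (use 2 in \<open>simp add: p polar_selmer\<close>)
  next
    case 3
    show ?thesis by (rule exI[of _ "(0, 0, 1)"]) (use 3 assms in \<open>simp add: p polar_selmer\<close>)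
  qed
qed

lemma polar_E:
  "polar (E_form A B) (x, y, z) q =
     - 3 * x^2 * fst q + (2 * y * z - A * B * z^2) * fst (snd q)
     + (y^2 - 2 * A * B * y * z) * snd (snd q)"
  by (simp add: polar_def form_eval_def form_dX_def form_dY_def form_dZ_def E_form_def
      eval_nat_numeral algebra_simps)

section \<open>Reduction of the Selmer curve\<close>

text \<open>
  A quotient of two homogeneous coordinates as a function of the projective point.  Since division by
  0 gives 0, the value is independent of the representative also where the denominator vanishes.
\<close>

definition coord_ratio :: "('a::field vec3 \<Rightarrow> 'a) \<Rightarrow> ('a vec3 \<Rightarrow> 'a) \<Rightarrow> 'a ppoint \<Rightarrow> 'a" where
  "coord_ratio f g P = (let v = SOME v. v \<in> P in f v / g v)"

lemma coord_ratio_proj: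
  assumes "\<And>k v. f (smul3 k v) = k * f v" "\<And>k v. g (smul3 k v) = k * g v"
  shows "coord_ratio f g (proj v) = f v / g v"
proof -
  have "v \<in> proj v" by (rule self_in_proj)
  then have "(SOME u. u \<in> proj v) \<in> proj v" by (rule someI)
  then obtain k where "k \<noteq> 0" "(SOME u. u \<in> proj v) = smul3 k v" by (auto simp: proj_def)
  then show ?thesis by (simp add: coord_ratio_def assms)
qed

definition zy_ratio :: "'a::field ppoint \<Rightarrow> 'a" where
  "zy_ratio = coord_ratio (\<lambda>v. snd (snd v)) (\<lambda>v. fst (snd v))"

definition xy_ratio :: "'a::field ppoint \<Rightarrow> 'a" where
  "xy_ratio = coord_ratio fst (\<lambda>v. fst (snd v))"

lemma zy_ratio_proj: "zy_ratio (proj (x, y, z)) = z / y"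
  unfolding zy_ratio_def by (subst coord_ratio_proj) auto

lemma xy_ratio_proj: "xy_ratio (proj (x, y, z)) = x / y"
  unfolding xy_ratio_def by (subst coord_ratio_proj) auto

text \<open>
  The prime divides \<open>B\<close> exactly once and does not divide \<open>A\<close>.  The curve reduces to
  \<open>y\<^sup>3 = A x\<^sup>3\<close>, three concurrent lines, at most one of which is rational over the residue field.
\<close>

locale selmer_place = place V red
  for V :: "'a::field_char_0 set" and red :: "'a \<Rightarrow> 'k::linordered_field" +
  fixes A B :: 'a
  assumes A_V [simp]: "A \<in> V" and red_A: "red A \<noteq> 0"
    and B_V [simp]: "B \<in> V" and red_B [simp]: "red B = 0" and B_nz: "B \<noteq> 0"
    and uniformizer: "x \<in> V \<Longrightarrow> red x = 0 \<Longrightarrow> x / B \<in> V"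
begin

lemma A_nz: "A \<noteq> 0"
  using red_A by auto

text \<open>
  No rational point reduces to the common point of the three lines: if \<open>x\<close> and \<open>y\<close> were divisible
  by the prime, \<open>B z\<^sup>3\<close> would be divisible by its cube, whereas \<open>z\<close> is a unit.  Hence the
  function \<open>z / y\<close> is integral at every rational point, whichever base point is chosen.
\<close>

lemma selmer_point_reduction:
  assumes nz: "(x, y, z) \<noteq> (0, 0, 0)" and eq: "y^3 = A * x^3 + B * z^3"
  shows "y \<noteq> 0" "x / y \<in> V" "z / y \<in> V" "red A * red (x / y) ^ 3 = 1"
proof -
  obtain k where k: "k \<noteq> 0" "k * x \<in> V" "k * y \<in> V" "k * z \<in> V"
      "k * x = 1 \<or> k * y = 1 \<or> k * z = 1"
    using primitive_triple[OF nz] .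
  define x1 y1 z1 where "x1 = k * x" and "y1 = k * y" and "z1 = k * z"
  note [simp] = k(2-4)[folded x1_def y1_def z1_def]
  have e: "y1^3 = A * x1^3 + B * z1^3"
    using arg_cong[OF eq, of "\<lambda>v. k^3 * v"] by (simp add: x1_def y1_def z1_def algebra_simps)
  have re: "red y1 ^ 3 = red A * red x1 ^ 3"
    using arg_cong[OF e, of red] by simp
  have ry: "red y1 \<noteq> 0"
  proof
    assume 0: "red y1 = 0"
    then have 1: "red x1 = 0" using re red_A by simp
    have "x1 \<noteq> 1" "y1 \<noteq> 1" using 0 1 by auto
    then have "z1 = 1" using k(5) by (auto simp: x1_def y1_def z1_def)
    then have "1 = (y1 / B) * y1^2 - A * ((x1 / B) * x1^2)"
      using e B_nz by (simp add: field_simps power2_eq_square power3_eq_cube)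
    then have "red 1 = red ((y1 / B) * y1^2 - A * ((x1 / B) * x1^2))" by simp
    moreover have "y1 / B \<in> V" "x1 / B \<in> V" using 0 1 uniformizer by simp_all
    ultimately show False using 0 1 by (simp del: times_divide_eq_left)
  qed
  have q: "x / y = x1 / y1" "z / y = z1 / y1" using k(1) by (simp_all add: x1_def y1_def z1_def)
  show "y \<noteq> 0" using ry by (auto simp: y1_def)
  show "x / y \<in> V" "z / y \<in> V" unfolding q using ry by (simp_all add: divide_V)
  show "red A * red (x / y) ^ 3 = 1" unfolding q using ry by (simp add: red_divide power_divide re [symmetric])
qed

sublocale selmer: line_cubic "selmer_form A B"
proof
  show "\<exists>e. polar (selmer_form A B) p e \<noteq> 0" if "p \<noteq> 0" for p
    using selmer_gradient A_nz B_nz that by blast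
next
  fix p q :: "'a vec3" assume pq: "indep p q"
  have nz: "form_eval 3 (selmer_form A B) v \<noteq> 0" if "v \<noteq> 0" "fst v = 0" for v
  proof
    obtain y z where v: "v = (0, y, z)" using \<open>fst v = 0\<close> by (metis prod.collapse)
    assume "form_eval 3 (selmer_form A B) v = 0"
    then have "y^3 = A * 0^3 + B * z^3" by (simp add: v form_eval_selmer)
    from selmer_point_reduction(4)[OF _ this] that show False by (simp add: v zero_vec3)
  qed
  \<comment> \<open>every line has a point with \<open>x = 0\<close>, and no such point lies on the curve\<close>
  have "\<exists>x y. (x, y) \<noteq> (0, 0) \<and> fst (smul3 x p + smul3 y q) = 0"
  proof (cases "fst p = 0")
    case True
    then show ?thesis by (intro exI[of _ 1] exI[of _ 0]) (cases p; cases q; simp)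
  next
    case False
    then show ?thesis by (intro exI[of _ "fst q"] exI[of _ "- fst p"]) (cases p; cases q; simp)
  qed
  then show "\<exists>x y. form_eval 3 (selmer_form A B) (smul3 x p + smul3 y q) \<noteq> 0"
    using nz indep_nonzero[OF pq] by blast
qed

lemma selmer_pointE:
  assumes "P \<in> cubic_points (selmer_form A B)"
  obtains x z where "P = proj (x, 1, z)" "x \<in> V" "z \<in> V" "red A * red x ^ 3 = 1"
    "1 = A * x^3 + B * z^3" "zy_ratio P = z"
proof -
  obtain p where p: "P = proj p" "p \<noteq> 0" "form_eval 3 (selmer_form A B) p = 0"
    using assms by (rule cubic_pointsE)
  obtain x y z where v: "p = (x, y, z)" by (cases p)
  have e: "y^3 = A * x^3 + B * z^3" using p by (simp add: v form_eval_selmer diff_eq_eq add.commute)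
  have nz: "(x, y, z) \<noteq> (0, 0, 0)" using p by (simp add: v zero_vec3)
  note r = selmer_point_reduction[OF nz e]
  have "P = proj (x / y, 1, z / y)"
    unfolding p(1) v proj_eq_iff using r(1) by (intro exI[of _ y]) simp
  moreover have "1 = A * (x / y)^3 + B * (z / y)^3"
    using arg_cong[OF e, of "\<lambda>t. t / y^3"] r(1) by (simp add: power_divide add_divide_distrib)
  ultimately show ?thesis
    using that[of "x / y" "z / y"] r zy_ratio_proj[of "x / y" 1 "z / y"] by simp
qed

text \<open>
  A branch without the common point is an additive group with coordinate \<open>z / y\<close>.  Write the
  points of a line section as \<open>p + s d\<close> with \<open>d = (d0, 0, d2)\<close>.  All three reduce to the same branch, so
  the line does too and \<open>d0\<close> reduces to 0; otherwise the cubic in \<open>s\<close> would have the triple root 0 modulo the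
  prime, although its quadratic coefficient is a unit.  With \<open>d2 = 1\<close> the sum of the roots
  \<open>z2 - z1\<close> and \<open>z3 - z1\<close> is a quotient of coefficients both divisible by \<open>B\<close>, and it reduces to
  \<open>- 3 z1\<close>.
\<close>

lemma selmer_line_section_sum:
  assumes ls: "line_section (selmer_form A B) P Q R"
  shows "red (zy_ratio P) + red (zy_ratio Q) + red (zy_ratio R) = 0"
proof -
  have mem: "P \<in> cubic_points (selmer_form A B)" "Q \<in> cubic_points (selmer_form A B)"
    "R \<in> cubic_points (selmer_form A B)"
    using ls line_section_point line_section_swap12 line_section_swap23 by blast+
  obtain x1 z1 where P: "P = proj (x1, 1, z1)" "x1 \<in> V" "z1 \<in> V" "red A * red x1 ^ 3 = 1"
    "1 = A * x1^3 + B * z1^3" "zy_ratio P = z1" using selmer_pointE[OF mem(1)] .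
  obtain x2 z2 where Q: "Q = proj (x2, 1, z2)" "x2 \<in> V" "z2 \<in> V" "red A * red x2 ^ 3 = 1"
    "1 = A * x2^3 + B * z2^3" "zy_ratio Q = z2" using selmer_pointE[OF mem(2)] .
  obtain x3 z3 where R: "R = proj (x3, 1, z3)" "x3 \<in> V" "z3 \<in> V" "red A * red x3 ^ 3 = 1"
    "1 = A * x3^3 + B * z3^3" "zy_ratio R = z3" using selmer_pointE[OF mem(3)] .
  note [simp] = P(2,3) Q(2,3) R(2,3)
  have "red x2 ^ 3 = red x1 ^ 3" "red x3 ^ 3 = red x1 ^ 3"
    using P(4) Q(4) R(4) red_A by (metis mult_left_cancel)+
  then have x: "red x2 = red x1" "red x3 = red x1"
    by (auto intro: cube_inject)
  have x1: "red x1 \<noteq> 0" using P(4) by auto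
  obtain d0 d2 k q1 q2 r1 r2 where d: "d0 \<in> V" "d2 \<in> V" "d0 = 1 \<or> d2 = 1"
    and k: "k \<noteq> 0"
    and Q': "Q = proj (q1 * x1 + q2 * d0, q1, q1 * z1 + q2 * d2)"
    and R': "R = proj (r1 * x1 + r2 * d0, r1, r1 * z1 + r2 * d2)"
    and ev: "\<And>s. form_eval 3 (selmer_form A B) (x1 + s * d0, 1, z1 + s * d2) =
        k * s * (q2 - s * q1) * (r2 - s * r1)"
    using line_section_affine[OF ls[unfolded P(1)]] by metis
  note [simp] = d(1,2)
  define s2 s3 K where "s2 = q2 / q1" and "s3 = r2 / r1" and "K = k * q1 * r1"
  have q: "q1 \<noteq> 0" "x2 = x1 + s2 * d0" "z2 = z1 + s2 * d2"
    using Q'[unfolded Q(1)] proj_affine_eq[of q1 x1 "q2 * d0" z1 "q2 * d2" x2 z2]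
    by (simp_all add: s2_def)
  have r: "r1 \<noteq> 0" "x3 = x1 + s3 * d0" "z3 = z1 + s3 * d2"
    using R'[unfolded R(1)] proj_affine_eq[of r1 x1 "r2 * d0" z1 "r2 * d2" x3 z3]
    by (simp_all add: s3_def)
  have "(- 3 * (A * x1^2 * d0 + B * z1^2 * d2)) * s + (- 3 * (A * x1 * d0^2 + B * z1 * d2^2)) * s^2
      + (- (A * d0^3 + B * d2^3)) * s^3 =
      (K * s2 * s3) * s + (- K * (s2 + s3)) * s^2 + K * s^3" for s
  proof -
    have f1: "1 - A * (x1 + s * d0)^3 - B * (z1 + s * d2)^3 = K * s * (s2 - s) * (s3 - s)"
    proof -
      have "q2 - s * q1 = q1 * (s2 - s)" "r2 - s * r1 = r1 * (s3 - s)"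
        using q(1) r(1) by (simp_all add: s2_def s3_def algebra_simps)
      with ev[of s] show ?thesis by (simp add: form_eval_selmer K_def mult_ac)
    qed
    have f2: "1 - A * (x1 + s * d0)^3 - B * (z1 + s * d2)^3 =
       (1 - A * x1^3 - B * z1^3) + (- 3 * (A * x1^2 * d0 + B * z1^2 * d2)) * s
       + (- 3 * (A * x1 * d0^2 + B * z1 * d2^2)) * s^2 + (- (A * d0^3 + B * d2^3)) * s^3"
      by (simp add: algebra_simps power2_eq_square power3_eq_cube)
    have f3: "1 - A * x1^3 - B * z1^3 = 0" using P(5) by (simp add: algebra_simps)
    have "(- 3 * (A * x1^2 * d0 + B * z1^2 * d2)) * s + (- 3 * (A * x1 * d0^2 + B * z1 * d2^2)) * s^2
      + (- (A * d0^3 + B * d2^3)) * s^3 = K * s * (s2 - s) * (s3 - s)"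
      using trans[OF f2[symmetric] f1] unfolding f3 by simp
    also have "\<dots> = (K * s2 * s3) * s + (- K * (s2 + s3)) * s^2 + K * s^3"
      by (simp add: algebra_simps power2_eq_square power3_eq_cube)
    finally show ?thesis .
  qed
  note coeffs = cubic_poly_coeffs[OF this]
  have "- (3 * (A * x1 * d0^2 + B * z1 * d2^2)) = - (K * (s2 + s3))"
    using coeffs(2) by (simp only: minus_mult_left)
  then have c2: "3 * (A * x1 * d0^2 + B * z1 * d2^2) = K * (s2 + s3)"
    by (simp only: neg_equal_iff_equal)
  have c3: "K = - (A * d0^3 + B * d2^3)" using coeffs(3) by simp
  have d0: "red d0 = 0"
  proof (rule ccontr)
    assume nz: "red d0 \<noteq> 0"
    then have "d0 \<noteq> 0" by auto
    then have s: "s2 = (x2 - x1) / d0" "s3 = (x3 - x1) / d0" using q(2) r(2) by (simp_all add: field_simps)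
    have sO: "s2 \<in> V" "s3 \<in> V" "red s2 = 0" "red s3 = 0"
      unfolding s using nz x by (simp_all add: divide_V red_divide)
    have "red (3 * (A * x1 * d0^2 + B * z1 * d2^2)) = 3 * (red A * red x1 * red d0 ^ 2)" by simp
    moreover have "red (K * (s2 + s3)) = 0" using sO by (simp add: c3)
    ultimately have "3 * (red A * red x1 * red d0 ^ 2) = 0" by (simp only: c2)
    then show False using nz red_A x1 by simp
  qed
  then have "d2 = 1" using d(3) by auto
  have s: "s2 = z2 - z1" "s3 = z3 - z1" using q(3) r(3) \<open>d2 = 1\<close> by simp_all
  \<comment> \<open>both sides of \<open>c2\<close> are divisible by \<open>B\<close>; divide before reducing\<close>
  define D where "D = d0 / B"
  have D: "D \<in> V" using uniformizer d0 by (simp add: D_def)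
  have dB: "d0 = B * D" using B_nz by (simp add: D_def)
  have "3 * (A * x1 * (D * d0) + z1) = - (A * (D * d0^2) + 1) * (s2 + s3)"
  proof -
    have "B * (3 * (A * x1 * (D * d0) + z1)) = B * (- (A * (D * d0^2) + 1) * (s2 + s3))"
      using c2 unfolding c3 \<open>d2 = 1\<close> by (simp add: dB algebra_simps power2_eq_square power3_eq_cube)
    then show ?thesis using B_nz by simp
  qed
  then have "red (3 * (A * x1 * (D * d0) + z1)) = red (- (A * (D * d0^2) + 1) * (s2 + s3))" by simp
  then have "3 * red z1 = - (red z2 - red z1 + (red z3 - red z1))"
    using D by (simp add: d0 s)
  then show ?thesis by (simp add: P(6) Q(6) R(6))
qed

end

section \<open>Reduction of the curve \<open>E\<close>\<close>

lemma line_cubic_E: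
  fixes A B :: "'a::field_char_0"
  assumes AB: "A * B \<noteq> 0"
  shows "line_cubic (E_form A B)"
proof
  fix p :: "'a vec3" assume p0: "p \<noteq> 0" and F: "form_eval 3 (E_form A B) p = 0"
  obtain x y z where p: "p = (x, y, z)" by (cases p)
  have F': "y^2 * z - A * B * y * z^2 - x^3 = 0" using F by (simp add: p form_eval_E)
  consider "x \<noteq> 0" | "2 * y * z - A * B * z^2 \<noteq> 0" | "x = 0" "2 * y * z - A * B * z^2 = 0" by blast
  then show "\<exists>e. polar (E_form A B) p e \<noteq> 0"
  proof cases
    case 1
    show ?thesis by (rule exI[of _ "(1, 0, 0)"]) (use 1 in \<open>simp add: p polar_E\<close>)
  next
    case 2
    show ?thesis by (rule exI[of _ "(0, 1, 0)"]) (use 2 in \<open>simp add: p polar_E\<close>)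
  next
    case 3
    have z: "z = 0"
    proof (rule ccontr)
      assume z: "z \<noteq> 0"
      have "z * (2 * y - A * B * z) = 0" using 3(2) by (simp add: algebra_simps power2_eq_square)
      then have 2: "A * B * z = 2 * y" using z by simp
      have "z * y * (y - A * B * z) = 0" using F' 3(1) by (simp add: algebra_simps power2_eq_square)
      then have "y = 0" using z unfolding 2 by auto
      then show False using 2 AB z by simp
    qed
    then have "y \<noteq> 0" using p0 3(1) by (auto simp: p zero_vec3)
    then show ?thesis by (intro exI[of _ "(0, 0, 1)"]) (simp add: p polar_E z)
  qed
next
  fix p q :: "'a vec3" assume pq: "indep p q"
  let ?F = "form_eval 3 (E_form A B)"
  show "\<exists>x y. ?F (smul3 x p + smul3 y q) \<noteq> 0"
  proof (rule ccontr)
    assume "\<not> ?thesis"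
    then have 0: "?F (smul3 x p + smul3 y q) = 0" for x y by blast
    have flat: "fst v = 0" if "?F v = 0" "snd (snd v) = 0" for v
    proof -
      obtain a b c where v: "v = (a, b, c)" by (cases v)
      show ?thesis using that by (simp add: v form_eval_E)
    qed
    obtain p1 p2 p3 where p: "p = (p1, p2, p3)" by (cases p)
    obtain q1 q2 q3 where q: "q = (q1, q2, q3)" by (cases q)
    have "?F p = 0" "?F q = 0" using 0[of 1 0] 0[of 0 1] by (simp_all add: p q)
    have pol: "polar (E_form A B) u v = 0"
      if z: "\<And>x y. ?F (smul3 x u + smul3 y v) = 0" for u v
    proof -
      have uv: "?F u = 0" "?F v = 0" using z[of 1 0] z[of 0 1] by (cases u; cases v; simp)+
      have "polar (E_form A B) u v + polar (E_form A B) v u = 0"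
        "polar (E_form A B) v u - polar (E_form A B) u v = 0"
        using z[of 1 1] z[of 1 "-1"] unfolding form_eval_taylor by (simp_all add: uv)
      then have "(polar (E_form A B) u v + polar (E_form A B) v u) -
          (polar (E_form A B) v u - polar (E_form A B) u v) = 0" by (simp only: diff_self)
      moreover have "(a + b) - (b - a) = 2 * a" for a b :: 'a by simp
      ultimately show ?thesis by simp
    qed
    \<comment> \<open>a line on the curve would meet \<open>z = 0\<close> in the flex \<open>(0, 1, 0)\<close>, whose tangent is \<open>z = 0\<close> itself\<close>
    have "p3 = 0 \<and> q3 = 0"
    proof (rule ccontr)
      assume nz: "\<not> (p3 = 0 \<and> q3 = 0)"
      define v where "v = smul3 q3 p + smul3 (- p3) q"
      have v3: "snd (snd v) = 0" by (simp add: v_def p q)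
      have "v \<noteq> 0" unfolding v_def by (rule indep_nonzero[OF pq]) (use nz in auto)
      moreover have "fst v = 0" using flat[of v] v3 0 by (simp add: v_def)
      ultimately have v: "v = (0, fst (snd v), 0)" "fst (snd v) \<noteq> 0"
        using v3 by (auto simp: prod_eq_iff zero_vec3)
      have "smul3 x v + smul3 y p = smul3 (x * q3 + y) p + smul3 (- x * p3) q"
        "smul3 x v + smul3 y q = smul3 (x * q3) p + smul3 (y - x * p3) q" for x y
        by (simp_all add: v_def p q algebra_simps)
      then have "polar (E_form A B) v p = 0" "polar (E_form A B) v q = 0"
        using 0 by (simp_all add: pol)
      moreover have "polar (E_form A B) v u = (fst (snd v))^2 * snd (snd u)" for u
        by (subst v(1)) (simp add: polar_E)
      ultimately show False using nz v(2) by (simp add: p q)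
    qed
    then have "p1 = 0" "q1 = 0" "p3 = 0" "q3 = 0" using flat[of p] flat[of q] \<open>?F p = 0\<close> \<open>?F q = 0\<close>
      by (simp_all add: p q)
    then have "smul3 q2 p + smul3 (- p2) q = 0" "smul3 1 p + smul3 0 q = 0 \<or> p2 \<noteq> 0"
      by (auto simp: p q zero_vec3)
    then show False using pq unfolding indep_def by (metis neg_equal_0_iff_equal one_neq_zero)
  qed
qed

text \<open>
  If the prime divides \<open>A B\<close>, the curve reduces to the cuspidal cubic \<open>y\<^sup>2 z = x\<^sup>3\<close>, whose smooth points
  form an additive group with coordinate \<open>x / y\<close>.
\<close>

locale E_place = place V red
  for V :: "'a::field_char_0 set" and red :: "'a \<Rightarrow> 'k::linordered_field" +
  fixes A B :: 'a
  assumes AB_nz: "A * B \<noteq> 0" and AB_V [simp]: "A * B \<in> V" and red_AB [simp]: "red (A * B) = 0"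
begin

sublocale E: line_cubic "E_form A B"
  by (rule line_cubic_E) (rule AB_nz)

text \<open>
  The points with nonsingular reduction: only the cusp \<open>(0, 0, 1)\<close> has \<open>y = 0\<close>.
\<close>

definition E0 :: "'a ppoint set" where
  "E0 = {proj (x, 1, z) | x z. x \<in> V \<and> z \<in> V \<and> form_eval 3 (E_form A B) (x, 1, z) = 0}"

lemma E0_subset: "E0 \<subseteq> cubic_points (E_form A B)"
  by (auto simp: E0_def zero_vec3 intro!: cubic_pointsI)

text \<open>
  Along \<open>p + s d\<close> the curve equation is a cubic in \<open>s\<close>.  If \<open>d0\<close> reduced to 0, this cubic would reduce
  to a nonzero linear polynomial, which has no room for the two integral roots of \<open>P\<close> and \<open>Q\<close>.  So the leading
  coefficient \<open>- d0\<^sup>3\<close> is a unit, the third root is integral, and the sum of the roots is read off the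
  quadratic coefficient.  The third point may a priori have second coordinate 0, so its root is kept
  as a ratio \<open>n / m\<close>.
\<close>

lemma E0_line_section:
  assumes ls: "line_section (E_form A B) P Q R" and PQ: "P \<in> E0" "Q \<in> E0"
  shows "R \<in> E0" "red (xy_ratio P) + red (xy_ratio Q) + red (xy_ratio R) = 0"
proof -
  obtain x1 z1 where P: "P = proj (x1, 1, z1)" "x1 \<in> V" "z1 \<in> V"
    "form_eval 3 (E_form A B) (x1, 1, z1) = 0" using PQ(1) by (auto simp: E0_def)
  obtain x2 z2 where Q: "Q = proj (x2, 1, z2)" "x2 \<in> V" "z2 \<in> V"
    "form_eval 3 (E_form A B) (x2, 1, z2) = 0" using PQ(2) by (auto simp: E0_def)
  define c where "c = A * B"
  have [simp]: "c \<in> V" "red c = 0" by (simp_all add: c_def)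
  note [simp] = P(2,3) Q(2,3)
  obtain d0 d2 k q1 q2 r1 r2 where d: "d0 \<in> V" "d2 \<in> V" "d0 = 1 \<or> d2 = 1"
    and k: "k \<noteq> 0"
    and Q': "Q = proj (q1 * x1 + q2 * d0, q1, q1 * z1 + q2 * d2)"
    and R': "R = proj (r1 * x1 + r2 * d0, r1, r1 * z1 + r2 * d2)"
    and ev: "\<And>s. form_eval 3 (E_form A B) (x1 + s * d0, 1, z1 + s * d2) =
        k * s * (q2 - s * q1) * (r2 - s * r1)"
    using line_section_affine[OF ls[unfolded P(1)]] by metis
  note [simp] = d(1,2)
  define s2 m n where "s2 = q2 / q1" and "m = k * q1 * r1" and "n = k * q1 * r2"
  have q: "q1 \<noteq> 0" "x2 = x1 + s2 * d0" "z2 = z1 + s2 * d2"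
    using Q'[unfolded Q(1)] proj_affine_eq[of q1 x1 "q2 * d0" z1 "q2 * d2" x2 z2]
    by (simp_all add: s2_def)
  have "(d2 - 2 * c * z1 * d2 - 3 * x1^2 * d0) * s + (- c * d2^2 - 3 * x1 * d0^2) * s^2
      + (- (d0^3)) * s^3 =
      (s2 * n) * s + (- (n + s2 * m)) * s^2 + m * s^3" for s
  proof -
    have "q2 - s * q1 = q1 * (s2 - s)" using q(1) by (simp add: s2_def algebra_simps)
    with ev[of s]
    have f1: "(z1 + s * d2) - c * (z1 + s * d2)^2 - (x1 + s * d0)^3 = s * (s2 - s) * (n - s * m)"
      by (simp add: form_eval_E m_def n_def c_def algebra_simps)
    have f2: "(z1 + s * d2) - c * (z1 + s * d2)^2 - (x1 + s * d0)^3 = (z1 - c * z1^2 - x1^3) +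
       (d2 - 2 * c * z1 * d2 - 3 * x1^2 * d0) * s + (- c * d2^2 - 3 * x1 * d0^2) * s^2
      + (- (d0^3)) * s^3"
      by (simp add: algebra_simps power2_eq_square power3_eq_cube)
    have f3: "z1 - c * z1^2 - x1^3 = 0" using P(4) by (simp add: form_eval_E c_def)
    have "(d2 - 2 * c * z1 * d2 - 3 * x1^2 * d0) * s + (- c * d2^2 - 3 * x1 * d0^2) * s^2
      + (- (d0^3)) * s^3 = s * (s2 - s) * (n - s * m)"
      using trans[OF f2[symmetric] f1] unfolding f3 by simp
    also have "\<dots> = (s2 * n) * s + (- (n + s2 * m)) * s^2 + m * s^3"
      by (simp add: algebra_simps power2_eq_square power3_eq_cube)
    finally show ?thesis .
  qed
  note coeffs = cubic_poly_coeffs[OF this]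
  have m: "m = - (d0^3)" using coeffs(3) by simp
  have "n + s2 * m = - (- c * d2^2 - 3 * x1 * d0^2)" using coeffs(2) by (simp only: minus_minus)
  then have n: "n + s2 * m = c * d2^2 + 3 * x1 * d0^2" by simp
  have d0: "red d0 \<noteq> 0"
  proof
    assume 0: "red d0 = 0"
    then have "d2 = 1" using d(3) by auto
    have s2: "s2 = z2 - z1" using q(3) \<open>d2 = 1\<close> by simp
    have n': "n = c * d2^2 + 3 * x1 * d0^2 - s2 * m" using n by (simp add: algebra_simps)
    have "red (d2 - 2 * c * z1 * d2 - 3 * x1^2 * d0) = red (s2 * n)" using coeffs(1) by simp
    then show False unfolding n' m s2 by (simp add: 0 \<open>d2 = 1\<close>)
  qed
  then have "d0 \<noteq> 0" by auto
  have red_m: "m \<in> V" "red m \<noteq> 0" using d0 by (simp_all add: m)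
  then have "m \<noteq> 0" by auto
  then have r1: "r1 \<noteq> 0" by (auto simp: m_def)
  have s2: "s2 = (x2 - x1) / d0" using q(2) \<open>d0 \<noteq> 0\<close> by simp
  have [simp]: "s2 \<in> V" unfolding s2 using d0 by (simp add: divide_V)
  define s3 where "s3 = n / m"
  have s3: "s3 = r2 / r1" using k q(1) by (simp add: s3_def n_def m_def)
  have n'': "n = c * d2^2 + 3 * x1 * d0^2 - s2 * m" using n by (simp add: algebra_simps)
  have [simp]: "s3 \<in> V" unfolding s3_def using red_m by (intro divide_V) (simp_all add: n'')
  have R: "R = proj (x1 + s3 * d0, 1, z1 + s3 * d2)"
    unfolding R' proj_eq_iff using r1 by (intro exI[of _ r1]) (simp add: s3 algebra_simps)
  have "R \<in> cubic_points (E_form A B)"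
    using ls line_section_point line_section_swap12 line_section_swap23 by blast
  then have "form_eval 3 (E_form A B) (x1 + s3 * d0, 1, z1 + s3 * d2) = 0"
    unfolding R by (subst (asm) proj_in_cubic_points_iff) (simp_all add: zero_vec3)
  then show "R \<in> E0" unfolding E0_def R by (intro CollectI exI conjI[OF refl]) auto
  have "m * (s2 + s3) = c * d2^2 + 3 * x1 * d0^2"
    using n \<open>m \<noteq> 0\<close> by (simp add: s3_def algebra_simps)
  then have "red (m * (s2 + s3)) = red (c * d2^2 + 3 * x1 * d0^2)" by simp
  then have "red d0 ^ 2 * (red d0 * (red s2 + red s3)) = red d0 ^ 2 * (- 3 * red x1)"
    by (simp add: m algebra_simps power2_eq_square power3_eq_cube)
  then have "red d0 * (red s2 + red s3) = - 3 * red x1"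
    using d0 by (simp only: mult_cancel_left) simp
  moreover have "red (xy_ratio P) = red x1" "red (xy_ratio Q) = red x1 + red s2 * red d0"
    "red (xy_ratio R) = red x1 + red s3 * red d0"
    by (simp_all add: P(1) Q(1) R xy_ratio_proj q(2))
  ultimately show "red (xy_ratio P) + red (xy_ratio Q) + red (xy_ratio R) = 0"
    by (simp add: algebra_simps)
qed

end

section \<open>The place of a rational function field at a point of the line\<close>

definition poly_place :: "'r::idom \<Rightarrow> 'r poly fract set" where
  "poly_place e = {Fraction_Field.Fract p q | p q. poly q e \<noteq> 0}"

definition poly_red :: "'r::idom \<Rightarrow> 'r poly fract \<Rightarrow> 'r fract" where
  "poly_red e x = (THE y. \<exists>p q. x = Fraction_Field.Fract p q \<and> poly q e \<noteq> 0 \<and>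
                     y = Fraction_Field.Fract (poly p e) (poly q e))"

lemma poly_red_Fract:
  assumes "poly q e \<noteq> 0"
  shows "poly_red e (Fraction_Field.Fract p q) = Fraction_Field.Fract (poly p e) (poly q e)"
  unfolding poly_red_def
proof (rule the_equality)
  show "\<exists>p' q'. Fraction_Field.Fract p q = Fraction_Field.Fract p' q' \<and> poly q' e \<noteq> 0 \<and>
     Fraction_Field.Fract (poly p e) (poly q e) = Fraction_Field.Fract (poly p' e) (poly q' e)"
    using assms by blast
  fix y assume "\<exists>p' q'. Fraction_Field.Fract p q = Fraction_Field.Fract p' q' \<and> poly q' e \<noteq> 0 \<and>
     y = Fraction_Field.Fract (poly p' e) (poly q' e)"
  then obtain p' q' where *: "Fraction_Field.Fract p q = Fraction_Field.Fract p' q'" "poly q' e \<noteq> 0"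
     "y = Fraction_Field.Fract (poly p' e) (poly q' e)" by blast
  have "q \<noteq> 0" "q' \<noteq> 0" using assms *(2) by auto
  then have "p * q' = p' * q" using *(1) by (simp add: eq_fract)
  then have "poly p e * poly q' e = poly p' e * poly q e" by (metis poly_mult)
  then show "y = Fraction_Field.Fract (poly p e) (poly q e)"
    using assms *(2,3) by (simp add: eq_fract)
qed

lemma poly_placeE:
  assumes "x \<in> poly_place e"
  obtains p q where "x = Fraction_Field.Fract p q" "poly q e \<noteq> 0" "q \<noteq> 0"
  using assms unfolding poly_place_def by force

lemma Fract_in_poly_place: "poly q e \<noteq> 0 \<Longrightarrow> Fraction_Field.Fract p q \<in> poly_place e"
  by (auto simp: poly_place_def)

lemma place_poly_place:
  fixes e :: "'r::linordered_idom"
  shows "place (poly_place e) (poly_red e)"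
proof
  show "1 \<in> poly_place e" "poly_red e 1 = 1"
    by (simp_all add: One_fract_def Fract_in_poly_place poly_red_Fract)
  fix x y :: "'r poly fract"
  show "x + y \<in> poly_place e" "poly_red e (x + y) = poly_red e x + poly_red e y"
    "x * y \<in> poly_place e" "poly_red e (x * y) = poly_red e x * poly_red e y"
    if "x \<in> poly_place e" "y \<in> poly_place e"
    using that by (auto elim!: poly_placeE simp: poly_red_Fract Fract_in_poly_place)
  show "- x \<in> poly_place e" if "x \<in> poly_place e"
    using that by (auto elim!: poly_placeE simp: Fract_in_poly_place)
  show "inverse x \<in> poly_place e" if x: "x \<in> poly_place e" "poly_red e x \<noteq> 0"
  proof -
    obtain p q where pq: "x = Fraction_Field.Fract p q" "poly q e \<noteq> 0"
      using x(1) by (rule poly_placeE)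
    then have "poly p e \<noteq> 0" using x(2) by (auto simp: poly_red_Fract fract_collapse)
    then show ?thesis by (simp add: pq(1) Fract_in_poly_place)
  qed
  show "x \<in> poly_place e \<or> inverse x \<in> poly_place e"
  proof (cases x rule: Fract_cases_nonzero)
    case (Fract p q)
    obtain p' where p': "p = [:- e, 1:] ^ order e p * p'" "\<not> [:- e, 1:] dvd p'"
      using order_decomp[OF Fract(3)] by blast
    obtain q' where q': "q = [:- e, 1:] ^ order e q * q'" "\<not> [:- e, 1:] dvd q'"
      using order_decomp[OF Fract(2)] by blast
    define i j where "i = order e p" and "j = order e q"
    have ev: "poly p' e \<noteq> 0" "poly q' e \<noteq> 0" using p'(2) q'(2) by (simp_all add: poly_eq_0_iff_dvd)
    show ?thesis
    proof (cases "j \<le> i")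
      case True
      have "x = Fraction_Field.Fract ([:- e, 1:] ^ j * ([:- e, 1:] ^ (i - j) * p')) ([:- e, 1:] ^ j * q')"
        unfolding Fract(1) using p'(1) q'(1) True
        by (simp add: i_def j_def mult.assoc [symmetric] power_add [symmetric])
      also have "\<dots> = Fraction_Field.Fract ([:- e, 1:] ^ (i - j) * p') q'"
        by (rule mult_fract_cancel) simp
      finally show ?thesis using ev by (simp add: Fract_in_poly_place)
    next
      case False
      have "inverse x = Fraction_Field.Fract ([:- e, 1:] ^ i * ([:- e, 1:] ^ (j - i) * q')) ([:- e, 1:] ^ i * p')"
        unfolding Fract(1) using p'(1) q'(1) False
        by (simp add: i_def j_def mult.assoc [symmetric] power_add [symmetric])
      also have "\<dots> = Fraction_Field.Fract ([:- e, 1:] ^ (j - i) * q') p'"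
        by (rule mult_fract_cancel) simp
      finally show ?thesis using ev by (simp add: Fract_in_poly_place)
    qed
  next
    case 0
    then show ?thesis by (simp add: Zero_fract_def Fract_in_poly_place)
  qed
qed

lemma poly_place_uniformizer:
  assumes "x \<in> poly_place e" "poly_red e x = 0"
  shows "x / Fraction_Field.Fract [:- e, 1:] 1 \<in> poly_place e"
proof -
  obtain p q where x: "x = Fraction_Field.Fract p q" "poly q e \<noteq> 0" "q \<noteq> 0"
    using assms(1) by (rule poly_placeE)
  have "poly p e = 0" using assms(2) x by (simp add: poly_red_Fract Zero_fract_def eq_fract)
  then obtain p' where p: "p = [:- e, 1:] * p'" by (auto simp: poly_eq_0_iff_dvd elim: dvdE)
  have "x / Fraction_Field.Fract [:- e, 1:] 1 = Fraction_Field.Fract ([:- e, 1:] * p') ([:- e, 1:] * q)"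
    unfolding x(1) p by (simp add: mult.commute)
  also have "\<dots> = Fraction_Field.Fract p' q" by (rule mult_fract_cancel) simp
  finally show ?thesis using x(2) by (simp add: Fract_in_poly_place)
qed

section \<open>Three independent points on each curve\<close>

abbreviation to_frac :: "'r::idom \<Rightarrow> 'r fract" where
  "to_frac p \<equiv> Fraction_Field.Fract p 1"

lemma to_frac_eq_0_iff: "to_frac p = 0 \<longleftrightarrow> p = 0"
  by (simp add: Zero_fract_def eq_fract)

lemma of_int_fract: "of_int n = to_frac (of_int n)"
  by (cases n rule: int_cases2) (simp_all add: of_nat_fract)

text \<open>
  The place \<open>t = - r - s\<close> of \<open>\<rat>(r, s)(t)\<close>, a zero of the first factor of \<open>B\<close>.  The residue field is
  \<open>\<rat>(r, s)\<close>, with indeterminates \<open>resid_r\<close> and \<open>resid_s\<close>.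
\<close>

definition resid_r :: "rat poly poly fract" where "resid_r = to_frac [:[:0, 1:]:]"
definition resid_s :: "rat poly poly fract" where "resid_s = to_frac [:0, 1:]"
definition pt0 :: "rat poly poly" where "pt0 = - ([:[:0, 1:]:] + [:0, 1:])"
definition V0 :: "rat_fun3 set" where "V0 = poly_place pt0"
definition red0 :: "rat_fun3 \<Rightarrow> rat poly poly fract" where "red0 = poly_red pt0"

lemma resid_nonzero: "resid_r \<noteq> 0" "resid_s \<noteq> 0" "resid_r + resid_s \<noteq> 0"
  by (simp_all add: resid_r_def resid_s_def to_frac_eq_0_iff)

text \<open>
  The reductions of the three points turn out to be a common multiple of \<open>1 / r\<close>, \<open>1 / s\<close> and
  \<open>1 / t = - 1 / (r + s)\<close>.  After clearing denominators a relation is a quadratic form in \<open>r\<close>, \<open>s\<close> that vanishes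
  identically; its values at \<open>(0, 1)\<close>, \<open>(1, 0)\<close>, \<open>(1, 1)\<close> give the coefficients.
\<close>

lemma reciprocals_independent:
  fixes n1 n2 n3 :: int
  assumes k: "k \<noteq> 0"
    and rel: "of_int n1 * (k / resid_r) + of_int n2 * (k / resid_s)
       + of_int n3 * (- k / (resid_r + resid_s)) = 0"
  shows "n1 = 0 \<and> n2 = 0 \<and> n3 = 0"
proof -
  have clear: "k * (a * (y * (x + y)) + b * (x * (x + y)) - c * (x * y)) =
      x * y * (x + y) * (a * (k / x) + b * (k / y) + c * (- k / (x + y)))"
    if nz: "x \<noteq> 0" "y \<noteq> 0" "x + y \<noteq> 0" for a b c x y :: "rat poly poly fract"
  proof -
    define \<alpha> \<beta> \<gamma> where "\<alpha> = k / x" and "\<beta> = k / y" and "\<gamma> = - k / (x + y)"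
    have "x * \<alpha> = k" "y * \<beta> = k" "(x + y) * \<gamma> = - k"
      using nz by (simp_all add: \<alpha>_def \<beta>_def \<gamma>_def)
    moreover have "x * y * (x + y) * (a * \<alpha> + b * \<beta> + c * \<gamma>) =
       a * (y * (x + y)) * (x * \<alpha>) + b * (x * (x + y)) * (y * \<beta>) + c * (x * y) * ((x + y) * \<gamma>)"
      by (simp add: algebra_simps)
    ultimately show ?thesis
      unfolding \<alpha>_def [symmetric] \<beta>_def [symmetric] \<gamma>_def [symmetric]
      by (simp add: algebra_simps)
  qed
  have "k * (of_int n1 * (resid_s * (resid_r + resid_s)) + of_int n2 * (resid_r * (resid_r + resid_s))
      - of_int n3 * (resid_r * resid_s)) = resid_r * resid_s * (resid_r + resid_s) *
      (of_int n1 * (k / resid_r) + of_int n2 * (k / resid_s) + of_int n3 * (- k / (resid_r + resid_s)))"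
    using clear[OF resid_nonzero] .
  then have "of_int n1 * (resid_s * (resid_r + resid_s)) + of_int n2 * (resid_r * (resid_r + resid_s))
      - of_int n3 * (resid_r * resid_s) = 0"
    unfolding rel using k by simp
  then have "to_frac (of_int n1 * ([:0, 1:] * ([:[:0, 1:]:] + [:0, 1:]))
      + of_int n2 * ([:[:0, 1:]:] * ([:[:0, 1:]:] + [:0, 1:]))
      - of_int n3 * ([:[:0, 1:]:] * [:0, 1:]) :: rat poly poly) = 0"
    by (simp only: resid_r_def resid_s_def of_int_fract add_fract mult_fract diff_fract one_neq_zero not_False_eq_True mult_1_right mult_1_left)
  then have "of_int n1 * ([:0, 1:] * ([:[:0, 1:]:] + [:0, 1:]))
      + of_int n2 * ([:[:0, 1:]:] * ([:[:0, 1:]:] + [:0, 1:]))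
      - of_int n3 * ([:[:0, 1:]:] * [:0, 1:]) = (0 :: rat poly poly)"
    by (simp only: to_frac_eq_0_iff)
  then have e: "poly (poly (of_int n1 * ([:0, 1:] * ([:[:0, 1:]:] + [:0, 1:]))
      + of_int n2 * ([:[:0, 1:]:] * ([:[:0, 1:]:] + [:0, 1:]))
      - of_int n3 * ([:[:0, 1:]:] * [:0, 1:])) [:y:]) x = 0" for x y :: rat
    by simp
  have e': "of_int n1 * (y * (x + y)) + of_int n2 * (x * (x + y)) - of_int n3 * (x * y) = 0" for x y :: rat
    using e[of y x] by (simp add: of_int_poly algebra_simps)
  have "of_int n1 = (0::rat)" "of_int n2 = (0::rat)" using e'[of 1 0] e'[of 0 1] by simp_all
  moreover have "of_int n3 = (0::rat)" using e'[of 1 1] calculation by simp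
  ultimately show ?thesis by simp
qed

lemma selmer_identity:
  fixes r s t :: "'a::comm_ring_1"
  defines "A \<equiv> 9 * (r^6 - r^3*s^3 + s^6 - r^3*t^3 - s^3*t^3 + t^6)"
    and "B \<equiv> - ((r + s + t) *
           (r^2 + 2*r*s + s^2 - r*t - s*t + t^2) *
           (r^2 - r*s + s^2 + 2*r*t - s*t + t^2) *
           (r^2 - r*s + s^2 - r*t + 2*s*t + t^2) *
           (r^2 - r*s + s^2 - r*t - s*t + t^2))"
  shows "(2*r^3 - s^3 - t^3)^3 = A * r^3 + B" "(2*s^3 - r^3 - t^3)^3 = A * s^3 + B"
    "(2*t^3 - r^3 - s^3)^3 = A * t^3 + B"
  unfolding A_def B_def by (simp_all add: algebra_simps eval_nat_numeral)

context
  fixes r s t A B u v w :: rat_fun3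
  assumes rst: "r = indet_r" "s = indet_s" "t = indet_t"
    and A_eq: "A = 9 * (r^6 - r^3*s^3 + s^6 - r^3*t^3 - s^3*t^3 + t^6)"
    and B_eq: "B = - ((r + s + t) *
           (r^2 + 2*r*s + s^2 - r*t - s*t + t^2) *
           (r^2 - r*s + s^2 + 2*r*t - s*t + t^2) *
           (r^2 - r*s + s^2 - r*t + 2*s*t + t^2) *
           (r^2 - r*s + s^2 - r*t - s*t + t^2))"
    and u_eq: "u = 2*t^3 - r^3 - s^3"
    and v_eq: "v = 2*s^3 - r^3 - t^3"
    and w_eq: "w = 2*r^3 - s^3 - t^3"
begin

lemma points_on_selmer: "w^3 = A * r^3 + B" "v^3 = A * s^3 + B" "u^3 = A * t^3 + B"
  unfolding A_eq B_eq u_eq v_eq w_eq by (rule selmer_identity)+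

interpretation place V0 red0 unfolding V0_def red0_def by (rule place_poly_place)

lemma red_rst:
  "r \<in> V0" "s \<in> V0" "t \<in> V0" "red0 r = resid_r" "red0 s = resid_s" "red0 t = - (resid_r + resid_s)"
  unfolding V0_def red0_def rst indet_r_def indet_s_def indet_t_def resid_r_def resid_s_def
  by (simp_all add: Fract_in_poly_place poly_red_Fract pt0_def)

text \<open>
  At \<open>t = - r - s\<close> the factor \<open>a = 3 (r\<^sup>2 + r s + s\<^sup>2)\<close> satisfies \<open>w = a r\<close>, \<open>v = a s\<close>, \<open>u = a t\<close>, in accordance
  with \<open>A = a\<^sup>3\<close>: the three points lie on the rational branch \<open>y = a x\<close>.
\<close>

lemma red_uvw:
  defines "a \<equiv> 3 * (resid_r^2 + resid_r * resid_s + resid_s^2)"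
  shows "w \<in> V0" "v \<in> V0" "u \<in> V0" "red0 w = a * resid_r" "red0 v = a * resid_s"
    "red0 u = - (a * (resid_r + resid_s))" "A \<in> V0" "red0 A = a^3" "a \<noteq> 0"
proof -
  show "w \<in> V0" "v \<in> V0" "u \<in> V0" "A \<in> V0"
    unfolding w_eq v_eq u_eq A_eq by (simp_all add: red_rst)
  show "red0 w = a * resid_r" "red0 v = a * resid_s" "red0 u = - (a * (resid_r + resid_s))"
    unfolding w_eq v_eq u_eq a_def
    by (simp_all add: red_rst) (simp_all add: algebra_simps power2_eq_square power3_eq_cube)
  show "red0 A = a^3"
    unfolding A_eq a_def
    by (simp add: red_rst) (simp add: algebra_simps eval_nat_numeral)
  show "a \<noteq> 0" unfolding a_def using sum_of_powers_eq_0(1)[of resid_r resid_s] resid_nonzero(1) by auto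
qed

text \<open>
  \<open>B\<close> vanishes only once at the place: the other factors reduce to \<open>3 (r + s)\<^sup>2\<close>, \<open>3 s\<^sup>2\<close>, \<open>3 r\<^sup>2\<close> and
  \<open>3 (r\<^sup>2 + r s + s\<^sup>2)\<close>.
\<close>

lemma B_factor:
  obtains C where "B = (r + s + t) * C" "C \<in> V0" "red0 C \<noteq> 0"
proof -
  define f1 f2 f3 f4 where "f1 = r^2 + 2*r*s + s^2 - r*t - s*t + t^2"
    and "f2 = r^2 - r*s + s^2 + 2*r*t - s*t + t^2"
    and "f3 = r^2 - r*s + s^2 - r*t + 2*s*t + t^2"
    and "f4 = r^2 - r*s + s^2 - r*t - s*t + t^2"
  have V: "f1 \<in> V0" "f2 \<in> V0" "f3 \<in> V0" "f4 \<in> V0"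
    by (simp_all add: f1_def f2_def f3_def f4_def red_rst)
  have red: "red0 f1 = 3 * (resid_r + resid_s)^2" "red0 f2 = 3 * resid_s^2" "red0 f3 = 3 * resid_r^2"
      "red0 f4 = 3 * (resid_r^2 + resid_r * resid_s + resid_s^2)"
    by (simp_all add: f1_def f2_def f3_def f4_def red_rst) (simp_all add: algebra_simps power2_eq_square)
  show ?thesis
  proof (rule that)
    show "B = (r + s + t) * - (f1 * f2 * f3 * f4)"
      unfolding B_eq f1_def f2_def f3_def f4_def by (simp only: mult_minus_right mult.assoc)
    show "- (f1 * f2 * f3 * f4) \<in> V0" by (simp add: V)
    show "red0 (- (f1 * f2 * f3 * f4)) \<noteq> 0"
      using resid_nonzero red_uvw(9) by (simp add: V red)
  qed
qed

interpretation selmer_place V0 red0 A B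
proof
  obtain C where C: "B = (r + s + t) * C" "C \<in> V0" "red0 C \<noteq> 0" by (rule B_factor)
  have pi: "r + s + t = Fraction_Field.Fract [:- pt0, 1:] 1"
    by (simp add: rst indet_r_def indet_s_def indet_t_def pt0_def)
  show "A \<in> V0" "red0 A \<noteq> 0" using red_uvw by simp_all
  show "B \<in> V0" "red0 B = 0" using C by (simp_all add: red_rst)
  have "r + s + t \<noteq> 0" by (simp add: pi to_frac_eq_0_iff)
  then show "B \<noteq> 0" using C by auto
  show "x / B \<in> V0" if "x \<in> V0" "red0 x = 0" for x
  proof -
    have "x / (r + s + t) \<in> V0" using poly_place_uniformizer that unfolding pi V0_def red0_def by blast
    then have "x / (r + s + t) / C \<in> V0" using C(2,3) by (rule divide_V)
    then show ?thesis by (simp add: C(1))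
  qed
qed

interpretation E_place V0 red0 A B
  by standard (use A_nz B_nz in simp_all)

lemma three_element_list: "length ns = 3 \<Longrightarrow> \<exists>a b c. ns = [a, b, c]"
  by (auto simp: numeral_3_eq_3 length_Suc_conv)

text \<open>
  The three points are the images of \<open>(r, w)\<close>, \<open>(s, v)\<close>, \<open>(t, u)\<close>.  On an image \<open>(A x y, A y\<^sup>3)\<close> the coordinate
  of the cuspidal cubic is \<open>x / y\<^sup>2\<close>.
\<close>

lemma E_independent:
  "Z_independent (mw_group (E_form A B) E_infinity)
     [proj (A * r * w, A * w^3, 1), proj (A * s * v, A * v^3, 1), proj (A * t * u, A * u^3, 1)]"
proof (rule E.Z_independentI[where H = E0 and \<nu> = "\<lambda>P. red0 (xy_ratio P)"])
  have pt: "proj (A * x * y, A * y^3, 1) \<in> E0 \<and>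
      red0 (xy_ratio (proj (A * x * y, A * y^3, 1))) = red0 x / (red0 y)^2"
    if "x \<in> V0" "y \<in> V0" "red0 y \<noteq> 0" "y^3 = A * x^3 + B" for x y
  proof -
    have y: "y \<noteq> 0" using that by auto
    have "proj (A * x * y, A * y^3, 1) = proj (x / y^2, 1, 1 / (A * y^3))"
      unfolding proj_eq_iff using y A_nz
      by (intro exI[of _ "A * y^3"]) (simp add: power2_eq_square power3_eq_cube)
    moreover have "x / y^2 \<in> V0" "1 / (A * y^3) \<in> V0"
      using that(1-3) red_A by (simp_all add: divide_V)
    moreover have "form_eval 3 (E_form A B) (x / y^2, 1, 1 / (A * y^3)) = 0"
    proof -
      have "form_eval 3 (E_form A B) (x / y^2, 1, 1 / (A * y^3)) = (y^3 - B - A * x^3) / (A * y^6)"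
        unfolding form_eval_E using y A_nz by (simp add: field_simps eval_nat_numeral)
      then show ?thesis using that by simp
    qed
    moreover have "red0 (x / y^2) = red0 x / (red0 y)^2" using that by (simp add: red_divide)
    ultimately show ?thesis unfolding E0_def by (auto simp: xy_ratio_proj)
  qed
  define a where "a = 3 * (resid_r^2 + resid_r * resid_s + resid_s^2)"
  note red = red_uvw[folded a_def]
  have nz: "red0 w \<noteq> 0" "red0 v \<noteq> 0" "red0 u \<noteq> 0" using red resid_nonzero by simp_all
  note pw = pt[OF red_rst(1) red(1) nz(1) points_on_selmer(1)]
    and pv = pt[OF red_rst(2) red(2) nz(2) points_on_selmer(2)]
    and pu = pt[OF red_rst(3) red(3) nz(3) points_on_selmer(3)]
  show "E0 \<subseteq> cubic_points (E_form A B)" by (rule E0_subset)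
  have "E_infinity = proj (0, 1, 0 :: rat_fun3)" "form_eval 3 (E_form A B) (0, 1, 0) = 0"
    by (simp_all add: E_infinity_def form_eval_E)
  then show O: "E_infinity \<in> E0"
    unfolding E0_def by (intro CollectI exI[of _ "0 :: rat_fun3"]) simp
  have ls: "line_section (E_form A B) P Q (third_point (E_form A B) P Q)" if "P \<in> E0" "Q \<in> E0" for P Q
    using that E0_subset E.third_line_section by blast
  show "third_point (E_form A B) P Q \<in> E0" if "P \<in> E0" "Q \<in> E0" for P Q
    using E0_line_section(1)[OF ls] that by blast
  show "red0 (xy_ratio (third_point (E_form A B) P Q)) = - red0 (xy_ratio P) - red0 (xy_ratio Q)"
    if "P \<in> E0" "Q \<in> E0" for P Q
    using E0_line_section(2)[OF ls] that by (simp add: algebra_simps eq_neg_iff_add_eq_0)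
  show "set [proj (A * r * w, A * w^3, 1), proj (A * s * v, A * v^3, 1), proj (A * t * u, A * u^3, 1)] \<subseteq> E0"
    using pw pv pu by simp
  fix ns :: "int list"
  assume len: "length ns = length [proj (A * r * w, A * w^3, 1), proj (A * s * v, A * v^3, 1), proj (A * t * u, A * u^3, 1)]"
  then obtain n1 n2 n3 where ns: "ns = [n1, n2, n3]" using three_element_list[of ns] by auto
  assume "(\<Sum>(n, P)\<leftarrow>zip ns [proj (A * r * w, A * w^3, 1), proj (A * s * v, A * v^3, 1), proj (A * t * u, A * u^3, 1)].
       of_int n * (red0 (xy_ratio P) - red0 (xy_ratio E_infinity))) = 0"
  then have "of_int n1 * (red0 r / (red0 w)^2) + of_int n2 * (red0 s / (red0 v)^2)
      + of_int n3 * (red0 t / (red0 u)^2) = 0"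
    using pw pv pu by (simp add: ns E_infinity_def xy_ratio_proj add.assoc)
  moreover have minus: "- m / (- (b * m))^2 = - (1 / b^2) / m" if "m \<noteq> 0" "b \<noteq> 0"
    for m b :: "rat poly poly fract"
    using that by (simp add: power2_eq_square)
  moreover have "red0 r / (red0 w)^2 = (1 / a^2) / resid_r" "red0 s / (red0 v)^2 = (1 / a^2) / resid_s"
    "red0 t / (red0 u)^2 = - (1 / a^2) / (resid_r + resid_s)"
    unfolding red(4-6) red_rst(4-6) using resid_nonzero red(9) minus[OF resid_nonzero(3) red(9)]
    by (simp_all add: power2_eq_square)
  ultimately have "n1 = 0 \<and> n2 = 0 \<and> n3 = 0"
    using reciprocals_independent[of "1 / a^2" n1 n2 n3] red(9) by simp
  then show "\<forall>n\<in>set ns. n = 0" by (simp add: ns)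
qed

text \<open>
  For a base point such as \<open>(r, w)\<close> itself the three given points do not suffice.  In terms of divisor
  classes, the classes \<open>3 P - H\<close>, with \<open>H\<close> the class of a line section, do not involve the base point
  and remain independent.  The point \<open>f P\<close> realizes the class \<open>3 P - H\<close> by chords and tangents: its value under \<open>\<nu>\<close>
  is \<open>\<nu> Z + 3 \<nu> P\<close>.
\<close>

lemma selmer_rank:
  assumes Z: "Z \<in> cubic_points (selmer_form A B)"
  shows "group_rank (mw_group (selmer_form A B) Z) \<ge> 3"
proof -
  let ?C = "cubic_points (selmer_form A B)"
  define \<nu> where "\<nu> P = red0 (zy_ratio P)" for P
  define f where "f P = selmer.third P (selmer.third Z (selmer.third (selmer.third P P) (selmer.third P P)))" for P
  have nu: "\<nu> (selmer.third P Q) = - \<nu> P - \<nu> Q" if "P \<in> ?C" "Q \<in> ?C" for P Q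
    using selmer_line_section_sum[OF selmer.third_line_section[OF that]]
    by (simp add: \<nu>_def algebra_simps eq_neg_iff_add_eq_0)
  have f: "f P \<in> ?C \<and> \<nu> (f P) - \<nu> Z = 3 * \<nu> P" if "P \<in> ?C" for P
    using that Z by (simp add: f_def nu)
  define P1 P2 P3 where "P1 = proj (r, w, 1)" and "P2 = proj (s, v, 1)" and "P3 = proj (t, u, 1)"
  have P: "P1 \<in> ?C" "P2 \<in> ?C" "P3 \<in> ?C"
    using points_on_selmer by (simp_all add: P1_def P2_def P3_def selmer_affine_iff)
  define a where "a = 3 * (resid_r^2 + resid_r * resid_s + resid_s^2)"
  note red = red_uvw[folded a_def]
  have nz: "red0 w \<noteq> 0" "red0 v \<noteq> 0" "red0 u \<noteq> 0" using red resid_nonzero by simp_all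
  have val: "3 * \<nu> P1 = (3 / a) / resid_r" "3 * \<nu> P2 = (3 / a) / resid_s"
    "3 * \<nu> P3 = - (3 / a) / (resid_r + resid_s)"
    using red nz by (simp_all add: \<nu>_def P1_def P2_def P3_def zy_ratio_proj red_divide)
  have "Z_independent (mw_group (selmer_form A B) Z) [f P1, f P2, f P3]"
  proof (rule selmer.Z_independentI[where H = ?C and \<nu> = \<nu>])
    show "set [f P1, f P2, f P3] \<subseteq> ?C" using f P by simp
    fix ns :: "int list"
    assume "length ns = length [f P1, f P2, f P3]"
    then obtain n1 n2 n3 where ns: "ns = [n1, n2, n3]" using three_element_list[of ns] by auto
    assume "(\<Sum>(n, P)\<leftarrow>zip ns [f P1, f P2, f P3]. of_int n * (\<nu> P - \<nu> Z)) = 0"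
    then have "n1 = 0 \<and> n2 = 0 \<and> n3 = 0"
      using reciprocals_independent[of "3 / a" n1 n2 n3] red(9) f P val
      by (simp add: ns add.assoc)
    then show "\<forall>n\<in>set ns. n = 0" by (simp add: ns)
  qed (use Z nu in simp_all)
  then have "enat (length [f P1, f P2, f P3]) \<le> group_rank (mw_group (selmer_form A B) Z)"
    unfolding group_rank_def by (intro Sup_upper) blast
  then show ?thesis by (simp add: numeral_eq_enat numeral_3_eq_3)
qed

lemma AB_nonzero: "A \<noteq> 0" "B \<noteq> 0" by (fact A_nz B_nz)+

end

section \<open>Two formulas for the third point on \<open>E\<close>\<close>

lemma polar_smul: "polar c (smul3 k p) (smul3 l q) = k^2 * l * polar c p (q :: 'a::field vec3)"
proof -
  obtain p1 p2 p3 where p: "p = (p1, p2, p3)" by (cases p)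
  obtain q1 q2 q3 where q: "q = (q1, q2, q3)" by (cases q)
  show ?thesis
    unfolding p q polar_def form_eval_def form_dX_def form_dY_def form_dZ_def
    by (simp add: eval_nat_numeral algebra_simps)
qed

text \<open>
  The third point of the chord through \<open>p\<close> and \<open>q\<close>, as a vector of forms quadratic in each argument.  It is the
  zero vector exactly when the two points of the curve coincide.
\<close>

definition chord :: "'a::field form \<Rightarrow> 'a vec3 \<Rightarrow> 'a vec3 \<Rightarrow> 'a vec3" where
  "chord c p q = smul3 (polar c q p) p + smul3 (- polar c p q) q"

lemma chord_smul: "chord c (smul3 k p) (smul3 l q) = smul3 (k^2 * l^2) (chord c p q)"
  unfolding chord_def polar_smul smul3_add smul3_assoc by (simp add: power2_eq_square mult_ac)

lemma chord_self: "form_eval 3 c p = 0 \<Longrightarrow> chord c p p = (0 :: 'a::field vec3)"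
  unfolding chord_def polar_self by (cases p) (simp add: zero_vec3)

lemma chord_nonzero_imp:
  assumes "form_eval 3 c p = 0" "chord c p q \<noteq> 0"
  shows "proj p \<noteq> proj q"
proof
  assume "proj p = proj q"
  then obtain k where "k \<noteq> 0" "q = smul3 k p" by (metis proj_eq_iff)
  then have "chord c p q = smul3 (1^2 * k^2) (chord c p p)"
    using chord_smul[of c 1 p k p] by simp
  then show False using assms by (simp add: chord_self smul3_eq_0_iff)
qed

lemma proj_eq_of_minors:
  fixes a1 :: "'a::field"
  assumes nz: "(a1, a2, a3) \<noteq> 0" "(b1, b2, b3) \<noteq> 0"
    and m: "a1 * b2 = a2 * b1" "a1 * b3 = a3 * b1" "a2 * b3 = a3 * b2"
  shows "proj (a1, a2, a3) = proj (b1, b2, b3)"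
proof -
  consider "b1 \<noteq> 0" | "b2 \<noteq> 0" | "b3 \<noteq> 0" using nz(2) by (auto simp: zero_vec3)
  then obtain k where k: "a1 = k * b1" "a2 = k * b2" "a3 = k * b3"
  proof cases
    case 1
    show ?thesis by (rule that[of "a1 / b1"]) (use 1 m in \<open>simp_all add: field_simps\<close>)
  next
    case 2
    show ?thesis by (rule that[of "a2 / b2"]) (use 2 m in \<open>simp_all add: field_simps\<close>)
  next
    case 3
    show ?thesis by (rule that[of "a3 / b3"]) (use 3 m in \<open>simp_all add: field_simps\<close>)
  qed
  moreover have "k \<noteq> 0" using k nz(1) by (auto simp: zero_vec3)
  ultimately show ?thesis by (auto simp: proj_eq_iff)
qed

definition neg_E :: "'a::field \<Rightarrow> 'a vec3 \<Rightarrow> 'a vec3" where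
  "neg_E c = (\<lambda>(x, y, z). (x, c * z - y, z))"

text \<open>
  With \<open>c = A B\<close>, the point \<open>S = (0, 0, 1)\<close> of \<open>E\<close> has order 3, and translations by \<open>S\<close> and \<open>- S\<close> are induced by
  linear maps of the plane, \<open>rot_E\<close> and \<open>unrot_E\<close>.
\<close>

definition rot_E :: "'a::field \<Rightarrow> 'a vec3 \<Rightarrow> 'a vec3" where
  "rot_E c = (\<lambda>(x, y, z). (c * x, - (c^2 * z), y - c * z))"

definition unrot_E :: "'a::field \<Rightarrow> 'a vec3 \<Rightarrow> 'a vec3" where
  "unrot_E c = (\<lambda>(x, y, z). (c * x, c^2 * z - c * y, - y))"

context
  fixes A B :: "'a::field_char_0"
  assumes AB: "A * B \<noteq> 0"
begin

interpretation E: line_cubic "E_form A B"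
  by (rule line_cubic_E) (rule AB)

lemma E_infinity_on: "E_infinity \<in> cubic_points (E_form A B)"
  unfolding E_infinity_def by (rule cubic_pointsI) (simp_all add: zero_vec3 form_eval_E)

lemma neg_E_on:
  assumes "p \<noteq> 0" "form_eval 3 (E_form A B) p = 0"
  shows "neg_E (A * B) p \<noteq> 0" "form_eval 3 (E_form A B) (neg_E (A * B) p) = 0"
  using assms
  by (cases p; auto simp: neg_E_def zero_vec3 form_eval_E algebra_simps power2_eq_square)+

lemma third_infinity:
  assumes p: "p \<noteq> 0" "form_eval 3 (E_form A B) p = 0"
  shows "E.third E_infinity (proj p) = proj (neg_E (A * B) p)"
proof -
  obtain x y z where v: "p = (x, y, z)" by (cases p)
  let ?o = "(0, 1, 0) :: 'a vec3"
  have o: "?o \<noteq> 0" "form_eval 3 (E_form A B) ?o = 0" by (simp_all add: zero_vec3 form_eval_E)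
  show ?thesis
  proof (cases "z = 0")
    case True
    then have x: "x = 0" using p by (simp add: v form_eval_E)
    then have y: "y \<noteq> 0" using p True by (simp add: v zero_vec3)
    have P: "proj p = proj ?o" unfolding proj_eq_iff using x y True by (intro exI[of _ y]) (simp add: v)
    have d: "indep ?o (1, 0, 0)" "polar (E_form A B) ?o (1, 0, 0) = 0"
      by (simp_all add: indep_def zero_vec3 polar_E)
    have "E.third (proj ?o) (proj ?o) = proj (smul3 (- 1) ?o)"
      using E.third_tangent(2)[OF o d] by (simp add: form_eval_E polar_E)
    also have "\<dots> = proj (neg_E (A * B) p)"
      unfolding proj_eq_iff v neg_E_def using x y True by (intro exI[of _ "1 / y"]) simp
    finally show ?thesis unfolding E_infinity_def P .
  next
    case False
    have ind: "indep ?o p"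
      unfolding indep_def using False by (auto simp: v zero_vec3)
    have "E.third (proj ?o) (proj p) = proj (smul3 (- z) (neg_E (A * B) p))"
      unfolding E.third_chord(3)[OF o(2) p(2) ind, unfolded v] v neg_E_def polar_E
      by (simp add: algebra_simps power2_eq_square)
    then show ?thesis using False by (simp add: E_infinity_def proj_smul)
  qed
qed

lemma rot_E_on:
  assumes "p \<noteq> 0" "form_eval 3 (E_form A B) p = 0"
  shows "rot_E (A * B) p \<noteq> 0" "form_eval 3 (E_form A B) (rot_E (A * B) p) = 0"
    "unrot_E (A * B) p \<noteq> 0" "form_eval 3 (E_form A B) (unrot_E (A * B) p) = 0"
proof -
  obtain x y z where v: "p = (x, y, z)" by (cases p)
  define c where "c = A * B"
  have F: "form_eval 3 (E_form A B) (x, y, z) = y^2 * z - c * y * z^2 - x^3" for x y z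
    by (simp add: form_eval_E c_def)
  have c: "c \<noteq> 0" using AB by (simp add: c_def)
  have "form_eval 3 (E_form A B) (rot_E c p) = c^3 * form_eval 3 (E_form A B) p"
    "form_eval 3 (E_form A B) (unrot_E c p) = c^3 * form_eval 3 (E_form A B) p"
    unfolding v rot_E_def unrot_E_def prod.case F
    by (simp_all add: algebra_simps power2_eq_square power3_eq_cube)
  then show "form_eval 3 (E_form A B) (rot_E (A * B) p) = 0"
    "form_eval 3 (E_form A B) (unrot_E (A * B) p) = 0"
    using assms by (simp_all add: c_def)
  show "rot_E (A * B) p \<noteq> 0" "unrot_E (A * B) p \<noteq> 0"
    unfolding c_def [symmetric] using assms(1) c by (auto simp: v rot_E_def unrot_E_def zero_vec3)
qed

text \<open>
  The common factor \<open>c\<^sup>3\<close> is split off to obtain coordinates that can be compared with the chord and the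
  tangent construction.
\<close>

lemma chord_rot_unrot:
  assumes c: "c = A * B"
  shows "chord (E_form A B) (rot_E c (x, y, z)) (unrot_E c (f, g, h)) = smul3 (c^3)
    (- (c^3 * x * z * h^2) - c^3 * z^2 * f * h + c^2 * x * y * h^2 + 2 * c^2 * x * z * g * h + c * y^2 * f * h + 2 * c * y * z * f * g - x * y * g^2 - y^2 * f * g,
     - (c^3 * y * z * h^2) - c^3 * z^2 * g * h + 3 * c^2 * x^2 * f * h + 3 * c^2 * x * z * f^2 + c^2 * y^2 * h^2 + 2 * c^2 * y * z * g * h - 3 * c * x^2 * f * g - 2 * c * y^2 * g * h - c * y * z * g^2 + y^2 * g^2,
     c^3 * z^2 * h^2 - 2 * c^2 * y * z * h^2 - c^2 * z^2 * g * h + 3 * c * x * z * f^2 + c * y^2 * h^2 + 2 * c * y * z * g * h - 3 * x^2 * f * g - 3 * x * y * f^2 - y^2 * g * h - y * z * g^2)"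
  unfolding chord_def rot_E_def unrot_E_def prod.case polar_E
  by (simp add: c algebra_simps power2_eq_square power3_eq_cube)

text \<open>
  The tangent is spanned by the point and the tangent direction with \<open>z = 0\<close>, a choice that works
  also at the points of order 2.  At infinity, a flex, the claim is checked separately.
\<close>

lemma third_self:
  assumes p: "(x, y, z) \<noteq> 0" "form_eval 3 (E_form A B) (x, y, z) = 0" and c: "c = A * B"
  shows "E.third (proj (x, y, z)) (proj (x, y, z)) = proj
    (- (2 * c^3 * x * z^3) + 3 * c^2 * x * y * z^2 + 3 * c * x * y^2 * z - 2 * x * y^3,
     - (8 * c^3 * y * z^3) + 12 * c^2 * y^2 * z^2 - 6 * c * y^3 * z + y^4,
     c^3 * z^4 - 6 * c^2 * y * z^3 + 12 * c * y^2 * z^2 - 8 * y^3 * z)"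
proof (cases "z = 0")
  case True
  then have x: "x = 0" using p by (simp add: form_eval_E)
  then have y: "y \<noteq> 0" using p True by (simp add: zero_vec3)
  have P: "proj (x, y, z) = E_infinity"
    unfolding proj_eq_iff E_infinity_def using x y True by (intro exI[of _ y]) simp
  have "E.third E_infinity (proj (x, y, z)) = proj (neg_E (A * B) (x, y, z))"
    by (rule third_infinity[OF p])
  also have "\<dots> = E_infinity"
    unfolding proj_eq_iff E_infinity_def neg_E_def
    using x y True by (intro exI[of _ "- y"]) simp
  finally have "E.third E_infinity (proj (x, y, z)) = E_infinity" .
  moreover have "proj (0, y^4, 0) = E_infinity"
    unfolding proj_eq_iff E_infinity_def using y by (intro exI[of _ "y^4"]) simp
  ultimately show ?thesis unfolding P by (simp add: x True)
next
  case False
  have e: "x * (x * x) = y * (y * z) - c * (y * (z * z))"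
    using p(2) by (simp add: form_eval_E c power2_eq_square power3_eq_cube algebra_simps)
  \<comment> \<open>a rewrite rule that lowers the degree in \<open>x\<close> by means of the curve equation\<close>
  have e': "x * (x * (x * k)) = (y * (y * z) - c * (y * (z * z))) * k" for k
    using e by (metis mult.assoc)
  \<comment> \<open>the intersection of the tangent with the line \<open>z = 0\<close>\<close>
  let ?p = "(x, y, z)" and ?d = "(2 * y * z - c * z^2, 3 * x^2, 0)"
  have "(2 * y * z - c * z^2, 3 * x^2) \<noteq> (0, 0)"
  proof
    assume "(2 * y * z - c * z^2, 3 * x^2) = (0, 0)"
    then have 0: "z * (2 * y - c * z) = 0" "x = 0" by (simp_all add: algebra_simps power2_eq_square)
    then have cz: "c * z = 2 * y" using False by simp
    have "z * (y * (y - c * z)) = y * (y * z) - c * (y * (z * z))" by (simp add: algebra_simps)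
    then have "z * (y * (y - c * z)) = 0" unfolding e [symmetric] 0(2) by simp
    then have "y = 0" using False cz by auto
    then show False using cz False AB c by simp
  qed
  then have ind: "indep ?p ?d"
    unfolding indep_def using False by (auto simp: zero_vec3)
  have tan: "polar (E_form A B) ?p ?d = 0"
    by (simp add: polar_E c)
  have "E.third (proj ?p) (proj ?p) =
      proj (smul3 (form_eval 3 (E_form A B) ?d) ?p + smul3 (- polar (E_form A B) ?d ?p) ?d)"
    by (rule E.third_tangent(2)[OF p ind tan])
  also have "smul3 (form_eval 3 (E_form A B) ?d) ?p + smul3 (- polar (E_form A B) ?d ?p) ?d =
     smul3 (z^3)
    (- (2 * c^3 * x * z^3) + 3 * c^2 * x * y * z^2 + 3 * c * x * y^2 * z - 2 * x * y^3,
     - (8 * c^3 * y * z^3) + 12 * c^2 * y^2 * z^2 - 6 * c * y^3 * z + y^4,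
     c^3 * z^4 - 6 * c^2 * y * z^3 + 12 * c * y^2 * z^2 - 8 * y^3 * z)"
    unfolding polar_E form_eval_E c [symmetric]
    by (simp add: algebra_simps eval_nat_numeral e e')
  finally show ?thesis using False by (simp add: proj_smul del: smul3.simps)
qed

text \<open>
  Since \<open>(p + S) + (n - S) = p + n\<close>, the chord through \<open>p + S\<close> and \<open>n - S\<close> has the same third point as the
  chord through \<open>p\<close> and \<open>n\<close>.  This covers \<open>p = n\<close>, where the chord formula degenerates; there it is compared with the
  tangent (\<open>third_self\<close>).  For distinct points the two vectors are compared through their \<open>2 \<times> 2\<close> minors,
  which vanish modulo the equations of the curve at \<open>p\<close> and \<open>n\<close>.
\<close>

lemma third_rot:
  assumes p: "p \<noteq> 0" "form_eval 3 (E_form A B) p = 0" and n: "n \<noteq> 0" "form_eval 3 (E_form A B) n = 0"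
    and nz: "chord (E_form A B) (rot_E (A * B) p) (unrot_E (A * B) n) \<noteq> 0"
  shows "E.third (proj p) (proj n) = proj (chord (E_form A B) (rot_E (A * B) p) (unrot_E (A * B) n))"
proof -
  obtain x y z where pv: "p = (x, y, z)" by (cases p)
  obtain f g h where nv: "n = (f, g, h)" by (cases n)
  define c where "c = A * B"
  have c: "c \<noteq> 0" using AB by (simp add: c_def)
  have e: "x * (x * x) = y * (y * z) - c * (y * (z * z))"
    using p(2) by (simp add: pv form_eval_E c_def power2_eq_square power3_eq_cube algebra_simps)
  have e': "x * (x * (x * k)) = (y * (y * z) - c * (y * (z * z))) * k" for k
    using e by (metis mult.assoc)
  show ?thesis
  proof (cases "proj p = proj n")
    case True
    then obtain k where k: "k \<noteq> 0" "n = smul3 k p" by (metis proj_eq_iff)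
    have "unrot_E c n = smul3 k (unrot_E c p)"
      by (simp add: k(2) pv unrot_E_def algebra_simps)
    then have "chord (E_form A B) (rot_E c p) (unrot_E c n) =
        smul3 (k^2) (chord (E_form A B) (rot_E c p) (unrot_E c p))"
      using chord_smul[of "E_form A B" 1 "rot_E c p" k] by simp
    also have "\<dots> = smul3 (k^2 * c^3)
    (- (2 * c^3 * x * z^3) + 3 * c^2 * x * y * z^2 + 3 * c * x * y^2 * z - 2 * x * y^3,
     - (8 * c^3 * y * z^3) + 12 * c^2 * y^2 * z^2 - 6 * c * y^3 * z + y^4,
     c^3 * z^4 - 6 * c^2 * y * z^3 + 12 * c * y^2 * z^2 - 8 * y^3 * z)"
      unfolding pv chord_rot_unrot[OF c_def] smul3_assoc
      by (simp add: algebra_simps power2_eq_square power3_eq_cube eval_nat_numeral e e')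
    finally show ?thesis
      using third_self[OF p[unfolded pv] c_def] k(1) c
      by (simp add: True [symmetric] pv c_def [symmetric] proj_smul del: smul3.simps)
  next
    case False
    have ind: "indep p n" using False p n by (simp add: indep_iff)
    have t: "E.third (proj p) (proj n) = proj (chord (E_form A B) p n)"
      unfolding chord_def by (rule E.third_chord(3)[OF p(2) n(2) ind])
    have nz': "chord (E_form A B) p n \<noteq> 0"
      unfolding chord_def
      by (rule indep_nonzero[OF ind]) (use E.third_chord(1)[OF p(2) n(2) ind] in auto)
    have m: "f * (f * f) = g * (g * h) - c * (g * (h * h))"
      using n(2) by (simp add: nv form_eval_E c_def power2_eq_square power3_eq_cube algebra_simps)
    have m': "f * (f * (f * k)) = (g * (g * h) - c * (g * (h * h))) * k" for k
      using m by (metis mult.assoc)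
    define a1 where "a1 = - (c * x * y * h^2) - 2 * c * x * z * g * h + 2 * c * y * z * f * h + c * z^2 * f * g + 2 * x * y * g * h + x * z * g^2 - y^2 * f * h - 2 * y * z * f * g"
    define a2 where "a2 = - (c * y^2 * h^2) + c * z^2 * g^2 + 3 * x^2 * f * g - 3 * x * y * f^2 + y^2 * g * h - y * z * g^2"
    define a3 where "a3 = c * y * z * h^2 - c * z^2 * g * h + 3 * x^2 * f * h - 3 * x * z * f^2 - y^2 * h^2 + z^2 * g^2"
    define b1 where "b1 = - (c^3 * x * z * h^2) - c^3 * z^2 * f * h + c^2 * x * y * h^2 + 2 * c^2 * x * z * g * h + c * y^2 * f * h + 2 * c * y * z * f * g - x * y * g^2 - y^2 * f * g"
    define b2 where "b2 = - (c^3 * y * z * h^2) - c^3 * z^2 * g * h + 3 * c^2 * x^2 * f * h + 3 * c^2 * x * z * f^2 + c^2 * y^2 * h^2 + 2 * c^2 * y * z * g * h - 3 * c * x^2 * f * g - 2 * c * y^2 * g * h - c * y * z * g^2 + y^2 * g^2"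
    define b3 where "b3 = c^3 * z^2 * h^2 - 2 * c^2 * y * z * h^2 - c^2 * z^2 * g * h + 3 * c * x * z * f^2 + c * y^2 * h^2 + 2 * c * y * z * g * h - 3 * x^2 * f * g - 3 * x * y * f^2 - y^2 * g * h - y * z * g^2"
    have a: "chord (E_form A B) p n = (a1, a2, a3)"
      unfolding chord_def pv nv polar_E
      by (simp add: a1_def a2_def a3_def c_def algebra_simps power2_eq_square)
    have b: "chord (E_form A B) (rot_E c p) (unrot_E c n) = smul3 (c^3) (b1, b2, b3)"
      unfolding pv nv chord_rot_unrot[OF c_def] b1_def b2_def b3_def ..
    have "(b1, b2, b3) \<noteq> 0" using nz by (auto simp: c_def [symmetric] b smul3_eq_0_iff simp del: smul3.simps)
    moreover have "a1 * b2 = a2 * b1" "a1 * b3 = a3 * b1" "a2 * b3 = a3 * b2"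
      unfolding a1_def a2_def a3_def b1_def b2_def b3_def
      by (simp_all add: algebra_simps power2_eq_square power3_eq_cube e e' m m')
    ultimately have "proj (a1, a2, a3) = proj (b1, b2, b3)"
      using nz' unfolding a by (intro proj_eq_of_minors)
    then show ?thesis unfolding t a c_def [symmetric] b using c by (simp add: proj_smul del: smul3.simps)
  qed
qed

end

section \<open>Maps given by forms over the base field\<close>

lemma ac_form_selmer: "ac_form (selmer_form A B) = selmer_form (to_ac A) (to_ac B)"
  by (simp add: ac_form_def selmer_form_def fun_eq_iff)

lemma ac_form_E: "ac_form (E_form A B) = E_form (to_ac A) (to_ac B)"
  by (simp add: ac_form_def E_form_def fun_eq_iff)

definition mono_fun :: "'a::field \<Rightarrow> nat \<Rightarrow> nat \<Rightarrow> nat \<Rightarrow> 'a alg_closure vec3 \<Rightarrow> 'a alg_closure" where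
  "mono_fun a i j l = (\<lambda>(x, y, z). to_ac a * x ^ i * y ^ j * z ^ l)"

text \<open>
  The functions on geometric vectors given by a form of degree \<open>d\<close> with coefficients in the base
  field.  As the span of monomials they are visibly closed under the operations needed to compose
  formulas; \<open>kform_form\<close> recovers the coefficients.
\<close>

inductive kform :: "nat \<Rightarrow> ('a::field alg_closure vec3 \<Rightarrow> 'a alg_closure) \<Rightarrow> bool" where
  kform_zero: "kform d (\<lambda>_. 0)"
| kform_mono: "i + j + l = d \<Longrightarrow> kform d (mono_fun a i j l)"
| kform_add: "kform d f \<Longrightarrow> kform d g \<Longrightarrow> kform d (\<lambda>w. f w + g w)"

lemma kform_form:
  "kform d f \<Longrightarrow> \<exists>g. \<forall>w. form_eval d (ac_form g) w = f w"
proof (induction rule: kform.induct)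
  case (kform_zero d)
  show ?case by (rule exI[of _ "\<lambda>i j. 0"]) (simp add: form_eval_def ac_form_def split: prod.splits)
next
  case (kform_mono i j l d a)
  define g where "g = (\<lambda>i' j'. if i' = i then (if j' = j then a else 0) else 0)"
  have "form_eval d (ac_form g) (x, y, z) = mono_fun a i j l (x, y, z)" for x y z
  proof -
    define T where "T i' j' = to_ac (g i' j') * x^i' * y^j' * z^(d - i' - j')" for i' j'
    have T0: "T i' j' = 0" if "i' \<noteq> i \<or> j' \<noteq> j" for i' j' using that by (auto simp: T_def g_def)
    have "form_eval d (ac_form g) (x, y, z) = (\<Sum>i'\<le>d. \<Sum>j'\<le>d - i'. T i' j')"
      by (simp add: form_eval_def ac_form_def T_def)
    also have "\<dots> = (\<Sum>j'\<le>d - i. T i j')"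
      using kform_mono by (subst sum.mono_neutral_right[of _ "{i}"]) (auto simp: T0)
    also have "\<dots> = T i j"
      using kform_mono by (subst sum.mono_neutral_right[of _ "{j}"]) (auto simp: T0)
    also have "\<dots> = to_ac a * x^i * y^j * z^l" using kform_mono by (auto simp: T_def g_def)
    finally show ?thesis using kform_mono by (auto simp: mono_fun_def)
  qed
  then show ?case by (intro exI[of _ g]) auto
next
  case (kform_add d f g)
  then obtain f' g' where *: "\<forall>w. form_eval d (ac_form f') w = f w" "\<forall>w. form_eval d (ac_form g') w = g w"
    by blast
  have "form_eval d (ac_form (\<lambda>i j. f' i j + g' i j)) (x, y, z) =
    form_eval d (ac_form f') (x, y, z) + form_eval d (ac_form g') (x, y, z)" for x y z
    by (simp add: form_eval_def ac_form_def sum.distrib [symmetric] algebra_simps)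
  then show ?case using * by (intro exI[of _ "\<lambda>i j. f' i j + g' i j"]) auto
qed

lemma kform_mult:
  assumes "kform d f" "kform e g"
  shows "kform (d + e) (\<lambda>w. f w * g w)"
  using assms(1)
proof (induction rule: kform.induct)
  case (kform_zero d)
  then show ?case by (simp add: kform.kform_zero)
next
  case (kform_mono i j l d a)
  note d = kform_mono
  show ?case using assms(2)
  proof (induction rule: kform.induct)
    case (kform_zero e)
    then show ?case by (simp add: kform.kform_zero)
  next
    case (kform_mono i' j' l' e b)
    have "(\<lambda>w. mono_fun a i j l w * mono_fun b i' j' l' w) = mono_fun (a * b) (i + i') (j + j') (l + l')"
      by (auto simp: mono_fun_def power_add fun_eq_iff)
    moreover have "(i + i') + (j + j') + (l + l') = d + e" using d kform_mono by simp
    ultimately show ?case by (simp add: kform.kform_mono)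
  next
    case (kform_add e f g)
    then show ?case by (simp add: distrib_left kform.kform_add)
  qed
next
  case (kform_add d f g)
  then show ?case by (simp add: distrib_right kform.kform_add)
qed

lemma kform_const: "kform 0 (\<lambda>_. to_ac a)"
  using kform_mono[of 0 0 0 0 a] by (simp add: mono_fun_def case_prod_unfold)

lemma kform_scale: "kform d f \<Longrightarrow> kform d (\<lambda>w. to_ac a * f w)"
  using kform_mult[OF kform_const] by force

lemma kform_diff: "kform d f \<Longrightarrow> kform d g \<Longrightarrow> kform d (\<lambda>w. f w - g w)"
  using kform_add[OF _ kform_scale[of d g "- 1"], of f] by simp

definition vform :: "nat \<Rightarrow> ('a::field alg_closure vec3 \<Rightarrow> 'a alg_closure vec3) \<Rightarrow> bool" where
  "vform d G \<longleftrightarrow> kform d (\<lambda>w. fst (G w)) \<and> kform d (\<lambda>w. fst (snd (G w))) \<and> kform d (\<lambda>w. snd (snd (G w)))"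

lemma is_morphismI:
  assumes maps: "f ` cubic_points (ac_form c) \<subseteq> cubic_points (ac_form c')"
    and loc: "\<And>v. v \<noteq> 0 \<Longrightarrow> form_eval 3 (ac_form c) v = 0 \<Longrightarrow>
       \<exists>d G. vform d G \<and> G v \<noteq> 0 \<and>
         (\<forall>w. w \<noteq> 0 \<and> form_eval 3 (ac_form c) w = 0 \<and> G w \<noteq> 0 \<longrightarrow> f (proj w) = proj (G w))"
  shows "is_morphism c c' f"
  unfolding is_morphism_def
proof (intro conjI allI impI)
  show "f ` cubic_points (ac_form c) \<subseteq> cubic_points (ac_form c')" by fact
  fix v assume v: "v \<noteq> 0 \<and> form_eval 3 (ac_form c) v = 0"
  obtain d G where G: "vform d G" "G v \<noteq> 0"
    "\<forall>w. w \<noteq> 0 \<and> form_eval 3 (ac_form c) w = 0 \<and> G w \<noteq> 0 \<longrightarrow> f (proj w) = proj (G w)"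
    using loc[OF conjunct1[OF v] conjunct2[OF v]] by (elim exE conjE)
  obtain g0 g1 g2 where g: "\<forall>w. form_eval d (ac_form g0) w = fst (G w)"
    "\<forall>w. form_eval d (ac_form g1) w = fst (snd (G w))" "\<forall>w. form_eval d (ac_form g2) w = snd (snd (G w))"
    using G(1) unfolding vform_def by (meson kform_form)
  have e: "(form_eval d (ac_form g0) w, form_eval d (ac_form g1) w, form_eval d (ac_form g2) w) = G w" for w
    by (simp only: g[rule_format] prod.collapse)
  show "\<exists>d g0 g1 g2.
           let g = (\<lambda>w. (form_eval d (ac_form g0) w, form_eval d (ac_form g1) w,
                         form_eval d (ac_form g2) w))
           in g v \<noteq> 0 \<and>
              (\<forall>w. w \<noteq> 0 \<and> form_eval 3 (ac_form c) w = 0 \<and> g w \<noteq> 0 \<longrightarrow>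
                 f (proj w) = proj (g w))"
    unfolding Let_def
    by (rule exI[of _ d], rule exI[of _ g0], rule exI[of _ g1], rule exI[of _ g2], unfold e)
      (use G(2,3) in blast)
qed

lemma vform_neg_E:
  assumes "vform d p" shows "vform d (\<lambda>w. neg_E (to_ac c) (p w))"
  using assms unfolding vform_def neg_E_def
  by (simp add: case_prod_unfold kform_diff kform_scale)

lemma vform_rot_E:
  assumes "vform d p" shows "vform d (\<lambda>w. rot_E (to_ac c) (p w))"
proof -
  have "kform d (\<lambda>w. to_ac (- (c^2)) * snd (snd (p w)))"
    using assms unfolding vform_def by (intro kform_scale) blast
  then show ?thesis using assms unfolding vform_def rot_E_def
    by (simp add: case_prod_unfold kform_diff kform_scale)
qed

lemma vform_chord:
  assumes "vform d p"
  shows "vform (2 * d) (\<lambda>w. chord (E_form (to_ac A) (to_ac B)) (p w) (map3 to_ac q))"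
proof -
  obtain q1 q2 q3 where q: "q = (q1, q2, q3)" by (cases q)
  define p1 p2 p3 where "p1 = (\<lambda>w. fst (p w))" and "p2 = (\<lambda>w. fst (snd (p w)))"
    and "p3 = (\<lambda>w. snd (snd (p w)))"
  have k: "kform d p1" "kform d p2" "kform d p3"
    using assms unfolding vform_def p1_def p2_def p3_def by auto
  have pw: "p w = (p1 w, p2 w, p3 w)" for w by (simp add: p1_def p2_def p3_def)
  define l where "l = (\<lambda>w. to_ac (- 3 * q1^2) * p1 w + to_ac (2 * q2 * q3 - A * B * q3^2) * p2 w
      + to_ac (q2^2 - 2 * A * B * q2 * q3) * p3 w)"
  define m where "m = (\<lambda>w. to_ac (- 3 * q1) * (p1 w * p1 w) + to_ac (2 * q2 - 2 * A * B * q3) * (p2 w * p3 w)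
      + to_ac (- A * B * q2) * (p3 w * p3 w) + to_ac q3 * (p2 w * p2 w))"
  have l: "kform d l" unfolding l_def by (intro kform_add kform_scale k)
  have m: "kform (d + d) m" unfolding m_def by (intro kform_add kform_scale kform_mult k)
  have "chord (E_form (to_ac A) (to_ac B)) (p w) (map3 to_ac q) =
     (l w * p1 w - to_ac q1 * m w, l w * p2 w - to_ac q2 * m w, l w * p3 w - to_ac q3 * m w)" for w
    unfolding chord_def pw q map3.simps polar_E l_def m_def
    by (simp add: algebra_simps power2_eq_square)
  then show ?thesis unfolding vform_def mult_2 using k l m
    by (simp add: kform_diff kform_scale kform_mult)
qed

section \<open>The map of degree 3 and its translates\<close>

definition phi :: "'a::field \<Rightarrow> 'a vec3 \<Rightarrow> 'a vec3" where
  "phi a = (\<lambda>(x, y, z). (a * x * y * z, a * y^3, z^3))"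

lemma vform_phi: "vform 3 (phi (to_ac a))"
proof -
  have "(\<lambda>w. fst (phi (to_ac a) w)) = mono_fun a 1 1 1"
    "(\<lambda>w. fst (snd (phi (to_ac a) w))) = mono_fun a 0 3 0"
    "(\<lambda>w. snd (snd (phi (to_ac a) w))) = mono_fun 1 0 0 3"
    by (auto simp: phi_def mono_fun_def fun_eq_iff)
  then show ?thesis unfolding vform_def by (simp add: kform_mono)
qed

lemma phi_smul: "phi a (smul3 k v) = smul3 (k^3) (phi a v)"
  by (cases v) (simp add: phi_def power3_eq_cube)

lemma selmer_map_proj: "selmer_map a (proj v) = proj (phi a v)"
proof -
  have "selmer_map a (proj v) = {smul3 k (phi a u) | k u. k \<noteq> 0 \<and> u \<in> proj v}"
    unfolding selmer_map_def phi_def by auto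
  also have "\<dots> = proj (phi a v)"
  proof (intro equalityI subsetI)
    fix p assume "p \<in> {smul3 k (phi a u) | k u. k \<noteq> 0 \<and> u \<in> proj v}"
    then obtain k l where "k \<noteq> 0" "l \<noteq> 0" "p = smul3 k (phi a (smul3 l v))"
      unfolding proj_def by blast
    then have "k * l^3 \<noteq> 0" "p = smul3 (k * l^3) (phi a v)" by (simp_all add: phi_smul smul3_assoc)
    then show "p \<in> proj (phi a v)" unfolding proj_def by blast
  next
    fix p assume "p \<in> proj (phi a v)"
    then show "p \<in> {smul3 k (phi a u) | k u. k \<noteq> 0 \<and> u \<in> proj v}"
      using self_in_proj[of v] unfolding proj_def[of "phi a v"] by blast
  qed
  finally show ?thesis .
qed

lemma phi_on:
  fixes a b :: "'a::field"
  assumes "a \<noteq> 0" "v \<noteq> 0" "form_eval 3 (selmer_form a b) v = 0"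
  shows "phi a v \<noteq> 0" "form_eval 3 (E_form a b) (phi a v) = 0"
proof -
  obtain x y z where v: "v = (x, y, z)" by (cases v)
  have e: "y^3 = a * x^3 + b * z^3" using assms(3) by (simp add: v form_eval_selmer diff_eq_eq add.commute)
  have "form_eval 3 (E_form a b) (phi a v) = a^2 * y^3 * z^3 * (y^3 - a * x^3 - b * z^3)"
    unfolding v phi_def prod.case form_eval_E by (simp add: algebra_simps eval_nat_numeral)
  then show "form_eval 3 (E_form a b) (phi a v) = 0" by (simp add: e)
  show "phi a v \<noteq> 0" using assms(1,2) e by (auto simp: v phi_def zero_vec3)
qed

lemma ac_point_proj: "ac_point (proj v) = proj (map3 to_ac v)"
proof -
  have *: "map3 to_ac (smul3 l v) = smul3 (to_ac l) (map3 to_ac v)" for l by (cases v) simp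
  show ?thesis
  proof (intro equalityI subsetI)
    fix p assume "p \<in> ac_point (proj v)"
    then obtain k l where "k \<noteq> 0" "l \<noteq> 0" "p = smul3 k (map3 to_ac (smul3 l v))"
      unfolding ac_point_def proj_def by blast
    then have "k * to_ac l \<noteq> 0" "p = smul3 (k * to_ac l) (map3 to_ac v)" by (simp_all add: * smul3_assoc)
    then show "p \<in> proj (map3 to_ac v)" unfolding proj_def by blast
  next
    fix p assume "p \<in> proj (map3 to_ac v)"
    then show "p \<in> ac_point (proj v)" using self_in_proj[of v]
      unfolding ac_point_def proj_def[of "map3 to_ac v"] by blast
  qed
qed

lemma card_cube_roots:
  fixes e :: "'a::{alg_closed_field, field_char_0}"
  assumes "e \<noteq> 0"
  shows "card {y. y^3 = e} = 3"
proof -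
  have "degree [:1, 1, 1 :: 'a:] > 0" by simp
  then obtain \<omega> :: 'a where "poly [:1, 1, 1:] \<omega> = 0" using alg_closed_imp_poly_has_root by blast
  then have w: "\<omega>^2 + \<omega> + 1 = 0" by (simp add: algebra_simps power2_eq_square)
  obtain \<beta> where b: "\<beta>^3 = e" using nth_root_exists[of 3 e] by auto
  have b0: "\<beta> \<noteq> 0" using b assms by auto
  have w1: "\<omega> \<noteq> 1" "\<omega>^2 \<noteq> 1" "\<omega>^2 \<noteq> \<omega>"
  proof -
    show w1: "\<omega> \<noteq> 1" using w by auto
    show "\<omega>^2 \<noteq> \<omega>"
    proof
      assume *: "\<omega>^2 = \<omega>"
      then have "\<omega> = 0" using w1 by (simp add: power2_eq_square)
      then show False using w by simp
    qed
    show "\<omega>^2 \<noteq> 1"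
    proof
      assume *: "\<omega>^2 = 1"
      then have "\<omega> = - 2" using w by (simp add: eq_neg_iff_add_eq_0 algebra_simps)
      then show False using * by simp
    qed
  qed
  have fac: "y^3 - \<beta>^3 = (y - \<beta>) * (y - \<omega> * \<beta>) * (y - \<omega>^2 * \<beta>)" for y
  proof -
    have w3: "\<omega>^3 = 1"
    proof -
      have "\<omega>^3 - 1 = (\<omega> - 1) * (\<omega>^2 + \<omega> + 1)"
        by (simp add: algebra_simps power2_eq_square power3_eq_cube)
      then show ?thesis by (simp add: w)
    qed
    have "(y - \<beta>) * (y - \<omega> * \<beta>) * (y - \<omega>^2 * \<beta>) =
       y^3 - (\<omega>^2 + \<omega> + 1) * \<beta> * y^2 + \<omega> * (\<omega>^2 + \<omega> + 1) * \<beta>^2 * y - \<omega>^3 * \<beta>^3"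
      by (simp add: algebra_simps power2_eq_square power3_eq_cube)
    then show ?thesis by (simp add: w w3)
  qed
  have "{y. y^3 = e} = {\<beta>, \<omega> * \<beta>, \<omega>^2 * \<beta>}"
    using fac unfolding b by (auto simp: set_eq_iff) (metis eq_iff_diff_eq_0 mult_eq_0_iff)+
  moreover have "\<beta> \<noteq> \<omega> * \<beta>" "\<beta> \<noteq> \<omega>^2 * \<beta>" "\<omega> * \<beta> \<noteq> \<omega>^2 * \<beta>" using b0 w1 by auto
  ultimately show ?thesis by simp
qed

lemma chord_third:
  assumes "line_cubic c" "p \<noteq> 0" "form_eval 3 c p = 0" "q \<noteq> 0" "form_eval 3 c q = 0" "proj p \<noteq> proj q"
  shows "chord c p q \<noteq> 0" "form_eval 3 c (chord c p q) = 0"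
    "third_point c (proj p) (proj q) = proj (chord c p q)"
proof -
  interpret line_cubic c by fact
  have ind: "indep p q" using assms by (simp add: indep_iff)
  show nz: "chord c p q \<noteq> 0"
    unfolding chord_def
    by (rule indep_nonzero[OF ind]) (use third_chord(1)[OF assms(3,5) ind] in auto)
  show t: "third_point c (proj p) (proj q) = proj (chord c p q)"
    unfolding chord_def by (rule third_chord(3)[OF assms(3,5) ind])
  have "third_point c (proj p) (proj q) \<in> cubic_points c"
    using assms by (intro third_closed cubic_pointsI)
  then show "form_eval 3 c (chord c p q) = 0" unfolding t using nz by (simp add: proj_in_cubic_points_iff)
qed

text \<open>
  The points \<open>p + S\<close> and \<open>p - S\<close> differ, because \<open>2 S\<close> is not the identity.  This is what makes the second
  formula nondegenerate where the first one fails.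
\<close>

lemma rot_unrot_distinct:
  fixes A B :: "'a::field_char_0"
  assumes AB: "A * B \<noteq> 0" and p: "p \<noteq> 0" "form_eval 3 (E_form A B) p = 0"
  shows "proj (rot_E (A * B) p) \<noteq> proj (unrot_E (A * B) p)"
proof
  assume eq: "proj (rot_E (A * B) p) = proj (unrot_E (A * B) p)"
  define c where "c = A * B"
  have c: "c \<noteq> 0" using AB by (simp add: c_def)
  obtain x y z where v: "p = (x, y, z)" by (cases p)
  obtain k where k: "k \<noteq> 0" "rot_E c p = smul3 k (unrot_E c p)"
    using eq by (auto simp: c_def proj_eq_iff)
  then have k': "c * x = k * (c * x)" "- (c^2 * z) = k * (c^2 * z - c * y)" "y - c * z = - k * y"
    by (simp_all add: v rot_E_def unrot_E_def)
  have "c * (- (c * z)) = c * (k * (c * z - y))" using k'(2) by (simp add: algebra_simps power2_eq_square)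
  then have k2: "- (c * z) = k * (c * z - y)" using mult_left_cancel[OF c] by blast
  have F: "y^2 * z - c * y * z^2 - x^3 = 0" using p(2) by (simp add: v form_eval_E c_def)
  show False
  proof (cases "x = 0")
    case False
    then have "k = 1" using k'(1) c by simp
    then have e: "y = 2 * (c * z)" "2 * y = c * z" using k2 k'(3) by (simp_all add: algebra_simps)
    then have "3 * (c * z) = 0" by (simp add: algebra_simps)
    then have "c * z = 0" by simp
    then have "z = 0" "y = 0" using e c by auto
    then show False using F False by simp
  next
    case True
    then have "z * (y * (y - c * z)) = 0" using F by (simp add: algebra_simps power2_eq_square)
    then consider "z = 0" | "y = 0" | "y = c * z" by auto
    then have "y = 0 \<and> z = 0"
    proof cases
      case 1
      then show ?thesis using k2 k(1) by simp
    next
      case 2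
      then show ?thesis using k'(3) c by simp
    next
      case 3
      then show ?thesis using k2 c by simp
    qed
    then show False using p(1) True by (simp add: v zero_vec3)
  qed
qed

context
  fixes A B :: "'a::field_char_0"
  assumes A0: "A \<noteq> 0" and B0: "B \<noteq> 0"
begin

private abbreviation (input) "a \<equiv> to_ac A"
private abbreviation (input) "b \<equiv> to_ac B"
private abbreviation (input) "C \<equiv> cubic_points (selmer_form a b)"
private abbreviation (input) "E \<equiv> cubic_points (E_form a b)"

lemma ab: "a * b \<noteq> 0" using A0 B0 by simp

interpretation E: line_cubic "E_form a b"
  by (rule line_cubic_E) (rule ab)

lemma smooth_selmer: "smooth_cubic (selmer_form A B)"
  unfolding smooth_cubic_def ac_form_selmer
proof (safe)
  fix v1 v2 v3 assume *: "(v1, v2, v3) \<noteq> 0"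
    "form_eval 2 (form_dX (selmer_form a b)) (v1, v2, v3) = 0"
    "form_eval 2 (form_dY (selmer_form a b)) (v1, v2, v3) = 0"
    "form_eval 2 (form_dZ 3 (selmer_form a b)) (v1, v2, v3) = 0"
  obtain e where "polar (selmer_form a b) (v1, v2, v3) e \<noteq> 0"
    using selmer_gradient[of a b "(v1, v2, v3)"] *(1) A0 B0 by auto
  then show False using * by (simp add: polar_def)
qed

lemma smooth_E: "smooth_cubic (E_form A B)"
  unfolding smooth_cubic_def ac_form_E
proof (safe)
  fix v1 v2 v3 assume *: "(v1, v2, v3) \<noteq> 0" "form_eval 3 (E_form a b) (v1, v2, v3) = 0"
    "form_eval 2 (form_dX (E_form a b)) (v1, v2, v3) = 0"
    "form_eval 2 (form_dY (E_form a b)) (v1, v2, v3) = 0"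
    "form_eval 2 (form_dZ 3 (E_form a b)) (v1, v2, v3) = 0"
  obtain e where "polar (E_form a b) (v1, v2, v3) e \<noteq> 0"
    using E.smooth_pt *(1,2) by blast
  then show False using * by (simp add: polar_def)
qed

lemma selmer_map_closed:
  assumes "P \<in> C" shows "selmer_map a P \<in> E"
proof -
  obtain p where p: "P = proj p" "p \<noteq> 0" "form_eval 3 (selmer_form a b) p = 0"
    using assms by (rule cubic_pointsE)
  show ?thesis unfolding p(1) selmer_map_proj
    using phi_on[OF _ p(2,3)] A0 by (intro cubic_pointsI) simp_all
qed

lemma selmer_map_morphism: "is_morphism (selmer_form A B) (E_form A B) (selmer_map a)"
proof (rule is_morphismI, unfold ac_form_selmer ac_form_E)
  show "selmer_map a ` C \<subseteq> E" using selmer_map_closed by blast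
  fix v :: "'a alg_closure vec3"
  assume v: "v \<noteq> 0" "form_eval 3 (selmer_form a b) v = 0"
  show "\<exists>d G. vform d G \<and> G v \<noteq> 0 \<and> (\<forall>w. w \<noteq> 0 \<and> form_eval 3 (selmer_form a b) w = 0 \<and> G w \<noteq> 0 \<longrightarrow>
      selmer_map a (proj w) = proj (G w))"
    using phi_on(1)[OF _ v] A0 by (intro exI[of _ 3] exI[of _ "phi a"]) (simp add: vform_phi selmer_map_proj)
qed

text \<open>
  For \<open>y \<noteq> 0\<close> a preimage \<open>(X, Y)\<close> of \<open>(x, y)\<close> is determined by \<open>Y\<close>, which can be any cube root of \<open>y / A\<close>.
\<close>

lemma selmer_map_fibre:
  assumes Q: "Q \<in> E" "Q \<noteq> E_infinity" "Q \<noteq> proj (0, 0, 1)"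
  shows "card {P \<in> C. selmer_map a P = Q} = 3"
proof -
  obtain q where q: "Q = proj q" "q \<noteq> 0" "form_eval 3 (E_form a b) q = 0"
    using Q(1) by (rule cubic_pointsE)
  obtain x' y' z' where q': "q = (x', y', z')" by (cases q)
  have z': "z' \<noteq> 0"
  proof
    assume z: "z' = 0"
    then have x: "x' = 0" using q(3) by (simp add: q' form_eval_E)
    then have "Q = E_infinity" unfolding q(1) q' E_infinity_def proj_eq_iff using z q(2)
      by (intro exI[of _ y']) (auto simp: q' zero_vec3)
    then show False using Q(2) by simp
  qed
  define x y where "x = x' / z'" and "y = y' / z'"
  have Qxy: "Q = proj (x, y, 1)"
    unfolding q(1) q' proj_eq_iff x_def y_def using z' by (intro exI[of _ z']) simp
  have F: "y^2 - a * b * y = x^3"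
    using Q(1) unfolding Qxy E_affine_iff .
  have y: "y \<noteq> 0"
  proof
    assume "y = 0"
    then have "x = 0" using F by simp
    then show False using Q(3) \<open>y = 0\<close> by (simp add: Qxy)
  qed
  define g where "g t = proj (x / (a * t), t, 1)" for t
  have "inj_on g {t. t^3 = y / a}"
    by (rule inj_onI) (auto simp: g_def proj_eq_iff)
  then have "card (g ` {t. t^3 = y / a}) = card {t. t^3 = y / a}" by (rule card_image)
  also have "\<dots> = 3" using y A0 by (intro card_cube_roots) simp
  also have "g ` {t. t^3 = y / a} = {P \<in> C. selmer_map a P = Q}"
  proof (intro equalityI subsetI)
    fix P assume "P \<in> g ` {t. t^3 = y / a}"
    then obtain t where t: "t^3 = y / a" "P = proj (x / (a * t), t, 1)" by (auto simp: g_def)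
    have t0: "t \<noteq> 0" using t(1) y A0 by auto
    have at: "a * t^3 = y" using t(1) A0 by simp
    have "t^3 = a * (x / (a * t))^3 + b"
    proof -
      have "a * (x / (a * t))^3 = x^3 / (a * (a * t^3))"
        using A0 by (simp add: power_divide power_mult_distrib power3_eq_cube mult_ac)
      also have "\<dots> = y / a - b" unfolding at F [symmetric] using y A0
        by (simp add: field_simps power2_eq_square)
      finally show ?thesis by (simp add: t(1))
    qed
    then have "P \<in> C" unfolding t(2) selmer_affine_iff .
    moreover have "selmer_map a P = Q"
      unfolding t(2) selmer_map_proj Qxy phi_def using t0 A0 by (simp add: at)
    ultimately show "P \<in> {P \<in> C. selmer_map a P = Q}" by simp
  next
    fix P assume "P \<in> {P \<in> C. selmer_map a P = Q}"
    then have P: "P \<in> C" "selmer_map a P = Q" by auto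
    obtain p where p: "P = proj p" "p \<noteq> 0" "form_eval 3 (selmer_form a b) p = 0"
      using P(1) by (rule cubic_pointsE)
    obtain p1 p2 p3 where p': "p = (p1, p2, p3)" by (cases p)
    obtain k where k: "k \<noteq> 0" "phi a p = smul3 k (x, y, 1)"
      using P(2) unfolding p(1) selmer_map_proj Qxy proj_eq_iff by blast
    then have e: "a * p1 * p2 * p3 = k * x" "a * p2^3 = k * y" "p3^3 = k"
      by (simp_all add: p' phi_def)
    have p3: "p3 \<noteq> 0" using e(3) k(1) by auto
    have p2: "p2 \<noteq> 0" using e(2) k(1) y A0 by auto
    have "P = g (p2 / p3)"
    proof -
      have "x / (a * (p2 / p3)) = p1 / p3"
      proof -
        have "x * p3^3 = a * p1 * p2 * p3" using e by (simp add: mult.commute)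
        then have "x * p3 * p3 = a * p1 * p2" using p3 by (simp add: power3_eq_cube mult.assoc)
        then show ?thesis using p2 p3 A0 by (simp add: field_simps)
      qed
      then show ?thesis unfolding g_def p(1) p' proj_eq_iff using p3
        by (intro exI[of _ p3]) simp
    qed
    moreover have "(p2 / p3)^3 = y / a"
      using e p3 A0 k(1) by (simp add: power_divide field_simps)
    ultimately show "P \<in> g ` {t. t^3 = y / a}" by blast
  qed
  finally show ?thesis by simp
qed

lemma selmer_map_exceptional:
  "finite {Q \<in> E. card {P \<in> C. selmer_map a P = Q} \<noteq> 3}"
  by (rule finite_subset[of _ "{E_infinity, proj (0, 0, 1)}"]) (use selmer_map_fibre in auto)

lemma selmer_map_degree: "has_degree (selmer_form A B) (E_form A B) (selmer_map a) 3"
  unfolding has_degree_def ac_form_selmer ac_form_E using selmer_map_exceptional by simp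

text \<open>
  Write \<open>n\<close> for the inverse of the image of \<open>Z\<close>.  Translation by \<open>n\<close> is a bijection, hence preserves the
  sizes of fibres, and near a point \<open>v\<close> it is given by forms: by the chord formula if the image of
  \<open>v\<close> is not \<open>n\<close>, and by the chord formula after shifting by \<open>S\<close> and \<open>- S\<close> if it is.
\<close>

lemma translated_isogeny:
  assumes Z: "Z \<in> cubic_points (selmer_form A B)"
  shows "let G = mw_group (ac_form (E_form A B)) E_infinity in
          is_isogeny (selmer_form A B) Z (E_form A B) E_infinity
            (\<lambda>P. selmer_map a P \<otimes>\<^bsub>G\<^esub> inv\<^bsub>G\<^esub> (selmer_map a (ac_point Z))) 3"
proof -
  define G where "G = mw_group (E_form a b) E_infinity"
  define f where "f P = selmer_map a P \<otimes>\<^bsub>G\<^esub> inv\<^bsub>G\<^esub> (selmer_map a (ac_point Z))" for P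
  obtain z0 where z0: "Z = proj z0" "z0 \<noteq> 0" "form_eval 3 (selmer_form A B) z0 = 0"
    using Z by (rule cubic_pointsE)
  define zv where "zv = map3 to_ac z0"
  have zv: "zv \<noteq> 0" "form_eval 3 (selmer_form a b) zv = 0"
  proof -
    obtain x y z where v: "z0 = (x, y, z)" by (cases z0)
    show "zv \<noteq> 0" using z0(2) by (simp add: zv_def v zero_vec3)
    have "form_eval 3 (selmer_form a b) zv = to_ac (form_eval 3 (selmer_form A B) z0)"
      by (simp add: zv_def v form_eval_selmer)
    then show "form_eval 3 (selmer_form a b) zv = 0" by (simp add: z0)
  qed
  have Zac: "ac_point Z = proj zv" by (simp add: z0(1) ac_point_proj zv_def)
  then have ZC: "ac_point Z \<in> C" using zv by (simp add: cubic_pointsI)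
  have pz: "phi a zv \<noteq> 0" "form_eval 3 (E_form a b) (phi a zv) = 0"
    using phi_on[OF _ zv] A0 by simp_all
  define n0 where "n0 = neg_E (A * B) (phi A z0)"
  define n where "n = map3 to_ac n0"
  have n_eq: "n = neg_E (a * b) (phi a zv)"
    by (cases z0) (simp add: n_def n0_def zv_def neg_E_def phi_def)
  have n: "n \<noteq> 0" "form_eval 3 (E_form a b) n = 0"
    unfolding n_eq using neg_E_on[OF ab pz] .
  have O: "E_infinity \<in> E" by (rule E_infinity_on[OF ab])
  have nE: "proj n \<in> E" using n by (rule cubic_pointsI)
  have OO: "E.third E_infinity E_infinity = E_infinity"
  proof -
    have o: "(0, 1, 0) \<noteq> (0 :: 'a alg_closure vec3)" "form_eval 3 (E_form a b) (0, 1, 0) = 0"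
      by (simp_all add: zero_vec3 form_eval_E)
    have "E.third E_infinity E_infinity = proj (neg_E (a * b) (0, 1, 0))"
      using third_infinity[OF ab o] by (simp add: E_infinity_def)
    also have "\<dots> = E_infinity"
      unfolding neg_E_def E_infinity_def proj_eq_iff by (intro exI[of _ "- 1"]) simp
    finally show ?thesis .
  qed
  have inv: "inv\<^bsub>G\<^esub> (selmer_map a (ac_point Z)) = proj n"
  proof -
    have "inv\<^bsub>G\<^esub> (proj (phi a zv)) = E.third (proj (phi a zv)) E_infinity"
      unfolding G_def using E.inv_mw_group[OF O] pz by (simp add: cubic_pointsI OO)
    also have "\<dots> = E.third E_infinity (proj (phi a zv))"
      using pz O by (intro E.third_commute) (simp_all add: cubic_pointsI)
    also have "\<dots> = proj n" unfolding n_eq by (rule third_infinity[OF ab pz])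
    finally show ?thesis unfolding Zac selmer_map_proj .
  qed
  have f_eq: "f P = E.third E_infinity (E.third (selmer_map a P) (proj n))" for P
    unfolding f_def inv by (simp add: G_def mw_group_def)
  have f_closed: "f P \<in> E" if "P \<in> C" for P
    unfolding f_eq using selmer_map_closed[OF that] nE O by simp
  have chord_ok: "f (proj w) = proj (neg_E (a * b) q)"
    if "w \<noteq> 0" "form_eval 3 (selmer_form a b) w = 0" "q \<noteq> 0"
      "E.third (proj (phi a w)) (proj n) = proj q" for w q
  proof -
    have pw: "proj (phi a w) \<in> E" using phi_on[OF _ that(1,2)] A0 by (simp add: cubic_pointsI)
    have "proj q \<in> E" unfolding that(4) [symmetric] using pw nE by simp
    then have q: "form_eval 3 (E_form a b) q = 0" using that(3) by (simp add: proj_in_cubic_points_iff)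
    show ?thesis unfolding f_eq selmer_map_proj that(4) by (rule third_infinity[OF ab that(3) q])
  qed
  have neg0: "neg_E k 0 = 0" for k :: "'a alg_closure" by (simp add: neg_E_def zero_vec3)
  have morph: "is_morphism (selmer_form A B) (E_form A B) f"
  proof (rule is_morphismI, unfold ac_form_selmer ac_form_E)
    show "f ` C \<subseteq> E" using f_closed by blast
    fix v :: "'a alg_closure vec3"
    assume v: "v \<noteq> 0" "form_eval 3 (selmer_form a b) v = 0"
    have pv: "phi a v \<noteq> 0" "form_eval 3 (E_form a b) (phi a v) = 0"
      using phi_on[OF _ v] A0 by simp_all
    show "\<exists>d G. vform d G \<and> G v \<noteq> 0 \<and> (\<forall>w. w \<noteq> 0 \<and> form_eval 3 (selmer_form a b) w = 0 \<and> G w \<noteq> 0 \<longrightarrow>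
      f (proj w) = proj (G w))"
    proof (cases "proj (phi a v) = proj n")
      case False
      let ?G = "\<lambda>w. neg_E (to_ac (A * B)) (chord (E_form a b) (phi a w) n)"
      show ?thesis
      proof (intro exI conjI allI impI)
        show "vform (2 * 3) ?G" unfolding n_def by (intro vform_neg_E vform_chord vform_phi)
        show "?G v \<noteq> 0"
          using chord_third[OF E.line_cubic_axioms pv n False] neg_E_on(1)[OF ab] by simp
        fix w assume w: "w \<noteq> 0 \<and> form_eval 3 (selmer_form a b) w = 0 \<and> ?G w \<noteq> 0"
        have pw: "phi a w \<noteq> 0" "form_eval 3 (E_form a b) (phi a w) = 0"
          using phi_on[of a w b] w A0 by simp_all
        have nz: "chord (E_form a b) (phi a w) n \<noteq> 0" using w neg0 by metis
        have "proj (phi a w) \<noteq> proj n" using chord_nonzero_imp[OF pw(2) nz] .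
        then show "f (proj w) = proj (?G w)"
          using chord_ok[of w, OF _ _ nz] chord_third(3)[OF E.line_cubic_axioms pw n] w by simp
      qed
    next
      case True
      let ?G = "\<lambda>w. neg_E (to_ac (A * B)) (chord (E_form a b) (rot_E (to_ac (A * B)) (phi a w))
           (map3 to_ac (unrot_E (A * B) n0)))"
      have un: "map3 to_ac (unrot_E (A * B) n0) = unrot_E (a * b) n"
        by (cases n0) (simp add: n_def unrot_E_def)
      show ?thesis
      proof (intro exI conjI allI impI)
        show "vform (2 * 3) ?G" by (intro vform_neg_E vform_chord vform_rot_E vform_phi)
        show "?G v \<noteq> 0"
        proof -
          obtain k where k: "k \<noteq> 0" "n = smul3 k (phi a v)" using True by (metis proj_eq_iff)
          have "unrot_E (a * b) n = smul3 k (unrot_E (a * b) (phi a v))"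
            unfolding k(2) by (cases "phi a v") (simp add: unrot_E_def algebra_simps)
          then have "proj (unrot_E (a * b) n) = proj (unrot_E (a * b) (phi a v))"
            using k(1) by (simp add: proj_smul)
          then have d: "proj (rot_E (a * b) (phi a v)) \<noteq> proj (unrot_E (a * b) n)"
            using rot_unrot_distinct[OF ab pv] by simp
          show ?thesis
            using chord_third[OF E.line_cubic_axioms rot_E_on(1,2)[OF ab pv] rot_E_on(3,4)[OF ab n] d]
              neg_E_on(1)[OF ab] by (simp add: un)
        qed
        fix w assume w: "w \<noteq> 0 \<and> form_eval 3 (selmer_form a b) w = 0 \<and> ?G w \<noteq> 0"
        have pw: "phi a w \<noteq> 0" "form_eval 3 (E_form a b) (phi a w) = 0"
          using phi_on[of a w b] w A0 by simp_all
        have nz: "chord (E_form a b) (rot_E (a * b) (phi a w)) (unrot_E (a * b) n) \<noteq> 0"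
          using w neg0 unfolding un by (metis to_ac_mult)
        show "f (proj w) = proj (?G w)"
          using chord_ok[of w, OF _ _ nz] third_rot[OF ab pw n nz] w by (simp add: un)
      qed
    qed
  qed
  have base: "f (ac_point Z) = ac_point E_infinity"
  proof -
    have "ac_point E_infinity = (E_infinity :: 'a alg_closure ppoint)"
      by (simp add: E_infinity_def ac_point_proj)
    moreover have "E.third (selmer_map a (ac_point Z)) (proj n) = E_infinity"
    proof -
      have "proj n = E.third E_infinity (selmer_map a (ac_point Z))"
        unfolding Zac selmer_map_proj n_eq by (rule third_infinity[OF ab pz, symmetric])
      then show ?thesis using E.third_commute[OF O selmer_map_closed[OF ZC]]
        by (simp add: O selmer_map_closed ZC)
    qed
    ultimately show ?thesis by (simp add: f_eq OO)
  qed
  have degree: "has_degree (selmer_form A B) (E_form A B) f 3"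
  proof -
    \<comment> \<open>translation by \<open>n\<close> and its inverse\<close>
    define T where "T Q = E.third E_infinity (E.third Q (proj n))" for Q
    define U where "U Q = E.third (E.third E_infinity Q) (proj n)" for Q
    have UT: "T (U Q) = Q \<and> U Q \<in> E" if "Q \<in> E" for Q
      using that O nE by (simp add: T_def U_def E.third_commute[of _ "proj n"])
    have TU: "U (T Q) = Q \<and> T Q \<in> E" if "Q \<in> E" for Q
      using that O nE by (simp add: T_def U_def E.third_commute[of _ "proj n"])
    have fib: "{P \<in> C. f P = Q} = {P \<in> C. selmer_map a P = U Q}" if "Q \<in> E" for Q
      using that UT TU selmer_map_closed unfolding f_eq T_def [symmetric] by metis
    have "{Q \<in> E. card {P \<in> C. f P = Q} \<noteq> 3} \<subseteq> T ` {Q \<in> E. card {P \<in> C. selmer_map a P = Q} \<noteq> 3}"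
    proof
      fix Q assume "Q \<in> {Q \<in> E. card {P \<in> C. f P = Q} \<noteq> 3}"
      then have "Q \<in> E" "card {P \<in> C. selmer_map a P = U Q} \<noteq> 3" using fib by auto
      then show "Q \<in> T ` {Q \<in> E. card {P \<in> C. selmer_map a P = Q} \<noteq> 3}"
        using UT by (intro image_eqI[of _ _ "U Q"]) auto
    qed
    then show ?thesis unfolding has_degree_def ac_form_selmer ac_form_E
      using finite_subset[OF _ finite_imageI[OF selmer_map_exceptional]] by auto
  qed
  have "elliptic_curve (selmer_form A B) Z" "elliptic_curve (E_form A B) E_infinity"
    unfolding elliptic_curve_def using smooth_selmer smooth_E Z E_infinity_on[of A B] A0 B0 by simp_all
  then show ?thesis
    unfolding Let_def is_isogeny_def ac_form_E G_def [symmetric] f_def [symmetric]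
    using morph base degree by blast
qed

end

section \<open>Rank at least three\<close>

theorem mainTheorem3:
  fixes r s t A B u v w :: rat_fun3
  assumes "r = indet_r" and "s = indet_s" and "t = indet_t"
    and "A = 9 * (r^6 - r^3*s^3 + s^6 - r^3*t^3 - s^3*t^3 + t^6)"
    and "B = - ((r + s + t) *
           (r^2 + 2*r*s + s^2 - r*t - s*t + t^2) *
           (r^2 - r*s + s^2 + 2*r*t - s*t + t^2) *
           (r^2 - r*s + s^2 - r*t + 2*s*t + t^2) *
           (r^2 - r*s + s^2 - r*t - s*t + t^2))"
    and "u = 2*t^3 - r^3 - s^3"
    and "v = 2*s^3 - r^3 - t^3"
    and "w = 2*r^3 - s^3 - t^3"
  shows "(w^3 = A * r^3 + B \<and> v^3 = A * s^3 + B \<and> u^3 = A * t^3 + B) \<and>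
    elliptic_curve (E_form A B) E_infinity \<and>
    (\<exists>P Q R. Z_independent (mw_group (E_form A B) E_infinity) [P, Q, R]) \<and>
    (is_morphism (selmer_form A B) (E_form A B) (selmer_map (to_ac A)) \<and>
     has_degree (selmer_form A B) (E_form A B) (selmer_map (to_ac A)) 3) \<and>
    (\<forall>Z \<in> cubic_points (selmer_form A B).
       elliptic_curve (selmer_form A B) Z \<and>
       (let G = mw_group (ac_form (E_form A B)) E_infinity in
          is_isogeny (selmer_form A B) Z (E_form A B) E_infinity
            (\<lambda>P. selmer_map (to_ac A) P \<otimes>\<^bsub>G\<^esub>
                 inv\<^bsub>G\<^esub> (selmer_map (to_ac A) (ac_point Z))) 3) \<and>
       group_rank (mw_group (selmer_form A B) Z) \<ge> 3)"
proof -
  have A0: "A \<noteq> 0" and B0: "B \<noteq> 0" using AB_nonzero[OF assms] by blast+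
  have E: "elliptic_curve (E_form A B) E_infinity"
    unfolding elliptic_curve_def using smooth_E[OF A0 B0] E_infinity_on[of A B] A0 B0 by simp
  show ?thesis
  proof (intro conjI ballI)
    show "w^3 = A * r^3 + B" "v^3 = A * s^3 + B" "u^3 = A * t^3 + B"
      using points_on_selmer[OF assms] by blast+
    show "elliptic_curve (E_form A B) E_infinity" by (fact E)
    show "\<exists>P Q R. Z_independent (mw_group (E_form A B) E_infinity) [P, Q, R]"
      using E_independent[OF assms] by blast
    show "is_morphism (selmer_form A B) (E_form A B) (selmer_map (to_ac A))"
      by (rule selmer_map_morphism[OF A0 B0])
    show "has_degree (selmer_form A B) (E_form A B) (selmer_map (to_ac A)) 3"
      by (rule selmer_map_degree[OF A0 B0])
    fix Z assume Z: "Z \<in> cubic_points (selmer_form A B)"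
    show "elliptic_curve (selmer_form A B) Z"
      unfolding elliptic_curve_def using smooth_selmer[OF A0 B0] Z by blast
    show "let G = mw_group (ac_form (E_form A B)) E_infinity in
          is_isogeny (selmer_form A B) Z (E_form A B) E_infinity
            (\<lambda>P. selmer_map (to_ac A) P \<otimes>\<^bsub>G\<^esub>
                 inv\<^bsub>G\<^esub> (selmer_map (to_ac A) (ac_point Z))) 3"
      by (rule translated_isogeny[OF A0 B0 Z])
    show "group_rank (mw_group (selmer_form A B) Z) \<ge> 3"
      by (rule selmer_rank[OF assms Z])
  qed
qed

end
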